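(* Let $G$ be a compact Lie group, $N\ge 2$, and let $T$ be a coupling tree with $N$ leaves. Let $\alpha_1,\alpha_1'$ be combinable labellings of $T$ and let $\alpha_2,\alpha_2'$ be combinable labellings of $T$. Then the pointwise product of the corresponding modified quasicharacters (functions on $G^N$) is given by $$\hat\chi(T)_{\alpha_1}^{\alpha_1'}\cdot\hat\chi(T)_{\alpha_2}^{\alpha_2'}=\sum_{\alpha,\alpha'}\ \sum_{\underline k,k} R(T)^{\alpha_1'\alpha_2',k}_{\alpha',\underline k}\ \hat\chi(T)_{\alpha}^{\alpha'}\ R(T)_{\alpha_1\alpha_2,k}^{\alpha,\underline k},$$ where the sum is over all combinable labellings $\alpha,\alpha'$ of $T$, all assignments $\underline k$ of a positive integer to every leaf of $T$ and all positive integers $k$ such that $(\alpha,\underline k,k)\in\langle\langle\alpha_1,\alpha_2\rangle\rangle$.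
   Context: Representations. $G$ is a compact Lie group; $\widehat G$ is the set of isomorphism classes of finite-dimensional irreps of $G$, labelled by highest weights $\lambda$. For every $\lambda\in\widehat G$ a concrete unitary irrep $(H_\lambda,D^\lambda)$ is fixed, with an orthonormal weight basis $|\lambda\mu\rangle$, $\mu\in\mathtt w(\lambda)$ (a finite index set of weight labels). For $\underline\lambda=(\lambda^1,\dots,\lambda^N)\in\widehat G^N$ put $H_{\underline\lambda}=\bigotimes_{i}H_{\lambda^i}$ and $D^{\underline\lambda}(\underline a)=\bigotimes_i D^{\lambda^i}(a_i)$ for $\underline a=(a_1,\dots,a_N)\in G^N$; $\mathtt w(\underline\lambda)=\prod_i\mathtt w(\lambda^i)$, and $|\underline\lambda\,\underline\mu\rangle=\bigotimes_i|\lambda^i\mu^i\rangle$. $\langle\underline\lambda\rangle$ is the set of $\lambda\in\widehat G$ occurring in the diagonal representation $a\mapsto D^{\underline\lambda}(a,\dots,a)$ of $G$. For $\lambda_1,\lambda_2\in\widehat G$, $m_{(\lambda_1,\lambda_2)}(\lambda)$ is the multiplicity of $D^\lambda$ in $D^{\lambda_1}\otimes D^{\lambda_2}$ and $\langle\langle\lambda_1,\lambda_2\rangle\rangle=\{(\lambda,k):m_{(\lambda_1,\lambda_2)}(\lambda)>0,\ 1\le k\le m_{(\lambda_1,\lambda_2)}(\lambda)\}$. For every pair $(\lambda_1,\lambda_2)$ a unitary $G$-isomorphism $H_{\lambda_1}\otimes H_{\lambda_2}\cong\bigoplus_{(\lambda,k)\in\langle\langle\lambda_1,\lambda_2\rangle\rangle}H_\lambda$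 is fixed once and for all; $\mathrm i_{(\lambda_1,\lambda_2),\lambda,k}:H_\lambda\to H_{\lambda_1}\otimes H_{\lambda_2}$ are the corresponding isometric injections. Coupling trees. A coupling tree $T$ with $N\geq 2$ leaves is an ordered rooted binary tree: every non-leaf vertex (node) $x$ has exactly two ordered children $x',x''$; the root is a node. A labelling $\alpha$ of $T$ (always assumed admissible) assigns to each leaf $y$ some $\lambda^y\in\widehat G$ and to each node $x$ a pair $\alpha^x=(\lambda^x,k^x)\in\langle\langle\lambda^{x'},\lambda^{x''}\rangle\rangle$. $\mathcal L^T(\underline\lambda,\lambda)$ is the set of labellings with leaf labels $\underline\lambda$ (in leaf order) and root highest weight $\lambda$. Two labellings of $T$ are combinable if they lie in the same set $\mathcal L^T(\underline\lambda,\lambda)$. For $\alpha\in\mathcal L^T(\underline\lambda,\lambda)$ the $G$-equivariant isometric injection $\mathrm i_\alpha^T:H_\lambda\to H_{\underline\lambda}$ is defined recursively: if the children $\mathtt r',\mathtt r''$ of the root $\mathtt r$ are the roots of subtrees $S',S''$ with restricted labellings $\alpha',\alpha''$, and $\alpha^{\mathtt r}=(\lambda,k)$, then $\mathrm i_\alpha^T=(\mathrm i_{\alpha'}^{S'}\otimes\mathrm i_{\alpha''}^{S''})\circ\mathrm i_{(\lambda^{\mathtt r'},\lambda^{\mathtt r''}),\lambda,k}$, with $\mathrm i=\mathrm{id}$ for a one-vertex tree. Put $|T;\alpha,\mu\rangle=\mathrm i_\alpha^T|\lambda\mu\rangle$. Modified quasicharacters. For $\alpha,\alpha'\in\mathcal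 L^T(\underline\lambda,\lambda)$: $\hat\chi(T)_\alpha^{\alpha'}(\underline a)=\sum_{\mu\in\mathtt w(\lambda)}\langle T;\alpha',\mu|D^{\underline\lambda}(\underline a)|T;\alpha,\mu\rangle$. Recoupling coefficients. Let $T_1,T_2$ be coupling trees with labellings $\alpha_i\in\mathcal L^{T_i}(\underline\lambda_i,\lambda)$, where $\underline\lambda_2$ arises from $\underline\lambda_1$ by a permutation $\sigma$, and let $\Pi:H_{\underline\lambda_1}\to H_{\underline\lambda_2}$ be the unitary permuting the tensor factors accordingly. By Schur's lemma $R(T_2|T_1)^{\alpha_2}_{\alpha_1}:=\langle T_2;\alpha_2,\mu|\Pi|T_1;\alpha_1,\mu\rangle$ does not depend on $\mu\in\mathtt w(\lambda)$. Tree operations. The join $T\cdot T$ is the coupling tree with $2N$ leaves having a new root whose left and right subtrees are copies of $T$; given labellings $\alpha_1,\alpha_2$ of $T$ with root weights $\lambda_1,\lambda_2$ and $(\lambda,k)\in\langle\langle\lambda_1,\lambda_2\rangle\rangle$, $[\alpha_1\cdot\alpha_2,(\lambda,k)]$ is the labelling of $T\cdot T$ which is $\alpha_1$ on the first copy, $\alpha_2$ on the second copy and $(\lambda,k)$ on the new root. The leaf duplication $T^\vee$ replaces every leaf $y$ of $T$ by a node with two leaf children. Given labellings $\alpha_1,\alpha_2,\alpha_3$ of $T$ and an assignment $\underline k=(k^y)$ of positive integers to the leaves with $(\lambda_3^y,k^y)\in\langle\langle\lambda_1^y,\lambda_2^y\rangle\rangle$ for all leaves $y$, $[\alpha_1*\alpha_2,\alpha_3,\underline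 k]$ is the labelling of $T^\vee$ assigning $\lambda_1^y,\lambda_2^y$ to the left and right leaf attached at $y$, $(\lambda_3^y,k^y)$ to the node replacing $y$, and $\alpha_3^x$ to each node $x$ of $T$. Below, $\Pi$ identifies the factor $H_{\lambda_i^y}$ in one tensor product with the factor $H_{\lambda_i^y}$ in the other. Write $(\alpha_3,\underline k,k)\in\langle\langle\alpha_1,\alpha_2\rangle\rangle$ if $(\lambda_3^y,k^y)\in\langle\langle\lambda_1^y,\lambda_2^y\rangle\rangle$ for all leaves $y$ and $(\lambda_3^{\mathtt r},k)\in\langle\langle\lambda_1^{\mathtt r},\lambda_2^{\mathtt r}\rangle\rangle$ for the root $\mathtt r$. In that case $$R(T)^{\alpha_1\alpha_2,k}_{\alpha_3,\underline k}:=R(T\cdot T|T^\vee)^{[\alpha_1\cdot\alpha_2,(\lambda_3^{\mathtt r},k)]}_{[\alpha_1*\alpha_2,\alpha_3,\underline k]},\qquad R(T)_{\alpha_1\alpha_2,k}^{\alpha_3,\underline k}:=R(T^\vee|T\cdot T)_{[\alpha_1\cdot\alpha_2,(\lambda_3^{\mathtt r},k)]}^{[\alpha_1*\alpha_2,\alpha_3,\underline k]},$$ and both are set to $0$ otherwise. *)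

theory Defs
  imports
    "HOL-Analysis.Analysis"
    "HOL-Algebra.Group"
    "HOL-Combinatorics.Permutations"
    "HOL-Library.Function_Algebras"
begin

section \<open>Compact Lie groups\<close>

text \<open>
  The model space of an \<open>n\<close>-dimensional manifold is \<^term>\<open>Euclidean_space n\<close>, the space of
  sequences \<open>nat \<Rightarrow> real\<close> vanishing from index \<open>n\<close> on. In contrast to a model space of class
  \<open>euclidean_space\<close> this covers \<open>n = 0\<close>, and hence finite groups.
  The following two notions are meant for subsets \<open>U\<close> that are open in the model space.
\<close>

primrec C_k_on :: "nat \<Rightarrow> nat \<Rightarrow> (nat \<Rightarrow> real) set \<Rightarrow> ((nat \<Rightarrow> real) \<Rightarrow> real) \<Rightarrow> bool" where
  "C_k_on n 0 U f \<longleftrightarrow> continuous_map (subtopology (Euclidean_space n) U) euclideanreal f"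
| "C_k_on n (Suc k) U f \<longleftrightarrow>
     continuous_map (subtopology (Euclidean_space n) U) euclideanreal f \<and>
     (\<forall>i<n. \<exists>f'. (\<forall>x\<in>U. ((\<lambda>t. f (x(i := t))) has_real_derivative f' x) (at (x i))) \<and>
                 C_k_on n k U f')"

definition smooth_map_on ::
    "nat \<Rightarrow> nat \<Rightarrow> (nat \<Rightarrow> real) set \<Rightarrow> ((nat \<Rightarrow> real) \<Rightarrow> (nat \<Rightarrow> real)) \<Rightarrow> bool" where
  "smooth_map_on m n U f \<longleftrightarrow> (\<forall>j<n. \<forall>k. C_k_on m k U (\<lambda>x. f x j))"

type_synonym 'g chart = "'g set \<times> ('g \<Rightarrow> nat \<Rightarrow> real)"

definition smooth_atlas :: "'g topology \<Rightarrow> nat \<Rightarrow> 'g chart set \<Rightarrow> bool" where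
  "smooth_atlas X n A \<longleftrightarrow>
     (\<Union>(U, \<phi>)\<in>A. U) = topspace X \<and>
     (\<forall>(U, \<phi>)\<in>A. openin X U \<and> openin (Euclidean_space n) (\<phi> ` U) \<and>
        homeomorphic_map (subtopology X U) (subtopology (Euclidean_space n) (\<phi> ` U)) \<phi>) \<and>
     (\<forall>(U, \<phi>)\<in>A. \<forall>(V, \<psi>)\<in>A. smooth_map_on n n (\<phi> ` (U \<inter> V)) (\<lambda>x. \<psi> (inv_into U \<phi> x)))"

text \<open>The two projections of the model space of dimension \<open>n + n\<close> to that of dimension \<open>n\<close>.\<close>

definition fst_coords :: "nat \<Rightarrow> (nat \<Rightarrow> real) \<Rightarrow> nat \<Rightarrow> real" where
  "fst_coords n z = (\<lambda>i. if i < n then z i else 0)"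

definition snd_coords :: "nat \<Rightarrow> (nat \<Rightarrow> real) \<Rightarrow> nat \<Rightarrow> real" where
  "snd_coords n z = (\<lambda>i. if i < n then z (n + i) else 0)"

locale lie_group = group G for G :: "'g monoid" (structure) +
  fixes X :: "'g topology" and n :: nat and A :: "'g chart set"
  assumes topspace_eq: "topspace X = carrier G"
    and Hausdorff: "Hausdorff_space X"
    and second_countable: "second_countable X"
    and atlas: "smooth_atlas X n A"
    and continuous_mult: "continuous_map (prod_topology X X) X (\<lambda>(a, b). a \<otimes> b)"
    and continuous_inv: "continuous_map X X (\<lambda>a. inv a)"
    and smooth_mult:
      "\<lbrakk>(U, \<phi>) \<in> A; (V, \<psi>) \<in> A; (W, \<theta>) \<in> A\<rbrakk> \<Longrightarrow>
         smooth_map_on (n + n) n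
           {z \<in> topspace (Euclidean_space (n + n)).
              fst_coords n z \<in> \<phi> ` U \<and> snd_coords n z \<in> \<psi> ` V \<and>
              inv_into U \<phi> (fst_coords n z) \<otimes> inv_into V \<psi> (snd_coords n z) \<in> W}
           (\<lambda>z. \<theta> (inv_into U \<phi> (fst_coords n z) \<otimes> inv_into V \<psi> (snd_coords n z)))"
    and smooth_inv:
      "\<lbrakk>(U, \<phi>) \<in> A; (V, \<psi>) \<in> A\<rbrakk> \<Longrightarrow>
         smooth_map_on n n (\<phi> ` {a \<in> U. inv a \<in> V}) (\<lambda>x. \<psi> (inv (inv_into U \<phi> x)))"

locale compact_lie_group = lie_group +
  assumes compact: "compact_space X"


section \<open>Hilbert spaces with a fixed orthonormal basis\<close>

text \<open>
  A finite-dimensional Hilbert space with an orthonormal basis labelled by a finite set \<open>I\<close> is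
  represented by \<open>\<complex>\<^sup>I\<close>, the functions vanishing outside \<open>I\<close>, and linear maps \<open>\<complex>\<^sup>I \<rightarrow> \<complex>\<^sup>J\<close> by their
  matrices \<open>M j i\<close>. Only the entries with \<open>j \<in> J\<close> and \<open>i \<in> I\<close> are significant, so equations
  between matrices are stated by \<open>mat_eq\<close>.
\<close>

type_synonym ('j, 'i) cmat = "'j \<Rightarrow> 'i \<Rightarrow> complex"

definition cspace :: "'i set \<Rightarrow> ('i \<Rightarrow> complex) set" where
  "cspace I = {v. \<forall>i. i \<notin> I \<longrightarrow> v i = 0}"

definition ip :: "'i set \<Rightarrow> ('i \<Rightarrow> complex) \<Rightarrow> ('i \<Rightarrow> complex) \<Rightarrow> complex" where
  "ip I u v = (\<Sum>i\<in>I. cnj (u i) * v i)"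

definition basis_vec :: "'i \<Rightarrow> 'i \<Rightarrow> complex" where
  "basis_vec i = (\<lambda>j. if j = i then 1 else 0)"

definition mapply :: "'j set \<Rightarrow> 'i set \<Rightarrow> ('j, 'i) cmat \<Rightarrow> ('i \<Rightarrow> complex) \<Rightarrow> 'j \<Rightarrow> complex" where
  "mapply J I M v = (\<lambda>j. if j \<in> J then \<Sum>i\<in>I. M j i * v i else 0)"

definition mmult :: "'i set \<Rightarrow> ('k, 'i) cmat \<Rightarrow> ('i, 'j) cmat \<Rightarrow> ('k, 'j) cmat" where
  "mmult I M M' = (\<lambda>k j. \<Sum>i\<in>I. M k i * M' i j)"

definition mone :: "('i, 'i) cmat" where
  "mone = (\<lambda>i j. if i = j then 1 else 0)"

definition madjoint :: "('j, 'i) cmat \<Rightarrow> ('i, 'j) cmat" where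
  "madjoint M = (\<lambda>i j. cnj (M j i))"

definition mat_eq :: "'j set \<Rightarrow> 'i set \<Rightarrow> ('j, 'i) cmat \<Rightarrow> ('j, 'i) cmat \<Rightarrow> bool" where
  "mat_eq J I M M' \<longleftrightarrow> (\<forall>j\<in>J. \<forall>i\<in>I. M j i = M' j i)"

definition unitary_mat :: "'j set \<Rightarrow> 'i set \<Rightarrow> ('j, 'i) cmat \<Rightarrow> bool" where
  "unitary_mat J I M \<longleftrightarrow>
     mat_eq I I (mmult J (madjoint M) M) mone \<and> mat_eq J J (mmult I M (madjoint M)) mone"


section \<open>Finite-dimensional representations\<close>

definition representation ::
    "'g monoid \<Rightarrow> 'g topology \<Rightarrow> 'i set \<Rightarrow> ('g \<Rightarrow> ('i, 'i) cmat) \<Rightarrow> bool" where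
  "representation G X I D \<longleftrightarrow>
     finite I \<and>
     mat_eq I I (D \<one>\<^bsub>G\<^esub>) mone \<and>
     (\<forall>a\<in>carrier G. \<forall>b\<in>carrier G. mat_eq I I (D (a \<otimes>\<^bsub>G\<^esub> b)) (mmult I (D a) (D b))) \<and>
     (\<forall>i\<in>I. \<forall>j\<in>I. continuous_map X euclidean (\<lambda>a. D a i j))"

definition unitary_rep ::
    "'g monoid \<Rightarrow> 'g topology \<Rightarrow> 'i set \<Rightarrow> ('g \<Rightarrow> ('i, 'i) cmat) \<Rightarrow> bool" where
  "unitary_rep G X I D \<longleftrightarrow>
     representation G X I D \<and> (\<forall>a\<in>carrier G. unitary_mat I I (D a))"

definition irreducible_rep ::
    "'g monoid \<Rightarrow> 'g topology \<Rightarrow> 'i set \<Rightarrow> ('g \<Rightarrow> ('i, 'i) cmat) \<Rightarrow> bool" where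
  "irreducible_rep G X I D \<longleftrightarrow>
     representation G X I D \<and> I \<noteq> {} \<and>
     (\<forall>V. V \<subseteq> cspace I \<and> module.subspace (\<lambda>c v i. c * v i) V \<and>
          (\<forall>a\<in>carrier G. \<forall>v\<in>V. mapply I I (D a) v \<in> V) \<longrightarrow> V = {0} \<or> V = cspace I)"

definition intertwines ::
    "'g monoid \<Rightarrow> 'j set \<Rightarrow> ('g \<Rightarrow> ('j, 'j) cmat) \<Rightarrow> 'i set \<Rightarrow> ('g \<Rightarrow> ('i, 'i) cmat) \<Rightarrow>
     ('j, 'i) cmat \<Rightarrow> bool" where
  "intertwines G J D' I D M \<longleftrightarrow>
     (\<forall>a\<in>carrier G. mat_eq J I (mmult J (D' a) M) (mmult I M (D a)))"

definition isomorphic_reps ::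
    "'g monoid \<Rightarrow> 'j set \<Rightarrow> ('g \<Rightarrow> ('j, 'j) cmat) \<Rightarrow> 'i set \<Rightarrow> ('g \<Rightarrow> ('i, 'i) cmat) \<Rightarrow> bool" where
  "isomorphic_reps G J D' I D \<longleftrightarrow>
     (\<exists>M M'. intertwines G J D' I D M \<and>
        mat_eq J J (mmult I M M') mone \<and> mat_eq I I (mmult J M' M) mone)"

text \<open>
  The multiplicity of an irreducible representation \<open>D\<close> in \<open>D'\<close>, as the dimension of the space of
  intertwiners from \<open>D\<close> to \<open>D'\<close>; insignificant matrix entries are normalised to zero.
\<close>

definition rep_multiplicity ::
    "'g monoid \<Rightarrow> 'j set \<Rightarrow> ('g \<Rightarrow> ('j, 'j) cmat) \<Rightarrow> 'i set \<Rightarrow> ('g \<Rightarrow> ('i, 'i) cmat) \<Rightarrow> nat" where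
  "rep_multiplicity G J D' I D =
     vector_space.dim (\<lambda>c M j i. c * M j i)
       {M. intertwines G J D' I D M \<and> (\<forall>j i. j \<notin> J \<or> i \<notin> I \<longrightarrow> M j i = 0)}"

definition tensor_rep ::
    "('g \<Rightarrow> ('i, 'i) cmat) \<Rightarrow> ('g \<Rightarrow> ('j, 'j) cmat) \<Rightarrow> 'g \<Rightarrow> ('i \<times> 'j, 'i \<times> 'j) cmat" where
  "tensor_rep D D' a = (\<lambda>(i, j) (i', j'). D a i i' * D' a j j')"

text \<open>Direct sum of the representations \<open>D s\<close>, in the basis labelled by pairs \<open>(s, i)\<close>.\<close>

definition direct_sum_rep ::
    "('s \<Rightarrow> 'g \<Rightarrow> ('i, 'i) cmat) \<Rightarrow> 'g \<Rightarrow> ('s \<times> 'i, 's \<times> 'i) cmat" where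
  "direct_sum_rep D a = (\<lambda>(s, i) (s', i'). if s = s' then D s a i i' else 0)"


section \<open>The fixed representation-theoretic data\<close>

text \<open>
  \<open>irr\<close> is the set of labels (highest weights) of the isomorphism classes of irreducible
  representations; \<open>wt \<Lambda>\<close> is the finite set of labels of the fixed orthonormal basis of
  \<open>H\<^sub>\<Lambda> = \<complex>\<^bsup>wt \<Lambda>\<^esup>\<close>, and \<open>rep \<Lambda>\<close> is \<open>D\<^sup>\<Lambda>\<close> in this basis;
  \<open>decomp \<Lambda>1 \<Lambda>2\<close> is the fixed isomorphism from \<open>H\<^bsub>\<Lambda>1\<^esub> \<otimes> H\<^bsub>\<Lambda>2\<^esub>\<close> to the direct sum
  over the pairs \<open>(\<Lambda>, k)\<close>. Highest weights are written \<open>\<Lambda>\<close>. Neither the weights nor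
  the orthonormal bases are tied to a choice of maximal torus; the bases are arbitrary, which
  includes bases of weight vectors.
\<close>

record ('g, 'l, 'm) coupling_data =
  grp :: "'g monoid"
  irr :: "'l set"
  wt :: "'l \<Rightarrow> 'm set"
  rep :: "'l \<Rightarrow> 'g \<Rightarrow> ('m, 'm) cmat"
  decomp :: "'l \<Rightarrow> 'l \<Rightarrow> (('l \<times> nat) \<times> 'm, 'm \<times> 'm) cmat"

definition mult_in_tensor :: "('g, 'l, 'm) coupling_data \<Rightarrow> 'l \<Rightarrow> 'l \<Rightarrow> 'l \<Rightarrow> nat" where
  "mult_in_tensor S \<Lambda>1 \<Lambda>2 \<Lambda> =
     rep_multiplicity (grp S) (wt S \<Lambda>1 \<times> wt S \<Lambda>2) (tensor_rep (rep S \<Lambda>1) (rep S \<Lambda>2))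
       (wt S \<Lambda>) (rep S \<Lambda>)"

definition coupled :: "('g, 'l, 'm) coupling_data \<Rightarrow> 'l \<Rightarrow> 'l \<Rightarrow> ('l \<times> nat) set" where
  "coupled S \<Lambda>1 \<Lambda>2 =
     {(\<Lambda>, k). \<Lambda> \<in> irr S \<and> mult_in_tensor S \<Lambda>1 \<Lambda>2 \<Lambda> > 0 \<and>
              1 \<le> k \<and> k \<le> mult_in_tensor S \<Lambda>1 \<Lambda>2 \<Lambda>}"

text \<open>
  In the third condition it suffices to consider representations on \<open>\<complex>\<^sup>d\<close>, with basis labelled by
  \<open>0, \<dots>, d - 1\<close>.
\<close>

definition coupling_system :: "('g, 'l, 'm) coupling_data \<Rightarrow> 'g topology \<Rightarrow> bool" where
  "coupling_system S X \<longleftrightarrow>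
     (\<forall>\<Lambda>\<in>irr S. unitary_rep (grp S) X (wt S \<Lambda>) (rep S \<Lambda>) \<and>
                irreducible_rep (grp S) X (wt S \<Lambda>) (rep S \<Lambda>)) \<and>
     (\<forall>\<Lambda>\<in>irr S. \<forall>\<Lambda>'\<in>irr S.
        isomorphic_reps (grp S) (wt S \<Lambda>') (rep S \<Lambda>') (wt S \<Lambda>) (rep S \<Lambda>) \<longrightarrow> \<Lambda> = \<Lambda>') \<and>
     (\<forall>d D. irreducible_rep (grp S) X {..<d::nat} D \<longrightarrow>
        (\<exists>\<Lambda>\<in>irr S. isomorphic_reps (grp S) {..<d} D (wt S \<Lambda>) (rep S \<Lambda>))) \<and>
     (\<forall>\<Lambda>1\<in>irr S. \<forall>\<Lambda>2\<in>irr S.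
        let I = wt S \<Lambda>1 \<times> wt S \<Lambda>2; J = (SIGMA (\<Lambda>, k):coupled S \<Lambda>1 \<Lambda>2. wt S \<Lambda>) in
        unitary_mat J I (decomp S \<Lambda>1 \<Lambda>2) \<and>
        intertwines (grp S) J (direct_sum_rep (\<lambda>(\<Lambda>, k). rep S \<Lambda>))
          I (tensor_rep (rep S \<Lambda>1) (rep S \<Lambda>2)) (decomp S \<Lambda>1 \<Lambda>2))"

text \<open>
  The isometric injection of \<open>H\<^sub>\<Lambda>\<close>: the inverse (that is, the adjoint) of the unitary map
  \<open>decomp \<Lambda>1 \<Lambda>2\<close>, restricted to the summand \<open>(\<Lambda>, k)\<close>.
\<close>

definition coupling_inj :: "('g, 'l, 'm) coupling_data \<Rightarrow> 'l \<Rightarrow> 'l \<Rightarrow> 'l \<Rightarrow> nat \<Rightarrow> ('m \<times> 'm, 'm) cmat" where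
  "coupling_inj S \<Lambda>1 \<Lambda>2 \<Lambda> k = (\<lambda>p \<mu>. madjoint (decomp S \<Lambda>1 \<Lambda>2) p ((\<Lambda>, k), \<mu>))"

text \<open>
  \<open>H\<^bsub>\<Lambda>s\<^esub>\<close> is \<open>\<complex>\<close> to the power \<open>wts S \<Lambda>s\<close>: the list \<open>\<mu>s\<close> labels the tensor product of the
  basis vectors labelled by its entries.
\<close>

definition wts :: "('g, 'l, 'm) coupling_data \<Rightarrow> 'l list \<Rightarrow> 'm list set" where
  "wts S \<Lambda>s = listset (map (wt S) \<Lambda>s)"

definition reps :: "('g, 'l, 'm) coupling_data \<Rightarrow> 'l list \<Rightarrow> 'g list \<Rightarrow> ('m list, 'm list) cmat" where
  "reps S \<Lambda>s gs = (\<lambda>\<mu>s \<nu>s. \<Prod>i<length \<Lambda>s. rep S (\<Lambda>s ! i) (gs ! i) (\<mu>s ! i) (\<nu>s ! i))"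


section \<open>Coupling trees and labellings\<close>

text \<open>
  Ordered rooted binary trees with data at the leaves and the nodes. A coupling tree is such a tree
  without data; a labelling of \<open>T\<close> is a tree with data whose underlying tree is \<open>T\<close>.
\<close>

datatype ('a, 'b) btree = Leaf 'a | Node 'b "('a, 'b) btree" "('a, 'b) btree"

type_synonym coupling_tree = "(unit, unit) btree"
type_synonym 'l labelling = "('l, 'l \<times> nat) btree"

primrec leaves :: "('a, 'b) btree \<Rightarrow> 'a list" where
  "leaves (Leaf y) = [y]"
| "leaves (Node x l r) = leaves l @ leaves r"

abbreviation num_leaves :: "('a, 'b) btree \<Rightarrow> nat" where
  "num_leaves t \<equiv> length (leaves t)"

definition tree_of :: "('a, 'b) btree \<Rightarrow> coupling_tree" where
  "tree_of = map_btree (\<lambda>_. ()) (\<lambda>_. ())"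

primrec root_weight :: "'l labelling \<Rightarrow> 'l" where
  "root_weight (Leaf \<Lambda>) = \<Lambda>"
| "root_weight (Node x l r) = fst x"

primrec admissible :: "('g, 'l, 'm) coupling_data \<Rightarrow> 'l labelling \<Rightarrow> bool" where
  "admissible S (Leaf \<Lambda>) \<longleftrightarrow> \<Lambda> \<in> irr S"
| "admissible S (Node x l r) \<longleftrightarrow>
     admissible S l \<and> admissible S r \<and> x \<in> coupled S (root_weight l) (root_weight r)"

definition labellings :: "('g, 'l, 'm) coupling_data \<Rightarrow> coupling_tree \<Rightarrow> 'l labelling set" where
  "labellings S T = {\<alpha>. tree_of \<alpha> = T \<and> admissible S \<alpha>}"

definition labellings_with ::
    "('g, 'l, 'm) coupling_data \<Rightarrow> coupling_tree \<Rightarrow> 'l list \<Rightarrow> 'l \<Rightarrow> 'l labelling set" where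
  "labellings_with S T \<Lambda>s \<Lambda> = {\<alpha> \<in> labellings S T. leaves \<alpha> = \<Lambda>s \<and> root_weight \<alpha> = \<Lambda>}"

definition combinable ::
    "('g, 'l, 'm) coupling_data \<Rightarrow> coupling_tree \<Rightarrow> 'l labelling \<Rightarrow> 'l labelling \<Rightarrow> bool" where
  "combinable S T \<alpha> \<alpha>' \<longleftrightarrow>
     (\<exists>\<Lambda>s \<Lambda>. \<alpha> \<in> labellings_with S T \<Lambda>s \<Lambda> \<and> \<alpha>' \<in> labellings_with S T \<Lambda>s \<Lambda>)"

text \<open>
  Tensor product of maps into \<open>H\<^bsub>\<Lambda>s\<^esub>\<close> and \<open>H\<^bsub>\<Lambda>s'\<^esub>\<close>, where \<open>\<Lambda>s\<close> has length \<open>n\<close>, as a map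
  into \<open>H\<^bsub>\<Lambda>s @ \<Lambda>s'\<^esub>\<close>.
\<close>

definition tensor_append ::
    "nat \<Rightarrow> ('m list, 'i) cmat \<Rightarrow> ('m list, 'j) cmat \<Rightarrow> ('m list, 'i \<times> 'j) cmat" where
  "tensor_append n M M' = (\<lambda>\<mu>s (i, j). M (take n \<mu>s) i * M' (drop n \<mu>s) j)"

primrec tree_inj :: "('g, 'l, 'm) coupling_data \<Rightarrow> 'l labelling \<Rightarrow> ('m list, 'm) cmat" where
  "tree_inj S (Leaf \<Lambda>) = (\<lambda>\<mu>s \<mu>. if \<mu>s = [\<mu>] then 1 else 0)"
| "tree_inj S (Node x l r) =
     mmult (wt S (root_weight l) \<times> wt S (root_weight r))
       (tensor_append (num_leaves l) (tree_inj S l) (tree_inj S r))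
       (coupling_inj S (root_weight l) (root_weight r) (fst x) (snd x))"

text \<open>The vector \<open>|T; \<alpha>, \<mu>\<rangle>\<close>, where \<open>T\<close> is the tree underlying \<open>\<alpha>\<close>.\<close>

definition ket :: "('g, 'l, 'm) coupling_data \<Rightarrow> 'l labelling \<Rightarrow> 'm \<Rightarrow> 'm list \<Rightarrow> complex" where
  "ket S \<alpha> \<mu> =
     mapply (wts S (leaves \<alpha>)) (wt S (root_weight \<alpha>)) (tree_inj S \<alpha>) (basis_vec \<mu>)"


section \<open>Modified quasicharacters and recoupling coefficients\<close>

text \<open>
  \<open>quasichar S \<alpha> \<alpha>'\<close> is the modified quasicharacter with lower index \<open>\<alpha>\<close> and upper index \<open>\<alpha>'\<close>, for
  combinable \<open>\<alpha>\<close> and \<open>\<alpha>'\<close>.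
\<close>

definition quasichar ::
    "('g, 'l, 'm) coupling_data \<Rightarrow> 'l labelling \<Rightarrow> 'l labelling \<Rightarrow> 'g list \<Rightarrow> complex" where
  "quasichar S \<alpha> \<alpha>' gs =
     (let W = wts S (leaves \<alpha>) in
      \<Sum>\<mu>\<in>wt S (root_weight \<alpha>).
        ip W (ket S \<alpha>' \<mu>) (mapply W W (reps S (leaves \<alpha>) gs) (ket S \<alpha> \<mu>)))"

text \<open>
  For \<open>\<sigma>\<close> permuting \<open>{..<length \<Lambda>s}\<close>, the operator from \<open>H\<^bsub>\<Lambda>s\<^esub>\<close> to
  \<open>H\<^bsub>permute_list \<sigma> \<Lambda>s\<^esub>\<close> sending the tensor product of \<open>v\<^sub>0, v\<^sub>1, \<dots>\<close> to that of
  \<open>v\<^bsub>\<sigma> 0\<^esub>, v\<^bsub>\<sigma> 1\<^esub>, \<dots>\<close>.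
\<close>

definition perm_op :: "(nat \<Rightarrow> nat) \<Rightarrow> ('m list, 'm list) cmat" where
  "perm_op \<sigma> = (\<lambda>\<nu>s \<mu>s. if \<nu>s = permute_list \<sigma> \<mu>s then 1 else 0)"

text \<open>
  The recoupling coefficient with upper index \<open>\<alpha>2\<close> and lower index \<open>\<alpha>1\<close>, for labellings with the same
  root weight and with \<open>leaves \<alpha>2 = permute_list \<sigma> (leaves \<alpha>1)\<close>: the common value of the matrix
  elements for all \<open>\<mu>\<close>, which exists by Schur's lemma.
\<close>

definition recoupling ::
    "('g, 'l, 'm) coupling_data \<Rightarrow> (nat \<Rightarrow> nat) \<Rightarrow> 'l labelling \<Rightarrow> 'l labelling \<Rightarrow> complex" where
  "recoupling S \<sigma> \<alpha>2 \<alpha>1 =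
     (let W1 = wts S (leaves \<alpha>1); W2 = wts S (leaves \<alpha>2) in
      THE c. \<forall>\<mu>\<in>wt S (root_weight \<alpha>1).
        ip W2 (ket S \<alpha>2 \<mu>) (mapply W2 W1 (perm_op \<sigma>) (ket S \<alpha>1 \<mu>)) = c)"

definition join_lab :: "'l labelling \<Rightarrow> 'l labelling \<Rightarrow> 'l \<times> nat \<Rightarrow> 'l labelling" where
  "join_lab \<alpha>1 \<alpha>2 x = Node x \<alpha>1 \<alpha>2"

text \<open>
  The labelling \<open>[\<alpha>1 * \<alpha>2, \<alpha>3, ks]\<close> of the leaf duplication, for labellings \<open>\<alpha>1\<close>, \<open>\<alpha>2\<close>, \<open>\<alpha>3\<close> of
  the same tree \<open>T\<close>. The assignment of multiplicity indices to the leaves of \<open>T\<close> is also given as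
  a tree \<open>ks\<close> with underlying tree \<open>T\<close>.
\<close>

fun dup_lab ::
    "'l labelling \<Rightarrow> 'l labelling \<Rightarrow> 'l labelling \<Rightarrow> (nat, unit) btree \<Rightarrow> 'l labelling" where
  "dup_lab (Leaf \<Lambda>1) (Leaf \<Lambda>2) (Leaf \<Lambda>3) (Leaf k) = Node (\<Lambda>3, k) (Leaf \<Lambda>1) (Leaf \<Lambda>2)"
| "dup_lab (Node _ l1 r1) (Node _ l2 r2) (Node x l3 r3) (Node _ lk rk) =
     Node x (dup_lab l1 l2 l3 lk) (dup_lab r1 r2 r3 rk)"
| "dup_lab _ _ _ _ = undefined"

definition coupled_labs ::
    "('g, 'l, 'm) coupling_data \<Rightarrow> coupling_tree \<Rightarrow> 'l labelling \<Rightarrow> 'l labelling \<Rightarrow>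
     ('l labelling \<times> (nat, unit) btree \<times> nat) set" where
  "coupled_labs S T \<alpha>1 \<alpha>2 =
     {(\<alpha>3, ks, k). \<alpha>3 \<in> labellings S T \<and> tree_of ks = T \<and>
        (\<forall>i<num_leaves T.
           (leaves \<alpha>3 ! i, leaves ks ! i) \<in> coupled S (leaves \<alpha>1 ! i) (leaves \<alpha>2 ! i)) \<and>
        (root_weight \<alpha>3, k) \<in> coupled S (root_weight \<alpha>1) (root_weight \<alpha>2)}"

text \<open>
  Position \<open>i\<close> among the \<open>N + N\<close> leaves of the join corresponds to position
  \<open>join_to_dup N i\<close> among the leaves of the leaf duplication, where the two leaves replacing the
  \<open>y\<close>-th leaf have positions \<open>2 * y\<close> and \<open>2 * y + 1\<close>.
\<close>

definition join_to_dup :: "nat \<Rightarrow> nat \<Rightarrow> nat" where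
  "join_to_dup N i = (if i < N then 2 * i else if i < 2 * N then 2 * (i - N) + 1 else i)"

definition R_join_dup ::
    "('g, 'l, 'm) coupling_data \<Rightarrow> coupling_tree \<Rightarrow> 'l labelling \<Rightarrow> 'l labelling \<Rightarrow> nat \<Rightarrow>
     'l labelling \<Rightarrow> (nat, unit) btree \<Rightarrow> complex" where
  "R_join_dup S T \<alpha>1 \<alpha>2 k \<alpha>3 ks =
     (if (\<alpha>3, ks, k) \<in> coupled_labs S T \<alpha>1 \<alpha>2
      then recoupling S (join_to_dup (num_leaves T))
             (join_lab \<alpha>1 \<alpha>2 (root_weight \<alpha>3, k)) (dup_lab \<alpha>1 \<alpha>2 \<alpha>3 ks)
      else 0)"

definition R_dup_join ::
    "('g, 'l, 'm) coupling_data \<Rightarrow> coupling_tree \<Rightarrow> 'l labelling \<Rightarrow> 'l labelling \<Rightarrow> nat \<Rightarrow>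
     'l labelling \<Rightarrow> (nat, unit) btree \<Rightarrow> complex" where
  "R_dup_join S T \<alpha>1 \<alpha>2 k \<alpha>3 ks =
     (if (\<alpha>3, ks, k) \<in> coupled_labs S T \<alpha>1 \<alpha>2
      then recoupling S (inv_into UNIV (join_to_dup (num_leaves T)))
             (dup_lab \<alpha>1 \<alpha>2 \<alpha>3 ks) (join_lab \<alpha>1 \<alpha>2 (root_weight \<alpha>3, k))
      else 0)"

end

theory Submission
  imports Defs "Jordan_Normal_Form.Char_Poly"
begin

text \<open>
  The product of the two quasicharacters is a partial trace of \<open>D(gs) \<otimes> D(gs)\<close>; by unitarity of the
  coupling at the root it can be computed in the basis of kets of the join \<open>T \<cdot> T\<close>. Each of these
  is expanded in the orthonormal basis of kets of the leaf duplication; by Schur's lemma only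
  terms with the same root weight and the same weight label survive, and the coefficients are the
  recoupling coefficients. Finally, a ket of the leaf duplication is the image of a ket of \<open>T\<close> under
  the leaf couplings. These intertwine \<open>D(gs) \<otimes> D(gs)\<close> with the representations attached to the leaf
  weights and have mutually orthogonal ranges, so each surviving pair of terms yields a
  quasicharacter of \<open>T\<close>.
\<close>

text \<open>The detour through the leaf duplication is forced by equivariance. The coupling at an
  inner node intertwines only the diagonal action, where one group element acts on all leaves,
  whereas quasicharacters are evaluated at an arbitrary \<open>gs\<close>. In the duplicated tree
  each leaf coupling joins two factors on which the same entry of \<open>gs\<close> acts, so it is
  equivariant under all of G^N; the diagonal action serves only for Schur's lemma. Upper indices sit
  in bras, so the coefficients of the primed labels come out conjugated, and conjugation exchanges
  the two kinds of recoupling coefficient. Two conventions shape the details.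
  \<open>recoupling\<close> is a definite description: a common value for all weight labels must be
  exhibited, and a weight label must exist to make it unique. And \<open>sum\<close> over an
  infinite set is 0, so the label sets must be shown finite, which rests on the unitarity of
  \<open>decomp\<close>. Indices of the 2N tensor factors are kept as pairs of lists, one per copy
  of the tree; concatenating or interleaving a pair gives the index order of the join or of the leaf
  duplication.\<close>

unbundle no vec_syntax

subsection \<open>Sums over products of sets\<close>

lemma in_listset_iff:
  "xs \<in> listset As \<longleftrightarrow> length xs = length As \<and> (\<forall>i<length As. xs ! i \<in> As ! i)"
proof (induction As arbitrary: xs)
  case Nil
  then show ?case by auto
next
  case (Cons B As)
  then show ?case
    by (cases xs) (auto simp: set_Cons_def nth_Cons split: nat.splits)
qed

lemma finite_listset: "(\<And>B. B \<in> set As \<Longrightarrow> finite B) \<Longrightarrow> finite (listset As)"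
proof (induction As)
  case (Cons B As)
  have "listset (B # As) = (\<lambda>(x, xs). x # xs) ` (B \<times> listset As)"
    by (auto simp: set_Cons_def)
  then show ?case using Cons by simp
qed simp

lemma sum_listset_Cons:
  "(\<Sum>xs\<in>listset (B # As). f xs) = (\<Sum>x\<in>B. \<Sum>xs\<in>listset As. f (x # xs))"
proof -
  have "bij_betw (\<lambda>(x, xs). x # xs) (B \<times> listset As) (listset (B # As))"
    by (auto simp: bij_betw_def inj_on_def set_Cons_def)
  then have "(\<Sum>xs\<in>listset (B # As). f xs) = (\<Sum>(x, xs)\<in>B \<times> listset As. f (x # xs))"
    by (subst sum.reindex_bij_betw[symmetric]) (auto simp: case_prod_beta')
  then show ?thesis by (simp add: sum.cartesian_product)
qed

lemma sum_listset_append: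
  "(\<Sum>zs\<in>listset (As @ Bs). f zs) = (\<Sum>xs\<in>listset As. \<Sum>ys\<in>listset Bs. f (xs @ ys))"
  by (induction As arbitrary: f) (simp_all add: sum_listset_Cons del: listset.simps(2))

text \<open>The generalised distributive law. A sum over tensor indices of a product of one-factor
  terms splits position by position, so statements about all leaves at once follow from statements
  about a single leaf.\<close>

lemma sum_listset_prod:
  fixes f :: "nat \<Rightarrow> 'a \<Rightarrow> 'b::comm_semiring_1"
  shows "(\<Sum>xs\<in>listset As. \<Prod>i<length As. f i (xs ! i)) = (\<Prod>i<length As. \<Sum>x\<in>As ! i. f i x)"
proof (induction As arbitrary: f)
  case (Cons B As)
  have "(\<Sum>xs\<in>listset (B # As). \<Prod>i<length (B # As). f i (xs ! i)) =
      (\<Sum>x\<in>B. f 0 x * (\<Sum>xs\<in>listset As. \<Prod>i<length As. f (Suc i) (xs ! i)))"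
    unfolding sum_listset_Cons
    by (simp only: list.size add_Suc_right add_0_right prod.lessThan_Suc_shift sum_distrib_left
        nth_Cons_0 nth_Cons_Suc)
  also have "\<dots> = (\<Sum>x\<in>B. f 0 x) * (\<Prod>i<length As. \<Sum>x\<in>As ! i. f (Suc i) x)"
    using Cons.IH[of "\<lambda>i. f (Suc i)"] by (simp add: sum_distrib_right)
  also have "\<dots> = (\<Prod>i<length (B # As). \<Sum>x\<in>(B # As) ! i. f i x)"
    by (simp only: list.size add_Suc_right add_0_right prod.lessThan_Suc_shift nth_Cons_0 nth_Cons_Suc)
  finally show ?case .
qed simp

subsection \<open>Schur's lemma\<close>

text \<open>Eigenvalues are roots of the characteristic polynomial, and over the complex numbers a
  root exists. \<open>mapply\<close> works over an arbitrary finite index set, while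
  \<open>carrier_mat\<close> uses an initial segment of the naturals; an enumeration
  \<open>h\<close> of \<open>I\<close> translates between the two.\<close>

lemma eigenvector_exists:
  assumes "finite I" "I \<noteq> {}"
  shows "\<exists>c v. v \<in> cspace I \<and> v \<noteq> 0 \<and> mapply I I M v = (\<lambda>i. c * v i)"
proof -
  obtain h where h: "bij_betw h {0..<card I} I"
    using ex_bij_betw_nat_finite[OF assms(1)] by blast
  define d where "d = card I"
  define g where "g = inv_into {0..<d} h"
  note h = h[folded d_def]
  have g: "bij_betw g I {0..<d}" unfolding g_def by (rule bij_betw_inv_into[OF h])
  have hg: "h (g i) = i" if "i \<in> I" for i
    unfolding g_def using bij_betw_inv_into_right[OF h that] .
  have gh: "g (h k) = k" if "k < d" for k
    unfolding g_def using bij_betw_inv_into_left[OF h] that by simp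
  have g_less: "g i < d" if "i \<in> I" for i using bij_betwE[OF g] that by auto
  have h_in: "h k \<in> I" if "k < d" for k using bij_betwE[OF h] that by auto
  define B where "B = Matrix.mat d d (\<lambda>(k, l). M (h k) (h l))"
  have B: "B \<in> carrier_mat d d" by (simp add: B_def)
  have "d \<noteq> 0" using assms by (simp add: d_def)
  \<comment> \<open>Nonemptiness of \<open>I\<close> enters here: the characteristic polynomial has
    degree \<open>d\<close>, the cardinality of \<open>I\<close>.\<close>
  then have "\<not> constant (poly (char_poly B))"
    using degree_monic_char_poly[OF B] by (simp add: constant_degree)
  then obtain c where "poly (char_poly B) c = 0"
    using fundamental_theorem_of_algebra by blast
  then obtain w where "eigenvector B w c"
    using eigenvalue_root_char_poly[OF B] unfolding eigenvalue_def by blast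
  then have w: "w \<in> carrier_vec d" "w \<noteq> 0\<^sub>v d" "B *\<^sub>v w = c \<cdot>\<^sub>v w"
    using B by (auto simp: eigenvector_def)
  define v where "v = (\<lambda>i. if i \<in> I then w $ g i else 0)"
  have "v \<in> cspace I" by (simp add: v_def cspace_def)
  moreover have "v \<noteq> 0"
  proof
    assume "v = 0"
    have "w $ k = 0" if "k < d" for k
      using fun_cong[OF \<open>v = 0\<close>, of "h k"] that h_in gh by (simp add: v_def)
    then have "w = 0\<^sub>v d" using w(1) by (intro eq_vecI) auto
    then show False using w(2) by simp
  qed
  moreover have "mapply I I M v = (\<lambda>i. c * v i)"
  proof
    fix i
    show "mapply I I M v i = c * v i"
    proof (cases "i \<in> I")
      case True
      have "(\<Sum>j\<in>I. M i j * v j) = (\<Sum>k\<in>{0..<d}. M i (h k) * v (h k))"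
        by (rule sum.reindex_bij_betw[OF h, symmetric])
      also have "\<dots> = (\<Sum>k\<in>{0..<d}. B $$ (g i, k) * w $ k)"
        using True by (intro sum.cong) (simp_all add: B_def v_def g_less hg gh h_in)
      also have "\<dots> = (B *\<^sub>v w) $ g i"
        using g_less[OF True] w(1) B by (simp add: scalar_prod_def)
      also have "\<dots> = c * w $ g i" using g_less[OF True] w by simp
      finally show ?thesis using True by (simp add: mapply_def v_def)
    qed (simp add: mapply_def v_def)
  qed
  ultimately show ?thesis by blast
qed

text \<open>An eigenspace \<open>V\<close> of \<open>M\<close> is nonzero and, as \<open>M\<close>
  commutes with every \<open>D a\<close>, invariant; irreducibility makes it the whole space.
  Evaluation at basis vectors then yields the entries of \<open>M\<close>.\<close>

lemma irreducible_commutant_scalar: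
  assumes irr: "irreducible_rep G X I D"
    and comm: "\<And>a i j. a \<in> carrier G \<Longrightarrow> i \<in> I \<Longrightarrow> j \<in> I \<Longrightarrow>
      (\<Sum>k\<in>I. D a i k * M k j) = (\<Sum>k\<in>I. M i k * D a k j)"
  shows "\<exists>c. \<forall>i\<in>I. \<forall>j\<in>I. M i j = (if i = j then c else 0)"
proof -
  have I: "finite I" "I \<noteq> {}" using irr by (auto simp: irreducible_rep_def representation_def)
  obtain c v where v: "v \<in> cspace I" "v \<noteq> 0" "mapply I I M v = (\<lambda>i. c * v i)"
    using eigenvector_exists[OF I] by blast
  define V where "V = {v \<in> cspace I. mapply I I M v = (\<lambda>i. c * v i)}"
  \<comment> \<open>\<open>irreducible_rep\<close> mentions \<open>module.subspace\<close> for this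
    pointwise scaling; the interpretation provides \<open>subspace_def\<close> for exactly that
    instance.\<close>
  interpret Modules.module "\<lambda>(c::complex) (v::'b \<Rightarrow> complex) i. c * v i"
    by unfold_locales (auto simp: fun_eq_iff algebra_simps)
  have "subspace V"
    by (auto simp: subspace_def V_def cspace_def mapply_def fun_eq_iff algebra_simps
        sum.distrib sum_distrib_left)
       (metis (no_types, lifting) mult.left_commute sum.cong sum_distrib_left)
  moreover have "mapply I I (D a) u \<in> V" if a: "a \<in> carrier G" and u: "u \<in> V" for a u
  proof -
    have Mu: "(\<Sum>k\<in>I. M i k * u k) = c * u i" if "i \<in> I" for i
    proof -
      have "mapply I I M u i = c * u i" using u by (simp add: V_def)
      then show ?thesis using that by (simp add: mapply_def)
    qed
    have "(\<Sum>k\<in>I. M i k * (\<Sum>j\<in>I. D a k j * u j)) = c * (\<Sum>j\<in>I. D a i j * u j)"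
      if i: "i \<in> I" for i
    proof -
      have "(\<Sum>k\<in>I. M i k * (\<Sum>j\<in>I. D a k j * u j)) = (\<Sum>j\<in>I. (\<Sum>k\<in>I. M i k * D a k j) * u j)"
        unfolding sum_distrib_left sum_distrib_right mult.assoc by (rule sum.swap)
      also have "\<dots> = (\<Sum>j\<in>I. (\<Sum>k\<in>I. D a i k * M k j) * u j)"
        using comm[OF a i] by simp
      also have "\<dots> = (\<Sum>k\<in>I. D a i k * (\<Sum>j\<in>I. M k j * u j))"
        unfolding sum_distrib_left sum_distrib_right mult.assoc by (rule sum.swap)
      also have "\<dots> = (\<Sum>k\<in>I. D a i k * (c * u k))" using Mu by simp
      finally show ?thesis by (simp add: sum_distrib_left mult.left_commute)
    qed
    then show ?thesis by (auto simp: V_def mapply_def cspace_def fun_eq_iff)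
  qed
  ultimately have "V = {0} \<or> V = cspace I"
    using irr unfolding irreducible_rep_def by (auto simp: V_def)
  moreover have "v \<in> V" using v by (simp add: V_def)
  ultimately have V: "V = cspace I" using v(2) by auto
  have "M i j = (if i = j then c else 0)" if "i \<in> I" "j \<in> I" for i j
  proof -
    have "basis_vec j \<in> V" unfolding V using that by (auto simp: cspace_def basis_vec_def)
    then have "mapply I I M (basis_vec j) i = c * basis_vec j i" by (simp add: V_def)
    then show ?thesis using that I(1)
      by (simp add: mapply_def basis_vec_def if_distrib cong: if_cong)
  qed
  then show ?thesis by blast
qed

subsection \<open>Coupling of two irreducible representations\<close>

text \<open>Associativity of matrix products in coordinates. It is used in both directions wherever
  an operator is moved past a composition of maps.\<close>

lemma sum_mult_assoc:
  fixes f :: "'a \<Rightarrow> 'c::comm_semiring_0"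
  shows "(\<Sum>k\<in>K. f k * (\<Sum>l\<in>L. g k l * h l)) = (\<Sum>l\<in>L. (\<Sum>k\<in>K. f k * g k l) * h l)"
  unfolding sum_distrib_left sum_distrib_right mult.assoc by (rule sum.swap)

lemma sum_delta_mult:
  fixes f :: "'a \<Rightarrow> 'c::semiring_1"
  assumes "finite K"
  shows "(\<Sum>k\<in>K. (if i = k then 1 else 0) * f k) = (if i \<in> K then f i else 0)"
    and "(\<Sum>k\<in>K. f k * (if k = i then 1 else 0)) = (if i \<in> K then f i else 0)"
  using assms by (simp_all add: if_distrib[where f = "\<lambda>x. x * _"] if_distrib[where f = "\<lambda>x. _ * x"]
      cong: if_cong)

section \<open>Matrix entries of the fixed irreducible representations and Schur's lemma between
  them\<close>

locale coupling = group "grp S" for S :: "('g, 'l, 'm) coupling_data" +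
  fixes X :: "'g topology"
  assumes system: "coupling_system S X"
begin

text \<open>The Clebsch-Gordan coefficients: component \<open>p\<close> of the coupled basis vector
  \<open>\<mu>\<close> in the summand \<open>x\<close>. Weight and multiplicity index form one
  argument \<open>x\<close> because \<open>coupled\<close> and the node labels consist of such
  pairs.\<close>

abbreviation cg :: "'l \<Rightarrow> 'l \<Rightarrow> 'l \<times> nat \<Rightarrow> 'm \<times> 'm \<Rightarrow> 'm \<Rightarrow> complex" where
  "cg \<Lambda>1 \<Lambda>2 x \<equiv> coupling_inj S \<Lambda>1 \<Lambda>2 (fst x) (snd x)"

lemma
  assumes "\<Lambda> \<in> irr S"
  shows unitary: "unitary_rep (grp S) X (wt S \<Lambda>) (rep S \<Lambda>)"
    and irreducible: "irreducible_rep (grp S) X (wt S \<Lambda>) (rep S \<Lambda>)"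
  using system assms by (auto simp: coupling_system_def)

lemma
  assumes "\<Lambda> \<in> irr S"
  shows finite_wt: "finite (wt S \<Lambda>)" and wt_nonempty: "wt S \<Lambda> \<noteq> {}"
  using irreducible[OF assms] by (auto simp: irreducible_rep_def representation_def)

lemma coupled_irr: "x \<in> coupled S \<Lambda>1 \<Lambda>2 \<Longrightarrow> fst x \<in> irr S"
  by (auto simp: coupled_def)

lemma rep_mult:
  assumes "\<Lambda> \<in> irr S" "a \<in> carrier (grp S)" "b \<in> carrier (grp S)" "i \<in> wt S \<Lambda>" "j \<in> wt S \<Lambda>"
  shows "rep S \<Lambda> (a \<otimes>\<^bsub>grp S\<^esub> b) i j = (\<Sum>k\<in>wt S \<Lambda>. rep S \<Lambda> a i k * rep S \<Lambda> b k j)"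
  using unitary[OF assms(1)] assms(2-)
  by (auto simp: unitary_rep_def representation_def mat_eq_def mmult_def)

text \<open>The matrix of the inverse element is a left inverse of \<open>rep S \<Lambda> a\<close>
  by the homomorphism property, the adjoint is a right inverse by unitarity, and the two must
  coincide.\<close>

lemma rep_inv:
  assumes L: "\<Lambda> \<in> irr S" and a: "a \<in> carrier (grp S)" and i: "i \<in> wt S \<Lambda>" and j: "j \<in> wt S \<Lambda>"
  shows "rep S \<Lambda> (inv\<^bsub>grp S\<^esub> a) i j = cnj (rep S \<Lambda> a j i)"
proof -
  let ?D = "rep S \<Lambda>" and ?W = "wt S \<Lambda>"
  have one: "(\<Sum>k\<in>?W. ?D (inv\<^bsub>grp S\<^esub> a) i k * ?D a k l) = (if i = l then 1 else 0)"
    if "l \<in> ?W" for l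
    using unitary[OF L] that i rep_mult[OF L _ a i that, of "inv\<^bsub>grp S\<^esub> a"] a
    by (auto simp: unitary_rep_def representation_def mat_eq_def mone_def)
  have adj: "(\<Sum>l\<in>?W. ?D a k l * cnj (?D a j l)) = (if k = j then 1 else 0)" if "k \<in> ?W" for k
    using unitary[OF L] that j a
    by (auto simp: unitary_rep_def unitary_mat_def mat_eq_def mone_def mmult_def madjoint_def)
  have "?D (inv\<^bsub>grp S\<^esub> a) i j = (\<Sum>k\<in>?W. ?D (inv\<^bsub>grp S\<^esub> a) i k * (if k = j then 1 else 0))"
    using j by (simp add: sum_delta_mult finite_wt[OF L])
  also have "\<dots> = (\<Sum>k\<in>?W. ?D (inv\<^bsub>grp S\<^esub> a) i k * (\<Sum>l\<in>?W. ?D a k l * cnj (?D a j l)))"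
    using adj by simp
  also have "\<dots> = (\<Sum>l\<in>?W. (if i = l then 1 else 0) * cnj (?D a j l))"
    unfolding sum_mult_assoc using one by simp
  also have "\<dots> = cnj (?D a j i)" using i by (simp add: sum_delta_mult finite_wt[OF L])
  finally show ?thesis .
qed

text \<open>For equal labels this is the statement on commutants. For different labels the adjoint
  of \<open>M\<close> is an intertwiner in the opposite direction, since the representations are
  unitary; hence both products of \<open>M\<close> with its adjoint are scalar. A nonzero entry of
  \<open>M\<close> would make the adjoint, divided by that scalar, an inverse of \<open>M\<close>,
  and inequivalent labels would become isomorphic.\<close>

lemma schur:
  assumes L: "\<Lambda> \<in> irr S" and L': "\<Lambda>' \<in> irr S"
    and M: "\<And>a i j. a \<in> carrier (grp S) \<Longrightarrow> i \<in> wt S \<Lambda>' \<Longrightarrow> j \<in> wt S \<Lambda> \<Longrightarrow>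
      (\<Sum>k\<in>wt S \<Lambda>'. rep S \<Lambda>' a i k * M k j) = (\<Sum>k\<in>wt S \<Lambda>. M i k * rep S \<Lambda> a k j)"
  shows "\<exists>c. \<forall>i\<in>wt S \<Lambda>'. \<forall>j\<in>wt S \<Lambda>. M i j = (if \<Lambda> = \<Lambda>' \<and> i = j then c else 0)"
proof (cases "\<Lambda> = \<Lambda>'")
  case True
  then show ?thesis
    using irreducible_commutant_scalar[OF irreducible[OF L], of M] M by auto
next
  case False
  let ?D = "rep S \<Lambda>" and ?D' = "rep S \<Lambda>'" and ?W = "wt S \<Lambda>" and ?W' = "wt S \<Lambda>'"
  have Madj: "(\<Sum>k\<in>?W. ?D a i k * cnj (M j k)) = (\<Sum>k\<in>?W'. cnj (M k i) * ?D' a k j)"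
    if a: "a \<in> carrier (grp S)" and i: "i \<in> ?W" and j: "j \<in> ?W'" for a i j
  proof -
    let ?b = "inv\<^bsub>grp S\<^esub> a"
    have "(\<Sum>k\<in>?W. ?D a i k * cnj (M j k)) = cnj (\<Sum>k\<in>?W. M j k * ?D ?b k i)"
      using rep_inv[OF L a _ i] by (simp add: mult.commute)
    also have "\<dots> = cnj (\<Sum>k\<in>?W'. ?D' ?b j k * M k i)" using M[of ?b j i] a i j by simp
    also have "\<dots> = (\<Sum>k\<in>?W'. cnj (M k i) * ?D' a k j)"
      using rep_inv[OF L' a j] by (simp add: mult.commute)
    finally show ?thesis .
  qed
  have "\<exists>c. \<forall>i\<in>?W. \<forall>j\<in>?W. (\<Sum>k\<in>?W'. cnj (M k i) * M k j) = (if i = j then c else 0)"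
  proof (rule irreducible_commutant_scalar[OF irreducible[OF L]])
    fix a i j assume a: "a \<in> carrier (grp S)" and i: "i \<in> ?W" and j: "j \<in> ?W"
    have "(\<Sum>k\<in>?W. ?D a i k * (\<Sum>l\<in>?W'. cnj (M l k) * M l j)) =
        (\<Sum>l\<in>?W'. (\<Sum>k\<in>?W'. cnj (M k i) * ?D' a k l) * M l j)"
      unfolding sum_mult_assoc using Madj[OF a i] by simp
    also have "\<dots> = (\<Sum>k\<in>?W. (\<Sum>l\<in>?W'. cnj (M l i) * M l k) * ?D a k j)"
      unfolding sum_mult_assoc[symmetric] using M[OF a _ j] by simp
    finally show "(\<Sum>k\<in>?W. ?D a i k * (\<Sum>l\<in>?W'. cnj (M l k) * M l j)) =
      (\<Sum>k\<in>?W. (\<Sum>l\<in>?W'. cnj (M l i) * M l k) * ?D a k j)" .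
  qed
  then obtain c where c: "\<And>i j. i \<in> ?W \<Longrightarrow> j \<in> ?W \<Longrightarrow>
      (\<Sum>k\<in>?W'. cnj (M k i) * M k j) = (if i = j then c else 0)" by blast
  have "\<exists>c. \<forall>i\<in>?W'. \<forall>j\<in>?W'. (\<Sum>k\<in>?W. M i k * cnj (M j k)) = (if i = j then c else 0)"
  proof (rule irreducible_commutant_scalar[OF irreducible[OF L']])
    fix a i j assume a: "a \<in> carrier (grp S)" and i: "i \<in> ?W'" and j: "j \<in> ?W'"
    have "(\<Sum>k\<in>?W'. ?D' a i k * (\<Sum>l\<in>?W. M k l * cnj (M j l))) =
        (\<Sum>l\<in>?W. (\<Sum>k\<in>?W. M i k * ?D a k l) * cnj (M j l))"
      unfolding sum_mult_assoc using M[OF a i] by simp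
    also have "\<dots> = (\<Sum>k\<in>?W'. (\<Sum>l\<in>?W. M i l * cnj (M k l)) * ?D' a k j)"
      unfolding sum_mult_assoc[symmetric] using Madj[OF a _ j] by simp
    finally show "(\<Sum>k\<in>?W'. ?D' a i k * (\<Sum>l\<in>?W. M k l * cnj (M j l))) =
      (\<Sum>k\<in>?W'. (\<Sum>l\<in>?W. M i l * cnj (M k l)) * ?D' a k j)" .
  qed
  then obtain c' where c': "\<And>i j. i \<in> ?W' \<Longrightarrow> j \<in> ?W' \<Longrightarrow>
      (\<Sum>k\<in>?W. M i k * cnj (M j k)) = (if i = j then c' else 0)" by blast
  have "M i j = 0" if i: "i \<in> ?W'" and j: "j \<in> ?W" for i j
  proof (rule ccontr)
    assume nz: "M i j \<noteq> 0"
    \<comment> \<open>The scalar \<open>c\<close> is the squared norm of column \<open>j\<close>,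
      and this column contains the nonzero entry \<open>M i j\<close>.\<close>
    have "c = (\<Sum>k\<in>?W'. cnj (M k j) * M k j)" using c[OF j j] by simp
    also have "\<dots> = of_real (\<Sum>k\<in>?W'. (cmod (M k j))\<^sup>2)"
      by (simp add: mult.commute[of "cnj _"] complex_norm_square del: of_real_power)
    finally have "c \<noteq> 0"
      using nz i finite_wt[OF L'] by (auto simp: sum_nonneg_eq_0_iff simp del: of_real_sum)
    \<comment> \<open>Entry \<open>(i, j)\<close> of the product of \<open>M\<close>, its adjoint
      and \<open>M\<close>, bracketed in the two possible ways, gives
      \<open>M i j * c = c' * M i j\<close>.\<close>
    have "M i j * c = (\<Sum>l\<in>?W. M i l * (if l = j then c else 0))"
      using j finite_wt[OF L] by (simp add: if_distrib cong: if_cong)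
    also have "\<dots> = (\<Sum>l\<in>?W. M i l * (\<Sum>k\<in>?W'. cnj (M k l) * M k j))"
      using c[OF _ j] by simp
    also have "\<dots> = (\<Sum>k\<in>?W'. (if i = k then c' else 0) * M k j)"
      unfolding sum_mult_assoc using c'[OF i] by simp
    also have "\<dots> = c' * M i j"
      using i finite_wt[OF L'] by (simp add: if_distrib[where f = "\<lambda>x. x * _"] cong: if_cong)
    finally have "c' = c" using nz by simp
    have "isomorphic_reps (grp S) ?W' ?D' ?W ?D"
      unfolding isomorphic_reps_def
    proof (intro exI conjI)
      show "intertwines (grp S) ?W' ?D' ?W ?D M"
        using M by (simp add: intertwines_def mat_eq_def mmult_def)
      show "mat_eq ?W' ?W' (mmult ?W M (\<lambda>i j. cnj (M j i) / c)) mone"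
        using c' \<open>c \<noteq> 0\<close> \<open>c' = c\<close>
        by (simp add: mat_eq_def mmult_def mone_def sum_divide_distrib[symmetric])
      show "mat_eq ?W ?W (mmult ?W' (\<lambda>i j. cnj (M j i) / c) M) mone"
        using c \<open>c \<noteq> 0\<close> by (simp add: mat_eq_def mmult_def mone_def sum_divide_distrib[symmetric])
    qed
    then show False using system L L' False by (auto simp: coupling_system_def)
  qed
  then show ?thesis using False by auto
qed

section \<open>Clebsch-Gordan coefficients of a fixed pair of irreducible representations\<close>

context
  fixes \<Lambda>1 \<Lambda>2
  assumes L1: "\<Lambda>1 \<in> irr S" and L2: "\<Lambda>2 \<in> irr S"
begin

lemma
  shows decomp_unitary: "unitary_mat (SIGMA x:coupled S \<Lambda>1 \<Lambda>2. wt S (fst x))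
        (wt S \<Lambda>1 \<times> wt S \<Lambda>2) (decomp S \<Lambda>1 \<Lambda>2)"
    and decomp_intertwines: "intertwines (grp S) (SIGMA x:coupled S \<Lambda>1 \<Lambda>2. wt S (fst x))
        (direct_sum_rep (\<lambda>x. rep S (fst x))) (wt S \<Lambda>1 \<times> wt S \<Lambda>2)
        (tensor_rep (rep S \<Lambda>1) (rep S \<Lambda>2)) (decomp S \<Lambda>1 \<Lambda>2)"
  using system L1 L2 by (auto simp: coupling_system_def Let_def case_prod_beta')

lemma decomp_columns:
  assumes "p \<in> wt S \<Lambda>1 \<times> wt S \<Lambda>2" "q \<in> wt S \<Lambda>1 \<times> wt S \<Lambda>2"
  shows "(\<Sum>j\<in>(SIGMA x:coupled S \<Lambda>1 \<Lambda>2. wt S (fst x)).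
      cnj (decomp S \<Lambda>1 \<Lambda>2 j p) * decomp S \<Lambda>1 \<Lambda>2 j q) = (if p = q then 1 else 0)"
  using decomp_unitary assms
  unfolding unitary_mat_def mat_eq_def mmult_def mone_def madjoint_def by blast

lemma decomp_rows:
  assumes "j \<in> (SIGMA x:coupled S \<Lambda>1 \<Lambda>2. wt S (fst x))"
    and "k \<in> (SIGMA x:coupled S \<Lambda>1 \<Lambda>2. wt S (fst x))"
  shows "(\<Sum>p\<in>wt S \<Lambda>1 \<times> wt S \<Lambda>2. decomp S \<Lambda>1 \<Lambda>2 j p * cnj (decomp S \<Lambda>1 \<Lambda>2 k p)) =
    (if j = k then 1 else 0)"
  using decomp_unitary assms
  unfolding unitary_mat_def mat_eq_def mmult_def mone_def madjoint_def by blast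

text \<open>Finiteness is hidden in unitarity. The columns of \<open>decomp\<close> have norm 1, but
  a \<open>sum\<close> over an infinite index set is 0 by convention, so the index set of the direct
  sum must be finite. Every pair in \<open>coupled\<close> is hit by the first projection because
  the weight sets are nonempty.\<close>

lemma finite_coupled: "finite (coupled S \<Lambda>1 \<Lambda>2)"
proof -
  let ?J = "SIGMA x:coupled S \<Lambda>1 \<Lambda>2. wt S (fst x)"
  have "finite ?J"
  proof (rule ccontr)
    assume "infinite ?J"
    moreover obtain p where "p \<in> wt S \<Lambda>1 \<times> wt S \<Lambda>2"
      using wt_nonempty[OF L1] wt_nonempty[OF L2] by blast
    ultimately show False using decomp_columns[of p p] by simp
  qed
  then have "finite (fst ` ?J)" by blast
  moreover have "fst ` ?J = coupled S \<Lambda>1 \<Lambda>2"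
  proof
    show "coupled S \<Lambda>1 \<Lambda>2 \<subseteq> fst ` ?J"
    proof
      fix x assume x: "x \<in> coupled S \<Lambda>1 \<Lambda>2"
      then obtain \<mu> where "\<mu> \<in> wt S (fst x)" using wt_nonempty[OF coupled_irr[OF x]] by blast
      then show "x \<in> fst ` ?J" using x by force
    qed
  qed auto
  ultimately show ?thesis by simp
qed

lemma cg_orthonormal:
  assumes "x \<in> coupled S \<Lambda>1 \<Lambda>2" "y \<in> coupled S \<Lambda>1 \<Lambda>2" "\<mu> \<in> wt S (fst x)" "\<nu> \<in> wt S (fst y)"
  shows "(\<Sum>p\<in>wt S \<Lambda>1 \<times> wt S \<Lambda>2. cnj (cg \<Lambda>1 \<Lambda>2 x p \<mu>) * cg \<Lambda>1 \<Lambda>2 y p \<nu>) =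
    (if x = y \<and> \<mu> = \<nu> then 1 else 0)"
  using decomp_rows[of "(x, \<mu>)" "(y, \<nu>)"] assms
  by (simp add: coupling_inj_def madjoint_def)

text \<open>Columns of \<open>decomp\<close> give completeness and its rows give orthonormality; the
  roles look exchanged because \<open>coupling_inj\<close> is built from the adjoint.\<close>

lemma cg_complete:
  assumes "p \<in> wt S \<Lambda>1 \<times> wt S \<Lambda>2" "q \<in> wt S \<Lambda>1 \<times> wt S \<Lambda>2"
  shows "(\<Sum>x\<in>coupled S \<Lambda>1 \<Lambda>2. \<Sum>\<mu>\<in>wt S (fst x). cg \<Lambda>1 \<Lambda>2 x p \<mu> * cnj (cg \<Lambda>1 \<Lambda>2 x q \<mu>)) =
    (if p = q then 1 else 0)"
proof -
  have "(\<Sum>x\<in>coupled S \<Lambda>1 \<Lambda>2. \<Sum>\<mu>\<in>wt S (fst x). cg \<Lambda>1 \<Lambda>2 x p \<mu> * cnj (cg \<Lambda>1 \<Lambda>2 x q \<mu>)) =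
      (\<Sum>(x, \<mu>)\<in>(SIGMA x:coupled S \<Lambda>1 \<Lambda>2. wt S (fst x)).
        cg \<Lambda>1 \<Lambda>2 x p \<mu> * cnj (cg \<Lambda>1 \<Lambda>2 x q \<mu>))"
    by (rule sum.Sigma) (auto intro: finite_coupled finite_wt coupled_irr)
  also have "\<dots> = (\<Sum>j\<in>(SIGMA x:coupled S \<Lambda>1 \<Lambda>2. wt S (fst x)).
      cnj (decomp S \<Lambda>1 \<Lambda>2 j p) * decomp S \<Lambda>1 \<Lambda>2 j q)"
    by (intro sum.cong) (auto simp: coupling_inj_def madjoint_def)
  also have "\<dots> = (if p = q then 1 else 0)"
    by (rule decomp_columns[OF assms])
  finally show ?thesis .
qed

text \<open>\<open>coupling_system\<close> provides equivariance of \<open>decomp\<close>, here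
  written M, in the form M T = E M for the tensor representation T and the direct sum E. For its
  inverse M' one has T M' = M' M T M' = M' E M M' = M' E, which is the chain of equations below in
  coordinates.\<close>

lemma cg_intertwines:
  assumes a: "a \<in> carrier (grp S)" and p: "p \<in> wt S \<Lambda>1 \<times> wt S \<Lambda>2"
    and x: "x \<in> coupled S \<Lambda>1 \<Lambda>2" and \<mu>: "\<mu> \<in> wt S (fst x)"
  shows "(\<Sum>q\<in>wt S \<Lambda>1 \<times> wt S \<Lambda>2.
      (rep S \<Lambda>1 a (fst p) (fst q) * rep S \<Lambda>2 a (snd p) (snd q)) * cg \<Lambda>1 \<Lambda>2 x q \<mu>) =
    (\<Sum>\<nu>\<in>wt S (fst x). cg \<Lambda>1 \<Lambda>2 x p \<nu> * rep S (fst x) a \<nu> \<mu>)"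
proof -
  let ?I = "wt S \<Lambda>1 \<times> wt S \<Lambda>2" and ?J = "SIGMA x:coupled S \<Lambda>1 \<Lambda>2. wt S (fst x)"
  let ?T = "tensor_rep (rep S \<Lambda>1) (rep S \<Lambda>2) a" and ?E = "direct_sum_rep (\<lambda>x. rep S (fst x)) a"
  let ?M = "decomp S \<Lambda>1 \<Lambda>2"
  have fin: "finite ?I" "finite ?J"
    by (auto intro: finite_coupled finite_wt coupled_irr L1 L2)
  have x\<mu>: "(x, \<mu>) \<in> ?J" using x \<mu> by simp
  have 1: "(\<Sum>j\<in>?J. cnj (?M j p) * ?M j q) = (if p = q then 1 else 0)" if "q \<in> ?I" for q
    using decomp_columns p that by blast
  have 2: "(\<Sum>q\<in>?I. ?M j q * cnj (?M (x, \<mu>) q)) = (if j = (x, \<mu>) then 1 else 0)" if "j \<in> ?J" for j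
    using decomp_rows x\<mu> that by blast
  have 3: "(\<Sum>q\<in>?I. ?M j q * ?T q r) = (\<Sum>k\<in>?J. ?E j k * ?M k r)" if "j \<in> ?J" "r \<in> ?I" for j r
    using decomp_intertwines[unfolded intertwines_def mat_eq_def mmult_def, THEN bspec, OF a,
        THEN bspec, OF that(1), THEN bspec, OF that(2)] by simp
  have "(\<Sum>r\<in>?I. ?T p r * cnj (?M (x, \<mu>) r)) =
      (\<Sum>q\<in>?I. (if p = q then 1 else 0) * (\<Sum>r\<in>?I. ?T q r * cnj (?M (x, \<mu>) r)))"
    using p fin by (simp add: sum_delta_mult del: mem_Sigma_iff)
  also have "\<dots> = (\<Sum>q\<in>?I. (\<Sum>j\<in>?J. cnj (?M j p) * ?M j q) * (\<Sum>r\<in>?I. ?T q r * cnj (?M (x, \<mu>) r)))"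
    using 1 by simp
  also have "\<dots> = (\<Sum>j\<in>?J. cnj (?M j p) * (\<Sum>q\<in>?I. ?M j q * (\<Sum>r\<in>?I. ?T q r * cnj (?M (x, \<mu>) r))))"
    by (rule sum_mult_assoc[symmetric])
  also have "\<dots> = (\<Sum>j\<in>?J. cnj (?M j p) * (\<Sum>r\<in>?I. (\<Sum>q\<in>?I. ?M j q * ?T q r) * cnj (?M (x, \<mu>) r)))"
    by (simp only: sum_mult_assoc)
  also have "\<dots> = (\<Sum>j\<in>?J. cnj (?M j p) * (\<Sum>r\<in>?I. (\<Sum>k\<in>?J. ?E j k * ?M k r) * cnj (?M (x, \<mu>) r)))"
    using 3 by simp
  also have "\<dots> = (\<Sum>j\<in>?J. cnj (?M j p) * (\<Sum>k\<in>?J. ?E j k * (\<Sum>r\<in>?I. ?M k r * cnj (?M (x, \<mu>) r))))"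
    by (simp only: sum_mult_assoc)
  also have "\<dots> = (\<Sum>j\<in>?J. cnj (?M j p) * (\<Sum>k\<in>?J. ?E j k * (if k = (x, \<mu>) then 1 else 0)))"
    using 2 by simp
  also have "\<dots> = (\<Sum>j\<in>?J. cnj (?M j p) * ?E j (x, \<mu>))"
    using x\<mu> fin by (simp add: sum_delta_mult del: mem_Sigma_iff)
  also have "\<dots> = (\<Sum>y\<in>coupled S \<Lambda>1 \<Lambda>2. \<Sum>\<nu>\<in>wt S (fst y). cnj (?M (y, \<nu>) p) * ?E (y, \<nu>) (x, \<mu>))"
    by (subst sum.Sigma) (auto intro: finite_coupled finite_wt coupled_irr simp: case_prod_beta')
  \<comment> \<open>\<open>direct_sum_rep\<close> is block diagonal, so only the block of
    \<open>x\<close> contributes.\<close>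
  also have "\<dots> = (\<Sum>y\<in>coupled S \<Lambda>1 \<Lambda>2. if y = x then
      \<Sum>\<nu>\<in>wt S (fst x). cnj (?M (x, \<nu>) p) * rep S (fst x) a \<nu> \<mu> else 0)"
    by (intro sum.cong) (auto simp: direct_sum_rep_def)
  also have "\<dots> = (\<Sum>\<nu>\<in>wt S (fst x). cnj (?M (x, \<nu>) p) * rep S (fst x) a \<nu> \<mu>)"
    using x finite_coupled by simp
  finally show ?thesis
    by (simp add: coupling_inj_def madjoint_def tensor_rep_def case_prod_beta')
qed

end

end

subsection \<open>Trees and their injections\<close>

lemma prod_lessThan_add:
  fixes f :: "nat \<Rightarrow> 'a::comm_monoid_mult"
  shows "(\<Prod>i<m + n. f i) = (\<Prod>i<m. f i) * (\<Prod>i<n. f (m + i))"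
  by (induction n) (simp_all add: mult.assoc)

lemma prod_indicator:
  fixes n :: nat
  shows
  "(\<Prod>i<n. if P i then 1 else 0) = (if \<forall>i<n. P i then 1 else (0::'a::comm_semiring_1))"
  by (induction n) (auto simp: less_Suc_eq)

text \<open>The mixed product rule for tensor products of operators, in coordinates. The bracketing
  is the one left behind by \<open>sum_mult_assoc\<close>, so that the two combine.\<close>

lemma sum_Times_mult:
  fixes f :: "'a \<Rightarrow> 'c::comm_semiring_1"
  shows "(\<Sum>u\<in>U \<times> V. (f (fst u) * g (snd u)) * (f' (fst u) * g' (snd u))) =
    (\<Sum>u\<in>U. f u * f' u) * (\<Sum>v\<in>V. g v * g' v)"
  by (simp add: sum_product sum.cartesian_product case_prod_beta' ac_simps)

lemma sum_rotate: "(\<Sum>x\<in>A. \<Sum>y\<in>B. \<Sum>z\<in>C. f x y z) = (\<Sum>y\<in>B. \<Sum>z\<in>C. \<Sum>x\<in>A. f x y z)"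
  by (subst sum.swap) (intro sum.cong refl sum.swap)

text \<open>The set \<open>D x\<close> may depend on \<open>x\<close>: weight labels range over the
  weight set of the representation selected by the outer index, so such a pair of sums has to move
  as a block.\<close>

lemma sum_swap_pairs:
  "(\<Sum>x\<in>A. \<Sum>w\<in>D x. \<Sum>y\<in>B. \<Sum>z\<in>C. f x w y z) =
    (\<Sum>y\<in>B. \<Sum>z\<in>C. \<Sum>x\<in>A. \<Sum>w\<in>D x. f x w y z)"
proof -
  have "(\<Sum>x\<in>A. \<Sum>w\<in>D x. \<Sum>y\<in>B. \<Sum>z\<in>C. f x w y z) =
      (\<Sum>x\<in>A. \<Sum>y\<in>B. \<Sum>z\<in>C. \<Sum>w\<in>D x. f x w y z)"
    by (intro sum.cong refl sum_rotate)
  also have "\<dots> = (\<Sum>y\<in>B. \<Sum>z\<in>C. \<Sum>x\<in>A. \<Sum>w\<in>D x. f x w y z)"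
    by (rule sum_rotate)
  finally show ?thesis .
qed

text \<open>Completeness in the form in which it climbs up a tree: it is applied to the coupling at
  a root, to a whole tree and to the tree above the leaf couplings. Coefficients are taken without
  conjugation, as they arise from composing injections.\<close>

lemma parseval:
  fixes f g :: "'p \<Rightarrow> complex"
  assumes fin: "finite W"
    and complete: "\<And>p q. p \<in> W \<Longrightarrow> q \<in> W \<Longrightarrow>
      (\<Sum>x\<in>K. \<Sum>\<mu>\<in>M x. e x p \<mu> * cnj (e x q \<mu>)) = (if p = q then 1 else 0)"
  shows "(\<Sum>x\<in>K. \<Sum>\<mu>\<in>M x. (\<Sum>p\<in>W. f p * e x p \<mu>) * cnj (\<Sum>p\<in>W. g p * e x p \<mu>)) =
    (\<Sum>p\<in>W. f p * cnj (g p))"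
proof -
  have "(\<Sum>x\<in>K. \<Sum>\<mu>\<in>M x. (\<Sum>p\<in>W. f p * e x p \<mu>) * cnj (\<Sum>p\<in>W. g p * e x p \<mu>)) =
      (\<Sum>x\<in>K. \<Sum>\<mu>\<in>M x. \<Sum>p\<in>W. \<Sum>q\<in>W. f p * cnj (g q) * (e x p \<mu> * cnj (e x q \<mu>)))"
    by (simp add: sum_product ac_simps)
  also have "\<dots> = (\<Sum>p\<in>W. \<Sum>q\<in>W. \<Sum>x\<in>K. \<Sum>\<mu>\<in>M x.
      f p * cnj (g q) * (e x p \<mu> * cnj (e x q \<mu>)))"
    by (rule sum_swap_pairs)
  also have "\<dots> = (\<Sum>p\<in>W. \<Sum>q\<in>W. f p * cnj (g q) * (if p = q then 1 else 0))"
    by (intro sum.cong refl) (simp only: sum_distrib_left[symmetric] complete)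
  also have "\<dots> = (\<Sum>p\<in>W. f p * cnj (g p))"
    using fin by (intro sum.cong refl) (simp add: if_distrib[where f = "\<lambda>x. _ * x"] cong: if_cong)
  finally show ?thesis .
qed

lemma sum_listset2_prod:
  fixes f :: "nat \<Rightarrow> 'a \<times> 'b \<Rightarrow> 'c::comm_semiring_1"
  assumes "length As = n" "length Bs = n"
  shows "(\<Sum>xs\<in>listset As. \<Sum>ys\<in>listset Bs. \<Prod>i<n. f i (xs ! i, ys ! i)) =
    (\<Prod>i<n. \<Sum>p\<in>As ! i \<times> Bs ! i. f i p)"
proof -
  have "(\<Sum>xs\<in>listset As. \<Sum>ys\<in>listset Bs. \<Prod>i<n. f i (xs ! i, ys ! i)) =
      (\<Sum>xs\<in>listset As. \<Prod>i<n. \<Sum>y\<in>Bs ! i. f i (xs ! i, y))"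
    using sum_listset_prod[of "\<lambda>i y. f i (_ ! i, y)" Bs] assms by simp
  also have "\<dots> = (\<Prod>i<n. \<Sum>x\<in>As ! i. \<Sum>y\<in>Bs ! i. f i (x, y))"
    using sum_listset_prod[of "\<lambda>i x. \<Sum>y\<in>Bs ! i. f i (x, y)" As] assms by simp
  finally show ?thesis by (simp add: sum.cartesian_product)
qed

section \<open>Interleaving of lists, the leaf order of the duplicated tree\<close>

lemma splice_append:
  "length xs = length ys \<Longrightarrow> splice (xs @ xs') (ys @ ys') = splice xs ys @ splice xs' ys'"
  by (induction xs ys rule: list_induct2) auto

lemma splice_nth:
  "length xs = length ys \<Longrightarrow> i < length xs \<Longrightarrow>
    splice xs ys ! (2 * i) = xs ! i \<and> splice xs ys ! Suc (2 * i) = ys ! i"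
  by (induction xs ys arbitrary: i rule: list_induct2) (auto simp: nth_Cons split: nat.splits)

lemma map_splice: "map f (splice xs ys) = splice (map f xs) (map f ys)"
  by (induction xs ys rule: splice.induct) auto

lemma sum_listset_splice:
  assumes "length As = length Bs"
  shows "(\<Sum>zs\<in>listset (splice As Bs). f zs) =
    (\<Sum>xs\<in>listset As. \<Sum>ys\<in>listset Bs. f (splice xs ys))"
  using assms
proof (induction As Bs arbitrary: f rule: list_induct2)
  case (Cons A As B Bs)
  have "(\<Sum>zs\<in>listset (splice (A # As) (B # Bs)). f zs) =
      (\<Sum>x\<in>A. \<Sum>y\<in>B. \<Sum>xs\<in>listset As. \<Sum>ys\<in>listset Bs. f (x # y # splice xs ys))"
    using Cons.IH by (simp add: sum_listset_Cons del: listset.simps(2))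
  also have "\<dots> = (\<Sum>x\<in>A. \<Sum>xs\<in>listset As. \<Sum>y\<in>B. \<Sum>ys\<in>listset Bs. f (x # y # splice xs ys))"
    by (intro sum.cong refl sum.swap)
  finally show ?case by (simp add: sum_listset_Cons del: listset.simps(2))
qed simp

section \<open>Shapes of trees and their leaf sequences\<close>

lemma tree_of_simps [simp]:
  "tree_of (Leaf y) = Leaf ()" "tree_of (Node x l r) = Node () (tree_of l) (tree_of r)"
  by (simp_all add: tree_of_def)

lemma tree_of_eq_Leaf: "tree_of t = Leaf u \<longleftrightarrow> (\<exists>y. t = Leaf y)"
  by (cases t) auto

lemma tree_of_eq_Node: "tree_of t = Node u L R \<longleftrightarrow>
    (\<exists>x l r. t = Node x l r \<and> tree_of l = L \<and> tree_of r = R)"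
  by (cases t) auto

lemma num_leaves_tree_of [simp]: "num_leaves (tree_of t) = num_leaves t"
  by (induction t) auto

text \<open>With trivial data at the nodes, shape and leaf sequence determine the tree. Together
  with the existence statement that follows, this makes an assignment of multiplicity indices,
  encoded as a tree, interchangeable with a list.\<close>

lemma leaves_inject:
  fixes t t' :: "('a, unit) btree"
  shows "tree_of t = tree_of t' \<Longrightarrow> leaves t = leaves t' \<longleftrightarrow> t = t'"
proof (induction t arbitrary: t')
  case (Leaf y)
  then show ?case by (cases t') auto
next
  case (Node x l r)
  then obtain l' r' where t': "t' = Node () l' r'" "tree_of l = tree_of l'" "tree_of r = tree_of r'"
    by (cases t') auto
  have "num_leaves l = num_leaves l'" using t'(2) num_leaves_tree_of by metis
  then show ?case using Node.IH t' by simp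
qed

lemma tree_with_leaves_exists:
  "length ys = num_leaves T \<Longrightarrow> \<exists>t :: ('a, unit) btree. tree_of t = tree_of T \<and> leaves t = ys"
proof (induction T arbitrary: ys)
  case (Leaf u)
  then obtain y where "ys = [y]" by (auto simp: length_Suc_conv)
  then show ?case by (intro exI[of _ "Leaf y"]) simp
next
  case (Node x L R)
  obtain l r :: "('a, unit) btree" where
    "tree_of l = tree_of L" "leaves l = take (num_leaves L) ys"
    "tree_of r = tree_of R" "leaves r = drop (num_leaves L) ys"
    using Node.IH(1)[of "take (num_leaves L) ys"] Node.IH(2)[of "drop (num_leaves L) ys"] Node.prems
    by fastforce
  then show ?case by (intro exI[of _ "Node () l r"]) simp
qed

lemma tree_of_idem: "tree_of (T :: coupling_tree) = T"
  by (induction T) auto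

section \<open>Equivariance and completeness of the tree injections\<close>

context coupling
begin

lemma wts_append: "wts S (As @ Bs) = listset (map (wt S) As @ map (wt S) Bs)"
  by (simp add: wts_def)

lemma in_wts_iff:
  "xs \<in> wts S \<Lambda>s \<longleftrightarrow> length xs = length \<Lambda>s \<and> (\<forall>i<length \<Lambda>s. xs ! i \<in> wt S (\<Lambda>s ! i))"
  by (auto simp: wts_def in_listset_iff)

lemma finite_wts: "set \<Lambda>s \<subseteq> irr S \<Longrightarrow> finite (wts S \<Lambda>s)"
  unfolding wts_def by (rule finite_listset) (auto intro: finite_wt)

lemma wts_appendE:
  assumes "zs \<in> wts S (As @ Bs)"
  obtains xs ys where "zs = xs @ ys" "xs \<in> wts S As" "ys \<in> wts S Bs"
proof (rule that)
  show "zs = take (length As) zs @ drop (length As) zs" by simp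
  show "take (length As) zs \<in> wts S As"
    unfolding in_wts_iff
  proof (intro conjI allI impI)
    fix i assume "i < length As"
    then show "take (length As) zs ! i \<in> wt S (As ! i)"
      using assms[unfolded in_wts_iff, THEN conjunct2, rule_format, of i] by (simp add: nth_append)
  qed (use assms in \<open>simp add: in_wts_iff\<close>)
  show "drop (length As) zs \<in> wts S Bs"
    unfolding in_wts_iff
  proof (intro conjI allI impI)
    fix i assume "i < length Bs"
    then show "drop (length As) zs ! i \<in> wt S (Bs ! i)"
      using assms[unfolded in_wts_iff] by (auto simp: nth_append dest: spec[of _ "length As + i"])
  qed (use assms in \<open>simp add: in_wts_iff\<close>)
qed

lemma sum_wts_append:
  "(\<Sum>zs\<in>wts S (As @ Bs). f zs) = (\<Sum>u\<in>wts S As \<times> wts S Bs. f (fst u @ snd u))"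
  unfolding wts_append sum_listset_append
  by (simp add: wts_def sum.cartesian_product case_prod_beta')

lemma reps_append:
  assumes "length gs = length As" "length xs = length As" "length us = length As"
  shows "reps S (As @ Bs) (gs @ hs) (xs @ ys) (us @ vs) = reps S As gs xs us * reps S Bs hs ys vs"
  using assms by (simp add: reps_def prod_lessThan_add nth_append)

lemma admissible_irr: "admissible S \<alpha> \<Longrightarrow> root_weight \<alpha> \<in> irr S \<and> set (leaves \<alpha>) \<subseteq> irr S"
  by (induction \<alpha>) (auto dest: coupled_irr)

lemma tree_inj_Node:
  assumes "length xs = num_leaves l"
  shows "tree_inj S (Node x l r) (xs @ ys) \<mu> =
    (\<Sum>p\<in>wt S (root_weight l) \<times> wt S (root_weight r).
      (tree_inj S l xs (fst p) * tree_inj S r ys (snd p)) *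
        cg (root_weight l) (root_weight r) x p \<mu>)"
  using assms by (simp add: mmult_def tensor_append_def case_prod_beta')

text \<open>At a node, the tensor product of two equivariant maps is composed with an equivariant
  coupling. Only the diagonal action is possible here, hence \<open>replicate\<close>: the coupling
  needs the same group element on both subtrees.\<close>

lemma tree_inj_intertwines:
  assumes "admissible S \<alpha>" "a \<in> carrier (grp S)" "zs \<in> wts S (leaves \<alpha>)"
    "\<mu> \<in> wt S (root_weight \<alpha>)"
  shows "(\<Sum>us\<in>wts S (leaves \<alpha>).
      reps S (leaves \<alpha>) (replicate (num_leaves \<alpha>) a) zs us * tree_inj S \<alpha> us \<mu>) =
    (\<Sum>\<nu>\<in>wt S (root_weight \<alpha>). tree_inj S \<alpha> zs \<nu> * rep S (root_weight \<alpha>) a \<nu> \<mu>)"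
  using assms
proof (induction \<alpha> arbitrary: zs \<mu>)
  case (Leaf \<Lambda>)
  then have fin: "finite (wt S \<Lambda>)" using finite_wt by simp
  from Leaf.prems obtain z where z: "zs = [z]" "z \<in> wt S \<Lambda>"
    by (auto simp: in_wts_iff length_Suc_conv)
  have wts: "(\<Sum>us\<in>wts S [\<Lambda>]. f us) = (\<Sum>u\<in>wt S \<Lambda>. f [u])" for f :: "'m list \<Rightarrow> complex"
    by (simp add: wts_def sum_listset_Cons del: listset.simps(2))
  have "(\<Sum>us\<in>wts S (leaves (Leaf \<Lambda>)).
      reps S (leaves (Leaf \<Lambda>)) (replicate (num_leaves (Leaf \<Lambda>)) a) zs us *
        tree_inj S (Leaf \<Lambda>) us \<mu>) = (\<Sum>u\<in>wt S \<Lambda>. rep S \<Lambda> a z u * (if u = \<mu> then 1 else 0))"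
    by (simp add: wts reps_def z)
  also have "\<dots> = rep S \<Lambda> a z \<mu>" using fin Leaf.prems by (simp add: sum_delta_mult)
  also have "\<dots> = (\<Sum>\<nu>\<in>wt S \<Lambda>. (if z = \<nu> then 1 else 0) * rep S \<Lambda> a \<nu> \<mu>)"
    using fin z by (simp add: sum_delta_mult)
  finally show ?case by (simp add: z)
next
  case (Node x l r)
  from Node.prems obtain xs ys where zs: "zs = xs @ ys"
    "xs \<in> wts S (leaves l)" "ys \<in> wts S (leaves r)" by (auto elim: wts_appendE)
  have irr: "root_weight l \<in> irr S" "root_weight r \<in> irr S"
    using Node.prems admissible_irr by auto
  let ?tl = "tree_inj S l" and ?tr = "tree_inj S r"
  let ?W = "wt S (root_weight l) \<times> wt S (root_weight r)"
  let ?U = "wts S (leaves l) \<times> wts S (leaves r)"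
  let ?Rl = "reps S (leaves l) (replicate (num_leaves l) a)"
  let ?Rr = "reps S (leaves r) (replicate (num_leaves r) a)"
  let ?Dl = "rep S (root_weight l) a" and ?Dr = "rep S (root_weight r) a"
  let ?c = "cg (root_weight l) (root_weight r) x"
  note IHl = Node.IH(1)[OF _ Node.prems(2) zs(2)]
  note IHr = Node.IH(2)[OF _ Node.prems(2) zs(3)]
  have "(\<Sum>us\<in>wts S (leaves (Node x l r)).
      reps S (leaves (Node x l r)) (replicate (num_leaves (Node x l r)) a) zs us *
        tree_inj S (Node x l r) us \<mu>) =
      (\<Sum>u\<in>?U. (?Rl xs (fst u) * ?Rr ys (snd u)) *
        (\<Sum>p\<in>?W. (?tl (fst u) (fst p) * ?tr (snd u) (snd p)) * ?c p \<mu>))"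
    unfolding leaves.simps sum_wts_append
  proof (rule sum.cong[OF refl])
    fix u assume "u \<in> ?U"
    then have len: "length (fst u) = num_leaves l" by (auto simp: in_wts_iff)
    have "length xs = num_leaves l" using zs by (simp add: in_wts_iff)
    then show "reps S (leaves l @ leaves r) (replicate (length (leaves l @ leaves r)) a) zs (fst u @ snd u) *
      tree_inj S (Node x l r) (fst u @ snd u) \<mu> = (?Rl xs (fst u) * ?Rr ys (snd u)) *
        (\<Sum>p\<in>?W. (?tl (fst u) (fst p) * ?tr (snd u) (snd p)) * ?c p \<mu>)"
      by (simp only: tree_inj_Node[OF len] zs length_append replicate_add reps_append len length_replicate)
  qed
  \<comment> \<open>The mixed product rule separates the two subtrees, so that each induction
    hypothesis applies to its own factor.\<close>
  also have "\<dots> = (\<Sum>p\<in>?W. ((\<Sum>u\<in>wts S (leaves l). ?Rl xs u * ?tl u (fst p)) *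
      (\<Sum>u\<in>wts S (leaves r). ?Rr ys u * ?tr u (snd p))) * ?c p \<mu>)"
    unfolding sum_mult_assoc
    by (intro sum.cong refl arg_cong2[where f = "(*)"] sum_Times_mult sum_Times_mult[symmetric])
  also have "\<dots> = (\<Sum>p\<in>?W. ((\<Sum>q\<in>wt S (root_weight l). ?tl xs q * ?Dl q (fst p)) *
      (\<Sum>q\<in>wt S (root_weight r). ?tr ys q * ?Dr q (snd p))) * ?c p \<mu>)"
    using Node.prems by (intro sum.cong refl) (auto simp: IHl IHr)
  also have "\<dots> = (\<Sum>q\<in>?W. (?tl xs (fst q) * ?tr ys (snd q)) *
      (\<Sum>p\<in>?W. (?Dl (fst q) (fst p) * ?Dr (snd q) (snd p)) * ?c p \<mu>))"
    unfolding sum_mult_assoc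
    by (intro sum.cong refl arg_cong2[where f = "(*)"] sum_Times_mult sum_Times_mult[symmetric])
  \<comment> \<open>Both subtrees now carry the same \<open>a\<close>, and equivariance of the root
    coupling moves it to the root.\<close>
  also have "\<dots> = (\<Sum>q\<in>?W. (?tl xs (fst q) * ?tr ys (snd q)) *
      (\<Sum>\<nu>\<in>wt S (fst x). ?c q \<nu> * rep S (fst x) a \<nu> \<mu>))"
    using Node.prems irr by (intro sum.cong refl) (simp add: cg_intertwines)
  also have "\<dots> = (\<Sum>\<nu>\<in>wt S (fst x). tree_inj S (Node x l r) zs \<nu> * rep S (fst x) a \<nu> \<mu>)"
  proof -
    have len: "length xs = num_leaves l" using zs by (simp add: in_wts_iff)
    show ?thesis unfolding sum_mult_assoc zs tree_inj_Node[OF len] by simp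
  qed
  finally show ?case by simp
qed

lemma cg_parseval:
  assumes "\<Lambda>1 \<in> irr S" "\<Lambda>2 \<in> irr S"
  shows "(\<Sum>x\<in>coupled S \<Lambda>1 \<Lambda>2. \<Sum>\<mu>\<in>wt S (fst x).
      (\<Sum>p\<in>wt S \<Lambda>1 \<times> wt S \<Lambda>2. f p * cg \<Lambda>1 \<Lambda>2 x p \<mu>) *
        cnj (\<Sum>p\<in>wt S \<Lambda>1 \<times> wt S \<Lambda>2. g p * cg \<Lambda>1 \<Lambda>2 x p \<mu>)) =
    (\<Sum>p\<in>wt S \<Lambda>1 \<times> wt S \<Lambda>2. f p * cnj (g p))"
  using assms by (intro parseval cg_complete) (auto intro: finite_wt)

text \<open>In contrast to \<open>labellings_with\<close>, the root weight is left free: an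
  orthonormal basis of the whole tensor product needs all irreducible constituents.\<close>

definition labellings_on :: "coupling_tree \<Rightarrow> 'l list \<Rightarrow> 'l labelling set" where
  "labellings_on T \<Lambda>s = {\<alpha> \<in> labellings S T. leaves \<alpha> = \<Lambda>s}"

lemma labellings_on_Leaf: "\<Lambda> \<in> irr S \<Longrightarrow> labellings_on (Leaf u) [\<Lambda>] = {Leaf \<Lambda>}"
  by (auto simp: labellings_on_def labellings_def tree_of_eq_Leaf)

text \<open>The recursion behind finiteness and completeness. The range of the root label depends on
  the root weights of both subtree labellings, hence the dependent sum; the length condition fixes
  where the leaf list is cut.\<close>

lemma bij_betw_labellings_on_Node:
  assumes "length As = num_leaves L"
  shows "bij_betw (\<lambda>((l, r), x). Node x l r)
    (SIGMA lr:labellings_on L As \<times> labellings_on R Bs.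
      coupled S (root_weight (fst lr)) (root_weight (snd lr)))
    (labellings_on (Node u L R) (As @ Bs))" (is "bij_betw ?f ?A ?B")
proof -
  have "?f ` ?A = ?B"
  proof
    show "?f ` ?A \<subseteq> ?B" by (auto simp: labellings_on_def labellings_def)
    show "?B \<subseteq> ?f ` ?A"
    proof
      fix \<alpha> assume "\<alpha> \<in> ?B"
      then obtain x l r where \<alpha>: "\<alpha> = Node x l r" "tree_of l = L" "tree_of r = R"
          "leaves l @ leaves r = As @ Bs" "admissible S l" "admissible S r"
          "x \<in> coupled S (root_weight l) (root_weight r)"
        by (auto simp: labellings_on_def labellings_def tree_of_eq_Node)
      moreover have "num_leaves l = length As" using \<alpha>(2) assms by auto
      ultimately have "((l, r), x) \<in> ?A" by (auto simp: labellings_on_def labellings_def)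
      then show "\<alpha> \<in> ?f ` ?A" using \<alpha>(1) by force
    qed
  qed
  moreover have "inj_on ?f ?A" by (auto simp: inj_on_def)
  ultimately show ?thesis by (simp add: bij_betw_def)
qed

lemma finite_labellings_on:
  "length \<Lambda>s = num_leaves T \<Longrightarrow> set \<Lambda>s \<subseteq> irr S \<Longrightarrow> finite (labellings_on T \<Lambda>s)"
proof (induction T arbitrary: \<Lambda>s)
  case (Leaf u)
  then obtain \<Lambda> where "\<Lambda>s = [\<Lambda>]" "\<Lambda> \<in> irr S" by (auto simp: length_Suc_conv)
  then show ?case by (simp add: labellings_on_Leaf)
next
  case (Node u L R)
  define As Bs where "As = take (num_leaves L) \<Lambda>s" and "Bs = drop (num_leaves L) \<Lambda>s"
  have AB: "\<Lambda>s = As @ Bs" "length As = num_leaves L" "length Bs = num_leaves R"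
    "set As \<subseteq> irr S" "set Bs \<subseteq> irr S"
    using Node.prems by (auto simp: As_def Bs_def dest: in_set_takeD in_set_dropD)
  have "root_weight \<alpha> \<in> irr S" if "\<alpha> \<in> labellings_on T \<Lambda>s" for \<alpha> T \<Lambda>s
    using that admissible_irr by (auto simp: labellings_on_def labellings_def)
  then have "finite (SIGMA lr:labellings_on L As \<times> labellings_on R Bs.
      coupled S (root_weight (fst lr)) (root_weight (snd lr)))"
    using Node.IH AB by (intro finite_SigmaI finite_cartesian_product finite_coupled) auto
  then show ?case
    using bij_betw_finite[OF bij_betw_labellings_on_Node[OF AB(2), of R Bs u]] AB(1) by simp
qed

text \<open>By induction on the tree. Completeness of the root coupling eliminates the root label,
  after which the sums over the labellings of the two subtrees are independent.\<close>

lemma tree_inj_complete: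
  assumes "length \<Lambda>s = num_leaves T" "set \<Lambda>s \<subseteq> irr S" "zs \<in> wts S \<Lambda>s" "us \<in> wts S \<Lambda>s"
  shows "(\<Sum>\<alpha>\<in>labellings_on T \<Lambda>s. \<Sum>\<mu>\<in>wt S (root_weight \<alpha>).
      tree_inj S \<alpha> zs \<mu> * cnj (tree_inj S \<alpha> us \<mu>)) = (if zs = us then 1 else 0)"
  using assms
proof (induction T arbitrary: \<Lambda>s zs us)
  case (Leaf u)
  then obtain \<Lambda> where \<Lambda>: "\<Lambda>s = [\<Lambda>]" "\<Lambda> \<in> irr S" by (auto simp: length_Suc_conv)
  moreover obtain z where "zs = [z]" "z \<in> wt S \<Lambda>"
    using Leaf.prems \<Lambda> by (auto simp: in_wts_iff length_Suc_conv)
  moreover obtain u where "us = [u]" "u \<in> wt S \<Lambda>"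
    using Leaf.prems \<Lambda> by (auto simp: in_wts_iff length_Suc_conv)
  ultimately show ?case
    using finite_wt by (simp add: labellings_on_Leaf sum_delta_mult if_distrib[of cnj] cong: if_cong)
next
  case (Node u L R)
  define As Bs where "As = take (num_leaves L) \<Lambda>s" and "Bs = drop (num_leaves L) \<Lambda>s"
  have AB: "\<Lambda>s = As @ Bs" "length As = num_leaves L" "length Bs = num_leaves R"
    "set As \<subseteq> irr S" "set Bs \<subseteq> irr S"
    using Node.prems by (auto simp: As_def Bs_def dest: in_set_takeD in_set_dropD)
  obtain xs ys where zs: "zs = xs @ ys" "xs \<in> wts S As" "ys \<in> wts S Bs"
    using Node.prems AB(1) by (auto elim: wts_appendE)
  obtain vs ws where us: "us = vs @ ws" "vs \<in> wts S As" "ws \<in> wts S Bs"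
    using Node.prems AB(1) by (auto elim: wts_appendE)
  \<comment> \<open>For fixed subtree labellings, \<open>cg_parseval\<close> replaces the coupled
    basis by the product basis of the two root spaces, and the sum over the latter
    factorises.\<close>
  have node: "(\<Sum>x\<in>coupled S (root_weight l) (root_weight r). \<Sum>\<mu>\<in>wt S (fst x).
      tree_inj S (Node x l r) zs \<mu> * cnj (tree_inj S (Node x l r) us \<mu>)) =
      (\<Sum>p\<in>wt S (root_weight l). tree_inj S l xs p * cnj (tree_inj S l vs p)) *
      (\<Sum>p\<in>wt S (root_weight r). tree_inj S r ys p * cnj (tree_inj S r ws p))"
    if l: "l \<in> labellings_on L As" and r: "r \<in> labellings_on R Bs" for l r
  proof -
    have irr: "root_weight l \<in> irr S" "root_weight r \<in> irr S"
      using l r admissible_irr by (auto simp: labellings_on_def labellings_def)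
    have len: "length xs = num_leaves l" "length vs = num_leaves l"
      using zs us l by (auto simp: labellings_on_def in_wts_iff)
    show ?thesis
      unfolding zs us tree_inj_Node[OF len(1)] tree_inj_Node[OF len(2)] cg_parseval[OF irr]
      by (simp add: sum_Times_mult[symmetric])
  qed
  define H where "H \<alpha> = (\<Sum>\<mu>\<in>wt S (root_weight \<alpha>).
      tree_inj S \<alpha> zs \<mu> * cnj (tree_inj S \<alpha> us \<mu>))" for \<alpha>
  let ?P = "labellings_on L As \<times> labellings_on R Bs"
  let ?K = "\<lambda>lr. coupled S (root_weight (fst lr)) (root_weight (snd lr))"
  have fin: "finite ?P" using finite_labellings_on AB by blast
  have finK: "\<forall>lr\<in>?P. finite (?K lr)"
    using admissible_irr by (auto intro!: finite_coupled simp: labellings_on_def labellings_def)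
  have "(\<Sum>\<alpha>\<in>labellings_on (Node u L R) \<Lambda>s. H \<alpha>) =
      (\<Sum>z\<in>Sigma ?P ?K. H ((\<lambda>((l, r), x). Node x l r) z))"
    unfolding AB(1) by (rule sum.reindex_bij_betw[OF bij_betw_labellings_on_Node[OF AB(2)], symmetric])
  also have "\<dots> = (\<Sum>(lr, x)\<in>Sigma ?P ?K. H (Node x (fst lr) (snd lr)))"
    by (simp add: case_prod_beta')
  also have "\<dots> = (\<Sum>lr\<in>?P. \<Sum>x\<in>?K lr. H (Node x (fst lr) (snd lr)))"
    by (rule sum.Sigma[OF fin finK, symmetric])
  also have "\<dots> = (\<Sum>lr\<in>labellings_on L As \<times> labellings_on R Bs.
      (\<Sum>p\<in>wt S (root_weight (fst lr)). tree_inj S (fst lr) xs p * cnj (tree_inj S (fst lr) vs p)) *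
      (\<Sum>p\<in>wt S (root_weight (snd lr)). tree_inj S (snd lr) ys p * cnj (tree_inj S (snd lr) ws p)))"
  proof (intro sum.cong refl)
    fix lr assume "lr \<in> ?P"
    then show "(\<Sum>x\<in>?K lr. H (Node x (fst lr) (snd lr))) =
        (\<Sum>p\<in>wt S (root_weight (fst lr)). tree_inj S (fst lr) xs p * cnj (tree_inj S (fst lr) vs p)) *
        (\<Sum>p\<in>wt S (root_weight (snd lr)). tree_inj S (snd lr) ys p * cnj (tree_inj S (snd lr) ws p))"
      using node[of "fst lr" "snd lr"] by (simp add: H_def mem_Times_iff del: tree_inj.simps)
  qed
  also have "\<dots> = (\<Sum>l\<in>labellings_on L As. \<Sum>p\<in>wt S (root_weight l).
        tree_inj S l xs p * cnj (tree_inj S l vs p)) *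
      (\<Sum>r\<in>labellings_on R Bs. \<Sum>p\<in>wt S (root_weight r).
        tree_inj S r ys p * cnj (tree_inj S r ws p))"
    unfolding sum_product[of _ "labellings_on L As"] sum.cartesian_product
    by (simp add: case_prod_beta')
  also have "\<dots> = (if xs = vs then 1 else 0) * (if ys = ws then 1 else 0)"
    using Node.IH AB zs us by simp
  also have "\<dots> = (if zs = us then 1 else 0)"
    using zs us by (auto simp: in_wts_iff)
  finally show ?case by (simp only: H_def)
qed

end

subsection \<open>Coupling at the leaves\<close>

lemma dup_lab_shape:
  assumes "tree_of \<alpha>1 = T" "tree_of \<alpha>2 = T" "tree_of \<alpha>3 = T" "tree_of ks = T"
  shows "leaves (dup_lab \<alpha>1 \<alpha>2 \<alpha>3 ks) = splice (leaves \<alpha>1) (leaves \<alpha>2)"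
    and "root_weight (dup_lab \<alpha>1 \<alpha>2 \<alpha>3 ks) = root_weight \<alpha>3"
proof -
  have "leaves (dup_lab \<alpha>1 \<alpha>2 \<alpha>3 ks) = splice (leaves \<alpha>1) (leaves \<alpha>2) \<and>
    root_weight (dup_lab \<alpha>1 \<alpha>2 \<alpha>3 ks) = root_weight \<alpha>3"
    using assms
  proof (induction T arbitrary: \<alpha>1 \<alpha>2 \<alpha>3 ks)
    case (Leaf u)
    then show ?case by (auto simp: tree_of_eq_Leaf)
  next
    case (Node u L R)
    then obtain x1 l1 r1 x2 l2 r2 x l3 r3 v lk rk where
      \<alpha>: "\<alpha>1 = Node x1 l1 r1" "\<alpha>2 = Node x2 l2 r2" "\<alpha>3 = Node x l3 r3" "ks = Node v lk rk"
      and L: "tree_of l1 = L" "tree_of l2 = L" "tree_of l3 = L" "tree_of lk = L"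
      and R: "tree_of r1 = R" "tree_of r2 = R" "tree_of r3 = R" "tree_of rk = R"
      by (auto simp: tree_of_eq_Node)
    have "num_leaves l1 = num_leaves l2" using L(1,2) num_leaves_tree_of by metis
    then show ?case
      using Node.IH(1)[OF L] Node.IH(2)[OF R] \<alpha> by (simp add: splice_append)
  qed
  then show "leaves (dup_lab \<alpha>1 \<alpha>2 \<alpha>3 ks) = splice (leaves \<alpha>1) (leaves \<alpha>2)"
    and "root_weight (dup_lab \<alpha>1 \<alpha>2 \<alpha>3 ks) = root_weight \<alpha>3" by auto
qed

context coupling
begin

lemma reps_inv:
  assumes "set \<Lambda>s \<subseteq> irr S" "a \<in> carrier (grp S)" "xs \<in> wts S \<Lambda>s" "ys \<in> wts S \<Lambda>s"
  shows "reps S \<Lambda>s (replicate (length \<Lambda>s) (inv\<^bsub>grp S\<^esub> a)) xs ys =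
    cnj (reps S \<Lambda>s (replicate (length \<Lambda>s) a) ys xs)"
  using assms by (auto simp: reps_def in_wts_iff subset_iff intro!: prod.cong rep_inv)

text \<open>The possible label sequences of the nodes that replace the leaves: entry
  \<open>i\<close> pairs the new leaf weight with its multiplicity index. As a list it can be summed
  over before any labelling of the tree is chosen.\<close>

definition coupled_seqs :: "'l list \<Rightarrow> 'l list \<Rightarrow> ('l \<times> nat) list set" where
  "coupled_seqs \<Lambda>s1 \<Lambda>s2 = listset (map2 (coupled S) \<Lambda>s1 \<Lambda>s2)"

text \<open>The tensor product over all leaves of the Clebsch-Gordan injections. The two copies of
  the leaves stay separate as the pair \<open>u\<close>, although position \<open>i\<close> couples
  the \<open>i\<close>-th entries of both.\<close>

definition leaf_cg ::
  "'l list \<Rightarrow> 'l list \<Rightarrow> ('l \<times> nat) list \<Rightarrow> 'm list \<times> 'm list \<Rightarrow> 'm list \<Rightarrow> complex" where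
  "leaf_cg \<Lambda>s1 \<Lambda>s2 ps u zs =
    (\<Prod>i<length \<Lambda>s1. cg (\<Lambda>s1 ! i) (\<Lambda>s2 ! i) (ps ! i) (fst u ! i, snd u ! i) (zs ! i))"

lemma leaf_cg_append:
  assumes "length As' = length As" "length ps = length As" "length xs = length As"
    "length ys = length As" "length zs = length As"
  shows "leaf_cg (As @ Bs) (As' @ Bs') (ps @ qs) (xs @ vs, ys @ ws) (zs @ us) =
    leaf_cg As As' ps (xs, ys) zs * leaf_cg Bs Bs' qs (vs, ws) us"
  using assms by (simp add: leaf_cg_def prod_lessThan_add nth_append)

lemma sum_wts_Times_prod:
  fixes f :: "nat \<Rightarrow> 'm \<times> 'm \<Rightarrow> complex"
  assumes "length \<Lambda>s1 = length \<Lambda>s2"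
  shows "(\<Sum>u\<in>wts S \<Lambda>s1 \<times> wts S \<Lambda>s2. \<Prod>i<length \<Lambda>s1. f i (fst u ! i, snd u ! i)) =
    (\<Prod>i<length \<Lambda>s1. \<Sum>p\<in>wt S (\<Lambda>s1 ! i) \<times> wt S (\<Lambda>s2 ! i). f i p)"
  using sum_listset2_prod[of "map (wt S) \<Lambda>s1" "length \<Lambda>s1" "map (wt S) \<Lambda>s2" f] assms
  by (simp add: wts_def sum.cartesian_product case_prod_beta')

context
  fixes \<Lambda>s1 \<Lambda>s2
  assumes len: "length \<Lambda>s1 = length \<Lambda>s2" and irr1: "set \<Lambda>s1 \<subseteq> irr S" and irr2: "set \<Lambda>s2 \<subseteq> irr S"
begin

lemma coupled_seqs_iff: "ps \<in> coupled_seqs \<Lambda>s1 \<Lambda>s2 \<longleftrightarrow> length ps = length \<Lambda>s1 \<and>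
    (\<forall>i<length \<Lambda>s1. ps ! i \<in> coupled S (\<Lambda>s1 ! i) (\<Lambda>s2 ! i))"
  using len by (simp add: coupled_seqs_def in_listset_iff)

lemma coupled_seqs_irr: "ps \<in> coupled_seqs \<Lambda>s1 \<Lambda>s2 \<Longrightarrow> set (map fst ps) \<subseteq> irr S"
  using coupled_irr by (fastforce simp: coupled_seqs_iff in_set_conv_nth)

lemma finite_coupled_seqs: "finite (coupled_seqs \<Lambda>s1 \<Lambda>s2)"
  unfolding coupled_seqs_def
proof (rule finite_listset)
  fix B assume "B \<in> set (map2 (coupled S) \<Lambda>s1 \<Lambda>s2)"
  then obtain \<Lambda>1 \<Lambda>2 where "B = coupled S \<Lambda>1 \<Lambda>2" "\<Lambda>1 \<in> set \<Lambda>s1" "\<Lambda>2 \<in> set \<Lambda>s2"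
    by (auto dest: set_zip_leftD set_zip_rightD)
  then show "finite B" using finite_coupled irr1 irr2 by auto
qed

lemma irr_nth: "i < length \<Lambda>s1 \<Longrightarrow> \<Lambda>s1 ! i \<in> irr S" "i < length \<Lambda>s1 \<Longrightarrow> \<Lambda>s2 ! i \<in> irr S"
  using irr1 irr2 len by auto

lemma leaf_cg_orthonormal:
  assumes ps: "ps \<in> coupled_seqs \<Lambda>s1 \<Lambda>s2" and qs: "qs \<in> coupled_seqs \<Lambda>s1 \<Lambda>s2"
    and zs: "zs \<in> wts S (map fst ps)" and us: "us \<in> wts S (map fst qs)"
  shows "(\<Sum>u\<in>wts S \<Lambda>s1 \<times> wts S \<Lambda>s2. cnj (leaf_cg \<Lambda>s1 \<Lambda>s2 ps u zs) * leaf_cg \<Lambda>s1 \<Lambda>s2 qs u us) =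
    (if ps = qs \<and> zs = us then 1 else 0)"
proof -
  let ?c = "\<lambda>i. cg (\<Lambda>s1 ! i) (\<Lambda>s2 ! i)"
  have "(\<Sum>u\<in>wts S \<Lambda>s1 \<times> wts S \<Lambda>s2. cnj (leaf_cg \<Lambda>s1 \<Lambda>s2 ps u zs) * leaf_cg \<Lambda>s1 \<Lambda>s2 qs u us) =
      (\<Prod>i<length \<Lambda>s1. \<Sum>p\<in>wt S (\<Lambda>s1 ! i) \<times> wt S (\<Lambda>s2 ! i).
        cnj (?c i (ps ! i) p (zs ! i)) * ?c i (qs ! i) p (us ! i))"
    by (subst sum_wts_Times_prod[OF len, symmetric]) (simp add: leaf_cg_def prod.distrib)
  also have "\<dots> = (\<Prod>i<length \<Lambda>s1. if ps ! i = qs ! i \<and> zs ! i = us ! i then 1 else 0)"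
    using assms by (intro prod.cong refl cg_orthonormal) (auto simp: coupled_seqs_iff in_wts_iff irr_nth)
  also have "\<dots> = (if ps = qs \<and> zs = us then 1 else 0)"
    unfolding prod_indicator using assms by (auto simp: coupled_seqs_iff in_wts_iff list_eq_iff_nth_eq)
  finally show ?thesis .
qed

lemma leaf_cg_complete:
  assumes u: "u \<in> wts S \<Lambda>s1 \<times> wts S \<Lambda>s2" and v: "v \<in> wts S \<Lambda>s1 \<times> wts S \<Lambda>s2"
  shows "(\<Sum>ps\<in>coupled_seqs \<Lambda>s1 \<Lambda>s2. \<Sum>zs\<in>wts S (map fst ps).
      leaf_cg \<Lambda>s1 \<Lambda>s2 ps u zs * cnj (leaf_cg \<Lambda>s1 \<Lambda>s2 ps v zs)) = (if u = v then 1 else 0)"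
proof -
  define h where "h i x \<mu> = cg (\<Lambda>s1 ! i) (\<Lambda>s2 ! i) x (fst u ! i, snd u ! i) \<mu> *
      cnj (cg (\<Lambda>s1 ! i) (\<Lambda>s2 ! i) x (fst v ! i, snd v ! i) \<mu>)" for i x \<mu>
  have "(\<Sum>ps\<in>coupled_seqs \<Lambda>s1 \<Lambda>s2. \<Sum>zs\<in>wts S (map fst ps).
      leaf_cg \<Lambda>s1 \<Lambda>s2 ps u zs * cnj (leaf_cg \<Lambda>s1 \<Lambda>s2 ps v zs)) =
      (\<Sum>ps\<in>coupled_seqs \<Lambda>s1 \<Lambda>s2. \<Prod>i<length \<Lambda>s1. \<Sum>\<mu>\<in>wt S (fst (ps ! i)). h i (ps ! i) \<mu>)"
  proof (rule sum.cong[OF refl])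
    fix ps assume "ps \<in> coupled_seqs \<Lambda>s1 \<Lambda>s2"
    then have l: "length ps = length \<Lambda>s1" by (simp add: coupled_seqs_iff)
    show "(\<Sum>zs\<in>wts S (map fst ps). leaf_cg \<Lambda>s1 \<Lambda>s2 ps u zs * cnj (leaf_cg \<Lambda>s1 \<Lambda>s2 ps v zs)) =
        (\<Prod>i<length \<Lambda>s1. \<Sum>\<mu>\<in>wt S (fst (ps ! i)). h i (ps ! i) \<mu>)"
      using sum_listset_prod[of "\<lambda>i. h i (ps ! i)" "map (wt S) (map fst ps)"] l
      by (simp add: wts_def leaf_cg_def h_def prod.distrib)
  qed
  also have "\<dots> = (\<Prod>i<length \<Lambda>s1. \<Sum>x\<in>coupled S (\<Lambda>s1 ! i) (\<Lambda>s2 ! i). \<Sum>\<mu>\<in>wt S (fst x). h i x \<mu>)"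
    using sum_listset_prod[of "\<lambda>i x. \<Sum>\<mu>\<in>wt S (fst x). h i x \<mu>" "map2 (coupled S) \<Lambda>s1 \<Lambda>s2"] len
    by (simp add: coupled_seqs_def)
  also have "\<dots> = (\<Prod>i<length \<Lambda>s1. if fst u ! i = fst v ! i \<and> snd u ! i = snd v ! i then 1 else 0)"
    unfolding h_def using assms
    by (intro prod.cong refl, subst cg_complete) (auto simp: in_wts_iff irr_nth len)
  also have "\<dots> = (if u = v then 1 else 0)"
    unfolding prod_indicator using assms len
    by (auto simp: in_wts_iff list_eq_iff_nth_eq prod_eq_iff)
  finally show ?thesis .
qed

text \<open>Position \<open>i\<close> couples two factors on which the same element
  \<open>gs ! i\<close> acts, so equivariance holds for every \<open>gs\<close> and not only for
  constant lists. This is the property that inner couplings do not share.\<close>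

lemma leaf_cg_intertwines:
  assumes gs: "length gs = length \<Lambda>s1" "set gs \<subseteq> carrier (grp S)"
    and u: "u \<in> wts S \<Lambda>s1 \<times> wts S \<Lambda>s2" and ps: "ps \<in> coupled_seqs \<Lambda>s1 \<Lambda>s2"
    and zs: "zs \<in> wts S (map fst ps)"
  shows "(\<Sum>v\<in>wts S \<Lambda>s1 \<times> wts S \<Lambda>s2.
      (reps S \<Lambda>s1 gs (fst u) (fst v) * reps S \<Lambda>s2 gs (snd u) (snd v)) * leaf_cg \<Lambda>s1 \<Lambda>s2 ps v zs) =
    (\<Sum>us\<in>wts S (map fst ps). leaf_cg \<Lambda>s1 \<Lambda>s2 ps u us * reps S (map fst ps) gs us zs)"
proof -
  let ?c = "\<lambda>i. cg (\<Lambda>s1 ! i) (\<Lambda>s2 ! i) (ps ! i)"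
  have l: "length ps = length \<Lambda>s1" using ps by (simp add: coupled_seqs_iff)
  have "(\<Sum>v\<in>wts S \<Lambda>s1 \<times> wts S \<Lambda>s2.
      (reps S \<Lambda>s1 gs (fst u) (fst v) * reps S \<Lambda>s2 gs (snd u) (snd v)) * leaf_cg \<Lambda>s1 \<Lambda>s2 ps v zs) =
      (\<Prod>i<length \<Lambda>s1. \<Sum>q\<in>wt S (\<Lambda>s1 ! i) \<times> wt S (\<Lambda>s2 ! i).
        (rep S (\<Lambda>s1 ! i) (gs ! i) (fst u ! i) (fst q) * rep S (\<Lambda>s2 ! i) (gs ! i) (snd u ! i) (snd q)) *
          ?c i q (zs ! i))"
    by (subst sum_wts_Times_prod[OF len, symmetric]) (simp add: leaf_cg_def reps_def prod.distrib len)
  also have "\<dots> = (\<Prod>i<length \<Lambda>s1. \<Sum>\<nu>\<in>wt S (fst (ps ! i)).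
      ?c i (fst u ! i, snd u ! i) \<nu> * rep S (fst (ps ! i)) (gs ! i) \<nu> (zs ! i))"
  proof (intro prod.cong refl)
    fix i assume "i \<in> {..<length \<Lambda>s1}"
    then have i: "i < length \<Lambda>s1" by simp
    have g: "gs ! i \<in> carrier (grp S)" using gs i by auto
    show "(\<Sum>q\<in>wt S (\<Lambda>s1 ! i) \<times> wt S (\<Lambda>s2 ! i).
        (rep S (\<Lambda>s1 ! i) (gs ! i) (fst u ! i) (fst q) * rep S (\<Lambda>s2 ! i) (gs ! i) (snd u ! i) (snd q)) *
          ?c i q (zs ! i)) = (\<Sum>\<nu>\<in>wt S (fst (ps ! i)).
      ?c i (fst u ! i, snd u ! i) \<nu> * rep S (fst (ps ! i)) (gs ! i) \<nu> (zs ! i))"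
      using cg_intertwines[OF irr_nth(1)[OF i] irr_nth(2)[OF i] g,
          of "(fst u ! i, snd u ! i)" "ps ! i" "zs ! i"] u ps zs i len l
      by (auto simp: in_wts_iff coupled_seqs_iff)
  qed
  also have "\<dots> = (\<Sum>us\<in>wts S (map fst ps). leaf_cg \<Lambda>s1 \<Lambda>s2 ps u us * reps S (map fst ps) gs us zs)"
    using sum_listset_prod[of "\<lambda>i \<nu>. ?c i (fst u ! i, snd u ! i) \<nu> *
        rep S (fst (ps ! i)) (gs ! i) \<nu> (zs ! i)" "map (wt S) (map fst ps)"] l
    by (simp add: wts_def leaf_cg_def reps_def prod.distrib)
  finally show ?thesis .
qed

end

text \<open>The injection of the duplicated tree factors through the injection of
  \<open>\<alpha>3\<close>, followed by the leaf couplings: nodes of the original tree couple only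
  the weights prescribed by \<open>\<alpha>3\<close>. The labellings \<open>\<alpha>1\<close> and
  \<open>\<alpha>2\<close> enter through their leaf weights alone.\<close>

lemma tree_inj_dup_lab:
  assumes "tree_of \<alpha>1 = T" "tree_of \<alpha>2 = T" "tree_of \<alpha>3 = T" "tree_of ks = T"
    and "admissible S \<alpha>1" "admissible S \<alpha>2" "admissible S \<alpha>3"
    and "xs \<in> wts S (leaves \<alpha>1)" "ys \<in> wts S (leaves \<alpha>2)" "\<mu> \<in> wt S (root_weight \<alpha>3)"
  shows "tree_inj S (dup_lab \<alpha>1 \<alpha>2 \<alpha>3 ks) (splice xs ys) \<mu> =
    (\<Sum>zs\<in>wts S (leaves \<alpha>3).
      leaf_cg (leaves \<alpha>1) (leaves \<alpha>2) (zip (leaves \<alpha>3) (leaves ks)) (xs, ys) zs * tree_inj S \<alpha>3 zs \<mu>)"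
  using assms
proof (induction T arbitrary: \<alpha>1 \<alpha>2 \<alpha>3 ks xs ys \<mu>)
  case (Leaf u)
  then obtain \<Lambda>1 \<Lambda>2 \<Lambda>3 k where \<alpha>: "\<alpha>1 = Leaf \<Lambda>1" "\<alpha>2 = Leaf \<Lambda>2" "\<alpha>3 = Leaf \<Lambda>3" "ks = Leaf k"
    by (auto simp: tree_of_eq_Leaf)
  obtain x y where xy: "xs = [x]" "ys = [y]" "x \<in> wt S \<Lambda>1" "y \<in> wt S \<Lambda>2"
    using Leaf.prems \<alpha> by (auto simp: in_wts_iff length_Suc_conv)
  have fin: "finite (wt S \<Lambda>1)" "finite (wt S \<Lambda>2)" "finite (wt S \<Lambda>3)"
    using Leaf.prems \<alpha> by (auto intro: finite_wt)
  have "tree_inj S (dup_lab \<alpha>1 \<alpha>2 \<alpha>3 ks) (splice xs ys) \<mu> =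
      (\<Sum>p\<in>wt S \<Lambda>1 \<times> wt S \<Lambda>2. (if (x, y) = p then 1 else 0) * cg \<Lambda>1 \<Lambda>2 (\<Lambda>3, k) p \<mu>)"
    using tree_inj_Node[of "[x]" "Leaf \<Lambda>1" "(\<Lambda>3, k)" "Leaf \<Lambda>2" "[y]" \<mu>]
    by (auto simp: \<alpha> xy simp del: tree_inj.simps(2) intro!: sum.cong)
  also have "\<dots> = cg \<Lambda>1 \<Lambda>2 (\<Lambda>3, k) (x, y) \<mu>"
    using xy fin by (subst sum_delta_mult) auto
  \<comment> \<open>The sum over \<open>z\<close> comes from the one-vertex tree
    \<open>\<alpha>3\<close>, whose injection is the identity matrix.\<close>
  also have "\<dots> = (\<Sum>z\<in>wt S \<Lambda>3. cg \<Lambda>1 \<Lambda>2 (\<Lambda>3, k) (x, y) z * (if z = \<mu> then 1 else 0))"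
    using fin Leaf.prems \<alpha> by (subst sum_delta_mult) auto
  also have "\<dots> = (\<Sum>zs\<in>wts S (leaves \<alpha>3).
      leaf_cg (leaves \<alpha>1) (leaves \<alpha>2) (zip (leaves \<alpha>3) (leaves ks)) (xs, ys) zs * tree_inj S \<alpha>3 zs \<mu>)"
    by (simp add: \<alpha> xy wts_def sum_listset_Cons leaf_cg_def del: listset.simps(2))
  finally show ?case .
next
  case (Node u L R)
  then obtain x1 l1 r1 x2 l2 r2 x l3 r3 v lk rk where
    \<alpha>: "\<alpha>1 = Node x1 l1 r1" "\<alpha>2 = Node x2 l2 r2" "\<alpha>3 = Node x l3 r3" "ks = Node v lk rk"
    and L: "tree_of l1 = L" "tree_of l2 = L" "tree_of l3 = L" "tree_of lk = L"
    and R: "tree_of r1 = R" "tree_of r2 = R" "tree_of r3 = R" "tree_of rk = R"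
    by (auto simp: tree_of_eq_Node)
  obtain xs1 xs2 where xs: "xs = xs1 @ xs2" "xs1 \<in> wts S (leaves l1)" "xs2 \<in> wts S (leaves r1)"
    using Node.prems \<alpha> by (auto elim: wts_appendE)
  obtain ys1 ys2 where ys: "ys = ys1 @ ys2" "ys1 \<in> wts S (leaves l2)" "ys2 \<in> wts S (leaves r2)"
    using Node.prems \<alpha> by (auto elim: wts_appendE)
  have num: "num_leaves l1 = num_leaves L" "num_leaves l2 = num_leaves L" "num_leaves l3 = num_leaves L"
      "num_leaves lk = num_leaves L"
    using L num_leaves_tree_of by metis+
  have lens: "length xs1 = num_leaves L" "length ys1 = num_leaves L"
    using xs ys num by (auto simp: in_wts_iff)
  let ?dl = "dup_lab l1 l2 l3 lk" and ?dr = "dup_lab r1 r2 r3 rk"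
  let ?Cl = "leaf_cg (leaves l1) (leaves l2) (zip (leaves l3) (leaves lk)) (xs1, ys1)"
  let ?Cr = "leaf_cg (leaves r1) (leaves r2) (zip (leaves r3) (leaves rk)) (xs2, ys2)"
  let ?W = "wt S (root_weight l3) \<times> wt S (root_weight r3)"
  let ?U = "wts S (leaves l3) \<times> wts S (leaves r3)"
  let ?c = "cg (root_weight l3) (root_weight r3) x"
  have adm: "admissible S l1" "admissible S l2" "admissible S l3"
      "admissible S r1" "admissible S r2" "admissible S r3"
    using Node.prems \<alpha> by auto
  have "length (splice xs1 ys1) = num_leaves ?dl"
    using lens num by (simp add: dup_lab_shape[OF L])
  then have "tree_inj S (dup_lab \<alpha>1 \<alpha>2 \<alpha>3 ks) (splice xs ys) \<mu> =
      (\<Sum>p\<in>?W. (tree_inj S ?dl (splice xs1 ys1) (fst p) * tree_inj S ?dr (splice xs2 ys2) (snd p)) *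
        ?c p \<mu>)"
    using tree_inj_Node[of "splice xs1 ys1" ?dl x ?dr "splice xs2 ys2" \<mu>] lens
    by (simp add: \<alpha> xs ys splice_append dup_lab_shape[OF L] dup_lab_shape[OF R] del: tree_inj.simps)
  also have "\<dots> = (\<Sum>p\<in>?W. ((\<Sum>zs\<in>wts S (leaves l3). ?Cl zs * tree_inj S l3 zs (fst p)) *
      (\<Sum>zs\<in>wts S (leaves r3). ?Cr zs * tree_inj S r3 zs (snd p))) * ?c p \<mu>)"
    by (intro sum.cong refl arg_cong2[where f = "(*)"] Node.IH(1)[OF L] Node.IH(2)[OF R] adm xs ys) auto
  \<comment> \<open>Reassociation collects the leaf couplings on the left; what remains on the right
    is the injection of \<open>\<alpha>3\<close> with its root coupling.\<close>
  also have "\<dots> = (\<Sum>z\<in>?U. (?Cl (fst z) * ?Cr (snd z)) *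
      (\<Sum>p\<in>?W. (tree_inj S l3 (fst z) (fst p) * tree_inj S r3 (snd z) (snd p)) * ?c p \<mu>))"
    unfolding sum_mult_assoc
    by (intro sum.cong refl arg_cong2[where f = "(*)"] sum_Times_mult sum_Times_mult[symmetric])
  also have "\<dots> = (\<Sum>z\<in>?U. leaf_cg (leaves \<alpha>1) (leaves \<alpha>2) (zip (leaves \<alpha>3) (leaves ks)) (xs, ys)
      (fst z @ snd z) * tree_inj S \<alpha>3 (fst z @ snd z) \<mu>)"
  proof (intro sum.cong refl arg_cong2[where f = "(*)"])
    fix z assume "z \<in> ?U"
    then have z: "length (fst z) = num_leaves L" using num by (auto simp: in_wts_iff)
    show "?Cl (fst z) * ?Cr (snd z) = leaf_cg (leaves \<alpha>1) (leaves \<alpha>2)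
        (zip (leaves \<alpha>3) (leaves ks)) (xs, ys) (fst z @ snd z)"
      using z num lens by (simp add: \<alpha> xs ys leaf_cg_append)
    show "(\<Sum>p\<in>?W. (tree_inj S l3 (fst z) (fst p) * tree_inj S r3 (snd z) (snd p)) * ?c p \<mu>) =
        tree_inj S \<alpha>3 (fst z @ snd z) \<mu>"
      unfolding \<alpha> using z num by (subst tree_inj_Node) simp_all
  qed
  also have "\<dots> = (\<Sum>zs\<in>wts S (leaves \<alpha>3). leaf_cg (leaves \<alpha>1) (leaves \<alpha>2)
      (zip (leaves \<alpha>3) (leaves ks)) (xs, ys) zs * tree_inj S \<alpha>3 zs \<mu>)"
    unfolding \<alpha> leaves.simps sum_wts_append ..
  finally show ?case .
qed

end

subsection \<open>Overlaps of join and leaf duplication\<close>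

lemma permute_list_join_to_dup:
  assumes "length xs = N" "length ys = N"
  shows "permute_list (join_to_dup N) (splice xs ys) = xs @ ys"
proof (rule nth_equalityI)
  fix i assume i: "i < length (permute_list (join_to_dup N) (splice xs ys))"
  then have "i < 2 * N" using assms by simp
  then show "permute_list (join_to_dup N) (splice xs ys) ! i = (xs @ ys) ! i"
    using assms splice_nth[of xs ys i] splice_nth[of xs ys "i - N"]
    by (simp add: permute_list_def join_to_dup_def nth_append)
qed (use assms in simp)

text \<open>From \<open>2 * N\<close> on the map is the identity, so it is injective on all
  naturals, and \<open>inv_into UNIV\<close> returns the unique preimage of each value.\<close>

lemma inj_join_to_dup: "inj (join_to_dup N)"
  unfolding inj_def join_to_dup_def by (auto split: if_splits) presburger+

lemma permute_list_inv_join_to_dup: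
  assumes "length xs = N" "length ys = N"
  shows "permute_list (inv_into UNIV (join_to_dup N)) (xs @ ys) = splice xs ys"
proof (rule nth_equalityI)
  fix i assume "i < length (permute_list (inv_into UNIV (join_to_dup N)) (xs @ ys))"
  then have i: "i < 2 * N" using assms by simp
  define j where "j = i div 2"
  have inv: "inv_into UNIV (join_to_dup N) (join_to_dup N k) = k" for k
    using inv_into_f_f[OF inj_join_to_dup] by blast
  \<comment> \<open>The inverse is evaluated by naming preimages: the even position
    \<open>2 * j\<close> comes from leaf \<open>j\<close> of the first copy, its successor from
    \<open>N + j\<close> in the second copy.\<close>
  consider "i = 2 * j" | "i = Suc (2 * j)" unfolding j_def by linarith
  then show "permute_list (inv_into UNIV (join_to_dup N)) (xs @ ys) ! i = splice xs ys ! i"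
  proof cases
    case 1
    then have j: "j < N" using i by simp
    have "inv_into UNIV (join_to_dup N) i = j" using inv[of j] 1 j by (simp add: join_to_dup_def)
    then show ?thesis using splice_nth[of xs ys j] i j 1 assms
      by (simp add: permute_list_def nth_append)
  next
    case 2
    then have j: "j < N" using i by simp
    have "inv_into UNIV (join_to_dup N) i = N + j"
      using inv[of "N + j"] 2 j by (simp add: join_to_dup_def)
    then show ?thesis using splice_nth[of xs ys j] i j 2 assms
      by (simp add: permute_list_def nth_append)
  qed
qed (use assms in simp)

section \<open>Kets and quasicharacters in coordinates, and overlaps of equivariant maps\<close>

context coupling
begin

lemma sum_wts_splice:
  assumes "length \<Lambda>s1 = length \<Lambda>s2"
  shows "(\<Sum>zs\<in>wts S (splice \<Lambda>s1 \<Lambda>s2). f zs) =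
    (\<Sum>u\<in>wts S \<Lambda>s1 \<times> wts S \<Lambda>s2. f (splice (fst u) (snd u)))"
  using assms sum_listset_splice[of "map (wt S) \<Lambda>s1" "map (wt S) \<Lambda>s2" f]
  by (simp add: wts_def map_splice sum.cartesian_product case_prod_beta')

lemma splice_in_wts:
  "length \<Lambda>s1 = length \<Lambda>s2 \<Longrightarrow> xs \<in> wts S \<Lambda>s1 \<Longrightarrow> ys \<in> wts S \<Lambda>s2 \<Longrightarrow>
    splice xs ys \<in> wts S (splice \<Lambda>s1 \<Lambda>s2)"
  by (induction \<Lambda>s1 \<Lambda>s2 arbitrary: xs ys rule: list_induct2) (auto simp: wts_def set_Cons_def)

lemma ip_mapply:
  "ip W a (mapply W W' M b) = (\<Sum>i\<in>W. cnj (a i) * (\<Sum>j\<in>W'. M i j * b j))"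
  by (simp add: ip_def mapply_def)

lemma labellingsD:
  assumes "\<alpha> \<in> labellings S T"
  shows "tree_of \<alpha> = T" "admissible S \<alpha>" "num_leaves \<alpha> = num_leaves T"
    "set (leaves \<alpha>) \<subseteq> irr S" "root_weight \<alpha> \<in> irr S"
  using assms admissible_irr num_leaves_tree_of[of \<alpha>] by (auto simp: labellings_def)

lemma ket_eq:
  assumes "admissible S \<alpha>" "\<mu> \<in> wt S (root_weight \<alpha>)" "zs \<in> wts S (leaves \<alpha>)"
  shows "ket S \<alpha> \<mu> zs = tree_inj S \<alpha> zs \<mu>"
  using assms finite_wt admissible_irr
  by (simp add: ket_def mapply_def basis_vec_def if_distrib[where f = "\<lambda>x. _ * x"] cong: if_cong)

lemma quasichar_eq:
  assumes "combinable S T \<alpha> \<alpha>'"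
  shows "quasichar S \<alpha> \<alpha>' gs = (\<Sum>\<mu>\<in>wt S (root_weight \<alpha>). \<Sum>zs\<in>wts S (leaves \<alpha>).
    cnj (tree_inj S \<alpha>' zs \<mu>) *
      (\<Sum>us\<in>wts S (leaves \<alpha>). reps S (leaves \<alpha>) gs zs us * tree_inj S \<alpha> us \<mu>))"
  using assms
  by (auto simp: quasichar_def Let_def ip_def mapply_def ket_eq combinable_def labellings_with_def
      labellings_def intro!: sum.cong)

lemma tree_parseval:
  assumes "length \<Lambda>s = num_leaves T" "set \<Lambda>s \<subseteq> irr S"
  shows "(\<Sum>\<alpha>\<in>labellings_on T \<Lambda>s. \<Sum>\<mu>\<in>wt S (root_weight \<alpha>).
      (\<Sum>zs\<in>wts S \<Lambda>s. f zs * tree_inj S \<alpha> zs \<mu>) *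
      cnj (\<Sum>zs\<in>wts S \<Lambda>s. g zs * tree_inj S \<alpha> zs \<mu>)) = (\<Sum>zs\<in>wts S \<Lambda>s. f zs * cnj (g zs))"
  by (intro parseval finite_wts tree_inj_complete assms)

text \<open>For equivariant \<open>F\<close> and \<open>J\<close>, the adjoint of \<open>F\<close>
  composed with \<open>J\<close> is an intertwiner from \<open>\<Lambda>\<close> to
  \<open>\<Lambda>'\<close>. The index set \<open>U\<close> stays abstract so that pairs of lists
  can serve as tensor indices.\<close>

lemma overlap_schur:
  fixes F :: "'u \<Rightarrow> 'm \<Rightarrow> complex"
  assumes irr: "\<Lambda> \<in> irr S" "\<Lambda>' \<in> irr S"
    and Q: "\<And>a u v. a \<in> carrier (grp S) \<Longrightarrow> u \<in> U \<Longrightarrow> v \<in> U \<Longrightarrow>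
      Q (inv\<^bsub>grp S\<^esub> a) u v = cnj (Q a v u)"
    and F: "\<And>a u \<nu>. a \<in> carrier (grp S) \<Longrightarrow> u \<in> U \<Longrightarrow> \<nu> \<in> wt S \<Lambda>' \<Longrightarrow>
      (\<Sum>v\<in>U. Q a u v * F v \<nu>) = (\<Sum>\<kappa>\<in>wt S \<Lambda>'. F u \<kappa> * rep S \<Lambda>' a \<kappa> \<nu>)"
    and J: "\<And>a u \<nu>. a \<in> carrier (grp S) \<Longrightarrow> u \<in> U \<Longrightarrow> \<nu> \<in> wt S \<Lambda> \<Longrightarrow>
      (\<Sum>v\<in>U. Q a u v * J v \<nu>) = (\<Sum>\<kappa>\<in>wt S \<Lambda>. J u \<kappa> * rep S \<Lambda> a \<kappa> \<nu>)"
  shows "\<exists>c. \<forall>\<nu>\<in>wt S \<Lambda>'. \<forall>\<mu>\<in>wt S \<Lambda>.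
    (\<Sum>u\<in>U. cnj (F u \<nu>) * J u \<mu>) = (if \<Lambda> = \<Lambda>' \<and> \<nu> = \<mu> then c else 0)"
proof (rule schur[OF irr])
  fix a i j assume a: "a \<in> carrier (grp S)" and i: "i \<in> wt S \<Lambda>'" and j: "j \<in> wt S \<Lambda>"
  let ?b = "inv\<^bsub>grp S\<^esub> a"
  \<comment> \<open>The adjoint of the equivariance of \<open>F\<close> at the inverse element;
    \<open>Q\<close> and the irreducible representation both turn inverses into adjoints.\<close>
  have adj: "(\<Sum>k\<in>wt S \<Lambda>'. rep S \<Lambda>' a i k * cnj (F u k)) = (\<Sum>v\<in>U. cnj (F v i) * Q a v u)"
    if u: "u \<in> U" for u
  proof -
    have "(\<Sum>k\<in>wt S \<Lambda>'. rep S \<Lambda>' a i k * cnj (F u k)) =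
        cnj (\<Sum>k\<in>wt S \<Lambda>'. F u k * rep S \<Lambda>' ?b k i)"
      using rep_inv[OF irr(2) a _ i] by (simp add: mult.commute)
    also have "\<dots> = cnj (\<Sum>v\<in>U. Q ?b u v * F v i)" using F[of ?b u i] a u i by simp
    also have "\<dots> = (\<Sum>v\<in>U. cnj (F v i) * Q a v u)" using Q[OF a u] by (simp add: mult.commute)
    finally show ?thesis .
  qed
  have "(\<Sum>k\<in>wt S \<Lambda>'. rep S \<Lambda>' a i k * (\<Sum>u\<in>U. cnj (F u k) * J u j)) =
      (\<Sum>u\<in>U. (\<Sum>v\<in>U. cnj (F v i) * Q a v u) * J u j)"
    unfolding sum_mult_assoc using adj by simp
  also have "\<dots> = (\<Sum>k\<in>wt S \<Lambda>. (\<Sum>u\<in>U. cnj (F u i) * J u k) * rep S \<Lambda> a k j)"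
    unfolding sum_mult_assoc[symmetric] using J[OF a _ j] by simp
  finally show "(\<Sum>k\<in>wt S \<Lambda>'. rep S \<Lambda>' a i k * (\<Sum>u\<in>U. cnj (F u k) * J u j)) =
    (\<Sum>k\<in>wt S \<Lambda>. (\<Sum>u\<in>U. cnj (F u i) * J u k) * rep S \<Lambda> a k j)" .
qed

text \<open>
  \<open>dup_amp \<Lambda>s1 \<Lambda>s2 (\<alpha>, ks)\<close> is the injection of the leaf duplication, with its \<open>2N\<close>
  tensor factors arranged as in the join.
\<close>

definition dup_amp :: "'l list \<Rightarrow> 'l list \<Rightarrow> 'l labelling \<times> (nat, unit) btree \<Rightarrow>
    'm list \<times> 'm list \<Rightarrow> 'm \<Rightarrow> complex" where
  "dup_amp \<Lambda>s1 \<Lambda>s2 q u \<mu> = (\<Sum>zs\<in>wts S (leaves (fst q)).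
    leaf_cg \<Lambda>s1 \<Lambda>s2 (zip (leaves (fst q)) (leaves (snd q))) u zs * tree_inj S (fst q) zs \<mu>)"

text \<open>\<open>coupled_labs\<close> without the condition at the root and without
  \<open>k\<close>. Together with the weight labels, these index a basis of the full tensor product
  of both copies, whatever root weights \<open>\<alpha>1\<close> and \<open>\<alpha>2\<close>
  have.\<close>

definition dup_labels ::
    "coupling_tree \<Rightarrow> 'l list \<Rightarrow> 'l list \<Rightarrow> ('l labelling \<times> (nat, unit) btree) set" where
  "dup_labels T \<Lambda>s1 \<Lambda>s2 = {(\<alpha>, ks). \<alpha> \<in> labellings S T \<and> tree_of ks = T \<and>
    (\<forall>i<num_leaves T. (leaves \<alpha> ! i, leaves ks ! i) \<in> coupled S (\<Lambda>s1 ! i) (\<Lambda>s2 ! i))}"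

definition pair_rep :: "'l list \<Rightarrow> 'l list \<Rightarrow> 'g list \<Rightarrow> ('m list \<times> 'm list, 'm list \<times> 'm list) cmat" where
  "pair_rep \<Lambda>s1 \<Lambda>s2 gs u v = reps S \<Lambda>s1 gs (fst u) (fst v) * reps S \<Lambda>s2 gs (snd u) (snd v)"

section \<open>The leaf duplication as an equivariant basis of pairs of tensor indices\<close>

context
  fixes T :: coupling_tree and \<Lambda>s1 \<Lambda>s2
  assumes len1: "length \<Lambda>s1 = num_leaves T" and len2: "length \<Lambda>s2 = num_leaves T"
    and irr1: "set \<Lambda>s1 \<subseteq> irr S" and irr2: "set \<Lambda>s2 \<subseteq> irr S"
begin

lemma len: "length \<Lambda>s1 = length \<Lambda>s2" using len1 len2 by simp

lemma finite_pairs: "finite (wts S \<Lambda>s1 \<times> wts S \<Lambda>s2)"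
  using finite_wts irr1 irr2 by blast

lemma dup_labelsD:
  assumes "q \<in> dup_labels T \<Lambda>s1 \<Lambda>s2"
  shows "zip (leaves (fst q)) (leaves (snd q)) \<in> coupled_seqs \<Lambda>s1 \<Lambda>s2"
    and "map fst (zip (leaves (fst q)) (leaves (snd q))) = leaves (fst q)"
    and "admissible S (fst q)" and "tree_of (fst q) = T" and "tree_of (snd q) = T"
    and "num_leaves (fst q) = num_leaves T" and "num_leaves (snd q) = num_leaves T"
proof -
  obtain \<alpha> ks where q: "q = (\<alpha>, ks)" by (cases q)
  have t: "tree_of \<alpha> = T" "tree_of ks = T" "admissible S \<alpha>"
    using assms q by (auto simp: dup_labels_def labellings_def)
  then have n: "num_leaves \<alpha> = num_leaves T" "num_leaves ks = num_leaves T"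
    using num_leaves_tree_of by metis+
  show "zip (leaves (fst q)) (leaves (snd q)) \<in> coupled_seqs \<Lambda>s1 \<Lambda>s2"
    using assms q n by (auto simp: coupled_seqs_iff[OF len irr1 irr2] len1 dup_labels_def)
  show "map fst (zip (leaves (fst q)) (leaves (snd q))) = leaves (fst q)" using q n by simp
  show "admissible S (fst q)" "tree_of (fst q) = T" "tree_of (snd q) = T"
    "num_leaves (fst q) = num_leaves T" "num_leaves (snd q) = num_leaves T"
    using q t n by auto
qed

text \<open>Mirrors the factorisation of \<open>dup_amp\<close>: the choice of leaf couplings comes
  before a labelling of the tree on the resulting leaf weights. The tree \<open>ks\<close> is
  recovered from the second components of the list and the known shape.\<close>

lemma bij_betw_dup_labels:
  "bij_betw (\<lambda>q. (zip (leaves (fst q)) (leaves (snd q)), fst q)) (dup_labels T \<Lambda>s1 \<Lambda>s2)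
    (SIGMA ps:coupled_seqs \<Lambda>s1 \<Lambda>s2. labellings_on T (map fst ps))" (is "bij_betw ?f ?A ?B")
proof -
  have "inj_on ?f ?A"
  proof (rule inj_onI)
    fix q q' assume q: "q \<in> ?A" "q' \<in> ?A" and eq: "?f q = ?f q'"
    then have "zip (leaves (fst q)) (leaves (snd q)) = zip (leaves (fst q')) (leaves (snd q'))"
      unfolding prod.inject by blast
    then have "map snd (zip (leaves (fst q)) (leaves (snd q))) =
        map snd (zip (leaves (fst q')) (leaves (snd q')))" by (rule arg_cong)
    then have "leaves (snd q) = leaves (snd q')"
      using dup_labelsD(6,7)[OF q(1)] dup_labelsD(6,7)[OF q(2)] by simp
    then have "snd q = snd q'"
      using leaves_inject dup_labelsD(5)[OF q(1)] dup_labelsD(5)[OF q(2)] by metis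
    then show "q = q'" using eq by (simp add: prod_eq_iff)
  qed
  moreover have "?f ` ?A \<subseteq> ?B"
    using dup_labelsD(1-4) by (auto simp: labellings_on_def labellings_def)
  moreover have "?B \<subseteq> ?f ` ?A"
  proof
    fix z assume "z \<in> ?B"
    then obtain ps \<alpha> where z: "z = (ps, \<alpha>)" "ps \<in> coupled_seqs \<Lambda>s1 \<Lambda>s2"
      "\<alpha> \<in> labellings S T" "leaves \<alpha> = map fst ps" by (auto simp: labellings_on_def)
    have ps: "length ps = num_leaves T"
      "\<And>i. i < num_leaves T \<Longrightarrow> ps ! i \<in> coupled S (\<Lambda>s1 ! i) (\<Lambda>s2 ! i)"
      using z(2) by (auto simp: coupled_seqs_iff[OF len irr1 irr2] len1)
    obtain ks :: "(nat, unit) btree" where ks: "tree_of ks = T" "leaves ks = map snd ps"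
      using tree_with_leaves_exists[of "map snd ps" T] ps(1) tree_of_idem by auto
    have "zip (map fst ps) (map snd ps) = ps" by (rule zip_map_fst_snd)
    then have "?f (\<alpha>, ks) = z" using z ks by simp
    moreover have "(\<alpha>, ks) \<in> ?A" using z ks ps by (simp add: dup_labels_def)
    ultimately show "z \<in> ?f ` ?A" by blast
  qed
  ultimately show ?thesis unfolding bij_betw_def by blast
qed

lemma finite_dup_labels: "finite (dup_labels T \<Lambda>s1 \<Lambda>s2)"
proof -
  have "finite (SIGMA ps:coupled_seqs \<Lambda>s1 \<Lambda>s2. labellings_on T (map fst ps))"
    using finite_coupled_seqs[OF len irr1 irr2] coupled_seqs_irr[OF len irr1 irr2]
    by (intro finite_SigmaI finite_labellings_on)
       (auto simp: coupled_seqs_iff[OF len irr1 irr2] len1)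
  then show ?thesis using bij_betw_finite[OF bij_betw_dup_labels] by blast
qed

text \<open>For fixed leaf couplings, completeness for the tree removes the sum over its labellings;
  what remains is completeness of the leaf couplings.\<close>

lemma dup_amp_complete:
  assumes u: "u \<in> wts S \<Lambda>s1 \<times> wts S \<Lambda>s2" and v: "v \<in> wts S \<Lambda>s1 \<times> wts S \<Lambda>s2"
  shows "(\<Sum>q\<in>dup_labels T \<Lambda>s1 \<Lambda>s2. \<Sum>\<nu>\<in>wt S (root_weight (fst q)).
      dup_amp \<Lambda>s1 \<Lambda>s2 q u \<nu> * cnj (dup_amp \<Lambda>s1 \<Lambda>s2 q v \<nu>)) = (if u = v then 1 else 0)"
proof -
  let ?C = "leaf_cg \<Lambda>s1 \<Lambda>s2"
  define h where "h z = (\<Sum>\<nu>\<in>wt S (root_weight (snd z)).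
      (\<Sum>zs\<in>wts S (leaves (snd z)). ?C (fst z) u zs * tree_inj S (snd z) zs \<nu>) *
      cnj (\<Sum>zs\<in>wts S (leaves (snd z)). ?C (fst z) v zs * tree_inj S (snd z) zs \<nu>))" for z
  have irr: "set (map fst ps) \<subseteq> irr S" "length (map fst ps) = num_leaves T"
    if "ps \<in> coupled_seqs \<Lambda>s1 \<Lambda>s2" for ps
    using coupled_seqs_irr[OF len irr1 irr2] coupled_seqs_iff[OF len irr1 irr2] len1 that by auto
  have "(\<Sum>q\<in>dup_labels T \<Lambda>s1 \<Lambda>s2. \<Sum>\<nu>\<in>wt S (root_weight (fst q)).
      dup_amp \<Lambda>s1 \<Lambda>s2 q u \<nu> * cnj (dup_amp \<Lambda>s1 \<Lambda>s2 q v \<nu>)) =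
      (\<Sum>q\<in>dup_labels T \<Lambda>s1 \<Lambda>s2. h (zip (leaves (fst q)) (leaves (snd q)), fst q))"
    by (simp add: h_def dup_amp_def)
  also have "\<dots> = (\<Sum>z\<in>(SIGMA ps:coupled_seqs \<Lambda>s1 \<Lambda>s2. labellings_on T (map fst ps)). h z)"
    by (rule sum.reindex_bij_betw[OF bij_betw_dup_labels])
  also have "\<dots> = (\<Sum>(ps, \<alpha>)\<in>(SIGMA ps:coupled_seqs \<Lambda>s1 \<Lambda>s2. labellings_on T (map fst ps)). h (ps, \<alpha>))"
    by simp
  also have "\<dots> = (\<Sum>ps\<in>coupled_seqs \<Lambda>s1 \<Lambda>s2. \<Sum>\<alpha>\<in>labellings_on T (map fst ps). h (ps, \<alpha>))"
    by (rule sum.Sigma[symmetric])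
       (auto intro!: finite_coupled_seqs[OF len irr1 irr2] finite_labellings_on irr simp del: length_map set_map)
  also have "\<dots> = (\<Sum>ps\<in>coupled_seqs \<Lambda>s1 \<Lambda>s2. \<Sum>zs\<in>wts S (map fst ps). ?C ps u zs * cnj (?C ps v zs))"
  proof (rule sum.cong[OF refl])
    fix ps assume ps: "ps \<in> coupled_seqs \<Lambda>s1 \<Lambda>s2"
    have "(\<Sum>\<alpha>\<in>labellings_on T (map fst ps). h (ps, \<alpha>)) =
        (\<Sum>\<alpha>\<in>labellings_on T (map fst ps). \<Sum>\<nu>\<in>wt S (root_weight \<alpha>).
      (\<Sum>zs\<in>wts S (map fst ps). ?C ps u zs * tree_inj S \<alpha> zs \<nu>) *
      cnj (\<Sum>zs\<in>wts S (map fst ps). ?C ps v zs * tree_inj S \<alpha> zs \<nu>))"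
      by (intro sum.cong refl) (simp add: h_def labellings_on_def)
    also have "\<dots> = (\<Sum>zs\<in>wts S (map fst ps). ?C ps u zs * cnj (?C ps v zs))"
      by (rule tree_parseval[OF irr(2)[OF ps] irr(1)[OF ps]])
    finally show "(\<Sum>\<alpha>\<in>labellings_on T (map fst ps). h (ps, \<alpha>)) =
        (\<Sum>zs\<in>wts S (map fst ps). ?C ps u zs * cnj (?C ps v zs))" .
  qed
  also have "\<dots> = (if u = v then 1 else 0)"
    by (rule leaf_cg_complete[OF len irr1 irr2 u v])
  finally show ?thesis .
qed

lemma pair_rep_dup_amp:
  assumes gs: "length gs = num_leaves T" "set gs \<subseteq> carrier (grp S)"
    and q: "q \<in> dup_labels T \<Lambda>s1 \<Lambda>s2" and u: "u \<in> wts S \<Lambda>s1 \<times> wts S \<Lambda>s2"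
  shows "(\<Sum>v\<in>wts S \<Lambda>s1 \<times> wts S \<Lambda>s2. pair_rep \<Lambda>s1 \<Lambda>s2 gs u v * dup_amp \<Lambda>s1 \<Lambda>s2 q v \<mu>) =
    (\<Sum>us\<in>wts S (leaves (fst q)).
      leaf_cg \<Lambda>s1 \<Lambda>s2 (zip (leaves (fst q)) (leaves (snd q))) u us *
      (\<Sum>zs\<in>wts S (leaves (fst q)). reps S (leaves (fst q)) gs us zs * tree_inj S (fst q) zs \<mu>))"
proof -
  let ?ps = "zip (leaves (fst q)) (leaves (snd q))"
  have gs': "length gs = length \<Lambda>s1" using gs len1 by simp
  show ?thesis
    unfolding dup_amp_def sum_mult_assoc pair_rep_def
    using leaf_cg_intertwines[OF len irr1 irr2 gs' gs(2) u dup_labelsD(1)[OF q]]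
    by (intro sum.cong refl) (simp add: dup_labelsD(2)[OF q])
qed

lemma dup_amp_intertwines:
  assumes a: "a \<in> carrier (grp S)" and q: "q \<in> dup_labels T \<Lambda>s1 \<Lambda>s2"
    and u: "u \<in> wts S \<Lambda>s1 \<times> wts S \<Lambda>s2" and \<mu>: "\<mu> \<in> wt S (root_weight (fst q))"
  shows "(\<Sum>v\<in>wts S \<Lambda>s1 \<times> wts S \<Lambda>s2.
      pair_rep \<Lambda>s1 \<Lambda>s2 (replicate (num_leaves T) a) u v * dup_amp \<Lambda>s1 \<Lambda>s2 q v \<mu>) =
    (\<Sum>\<nu>\<in>wt S (root_weight (fst q)). dup_amp \<Lambda>s1 \<Lambda>s2 q u \<nu> * rep S (root_weight (fst q)) a \<nu> \<mu>)"
proof -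
  have "length (replicate (num_leaves T) a) = num_leaves T"
    "set (replicate (num_leaves T) a) \<subseteq> carrier (grp S)" using a by auto
  note pair_rep_dup_amp[OF this q u, of \<mu>]
  also have "(\<Sum>us\<in>wts S (leaves (fst q)).
      leaf_cg \<Lambda>s1 \<Lambda>s2 (zip (leaves (fst q)) (leaves (snd q))) u us *
      (\<Sum>zs\<in>wts S (leaves (fst q)). reps S (leaves (fst q)) (replicate (num_leaves T) a) us zs *
        tree_inj S (fst q) zs \<mu>)) = (\<Sum>us\<in>wts S (leaves (fst q)).
      leaf_cg \<Lambda>s1 \<Lambda>s2 (zip (leaves (fst q)) (leaves (snd q))) u us *
      (\<Sum>\<nu>\<in>wt S (root_weight (fst q)). tree_inj S (fst q) us \<nu> * rep S (root_weight (fst q)) a \<nu> \<mu>))"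
    using tree_inj_intertwines[OF dup_labelsD(3)[OF q] a _ \<mu>] dup_labelsD(6)[OF q] by simp
  finally show ?thesis by (simp only: sum_mult_assoc dup_amp_def)
qed

text \<open>Leaf couplings carry the action of \<open>gs\<close> down to the new leaf weights, and
  couplings with different label sequences have orthogonal ranges. What survives is one term of the
  quasicharacter of the original tree, before the sum over \<open>\<mu>\<close>. The condition on
  leaves and \<open>snd\<close> says that both labels use the same leaf couplings.\<close>

lemma dup_amp_gram:
  assumes gs: "length gs = num_leaves T" "set gs \<subseteq> carrier (grp S)"
    and q': "q' \<in> dup_labels T \<Lambda>s1 \<Lambda>s2" and q: "q \<in> dup_labels T \<Lambda>s1 \<Lambda>s2"
  shows "(\<Sum>u\<in>wts S \<Lambda>s1 \<times> wts S \<Lambda>s2. cnj (dup_amp \<Lambda>s1 \<Lambda>s2 q' u \<mu>) *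
      (\<Sum>v\<in>wts S \<Lambda>s1 \<times> wts S \<Lambda>s2. pair_rep \<Lambda>s1 \<Lambda>s2 gs u v * dup_amp \<Lambda>s1 \<Lambda>s2 q v \<mu>)) =
    (if leaves (fst q') = leaves (fst q) \<and> snd q' = snd q then
      \<Sum>zs\<in>wts S (leaves (fst q)). cnj (tree_inj S (fst q') zs \<mu>) *
        (\<Sum>us\<in>wts S (leaves (fst q)). reps S (leaves (fst q)) gs zs us * tree_inj S (fst q) us \<mu>)
     else 0)"
proof -
  let ?U = "wts S \<Lambda>s1 \<times> wts S \<Lambda>s2" and ?C = "leaf_cg \<Lambda>s1 \<Lambda>s2"
  let ?ps' = "zip (leaves (fst q')) (leaves (snd q'))" and ?ps = "zip (leaves (fst q)) (leaves (snd q))"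
  let ?W' = "wts S (leaves (fst q'))" and ?W = "wts S (leaves (fst q))"
  define t' where "t' zs = tree_inj S (fst q') zs \<mu>" for zs
  define y where "y zs = (\<Sum>us\<in>?W. reps S (leaves (fst q)) gs zs us * tree_inj S (fst q) us \<mu>)" for zs
  have finW: "finite ?W"
    using finite_wts admissible_irr dup_labelsD(3)[OF q] by blast
  have psiff: "?ps' = ?ps \<longleftrightarrow> leaves (fst q') = leaves (fst q) \<and> snd q' = snd q"
  proof
    assume eq: "?ps' = ?ps"
    then have "leaves (fst q') = leaves (fst q)"
      using arg_cong[OF eq, of "map fst"] dup_labelsD(2)[OF q] dup_labelsD(2)[OF q'] by simp
    moreover have "leaves (snd q') = leaves (snd q)"
      using arg_cong[OF eq, of "map snd"] dup_labelsD(6,7)[OF q] dup_labelsD(6,7)[OF q'] by simp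
    then have "snd q' = snd q"
      using leaves_inject dup_labelsD(5)[OF q] dup_labelsD(5)[OF q'] by metis
    ultimately show "leaves (fst q') = leaves (fst q) \<and> snd q' = snd q" by blast
  qed simp
  have "(\<Sum>u\<in>?U. cnj (dup_amp \<Lambda>s1 \<Lambda>s2 q' u \<mu>) *
      (\<Sum>v\<in>?U. pair_rep \<Lambda>s1 \<Lambda>s2 gs u v * dup_amp \<Lambda>s1 \<Lambda>s2 q v \<mu>)) =
      (\<Sum>u\<in>?U. (\<Sum>zs\<in>?W'. cnj (t' zs) * cnj (?C ?ps' u zs)) * (\<Sum>us\<in>?W. ?C ?ps u us * y us))"
    using pair_rep_dup_amp[OF gs q] by (simp add: dup_amp_def t'_def y_def mult.commute)
  also have "\<dots> = (\<Sum>zs\<in>?W'. cnj (t' zs) * (\<Sum>u\<in>?U. cnj (?C ?ps' u zs) * (\<Sum>us\<in>?W. ?C ?ps u us * y us)))"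
    by (rule sum_mult_assoc[symmetric])
  also have "\<dots> = (\<Sum>zs\<in>?W'. cnj (t' zs) * (\<Sum>us\<in>?W. (\<Sum>u\<in>?U. cnj (?C ?ps' u zs) * ?C ?ps u us) * y us))"
    by (simp only: sum_mult_assoc)
  \<comment> \<open>Orthonormality of the leaf couplings, both across different label sequences and
    inside one range.\<close>
  also have "\<dots> = (\<Sum>zs\<in>?W'. cnj (t' zs) * (\<Sum>us\<in>?W. (if ?ps' = ?ps \<and> zs = us then 1 else 0) * y us))"
    using leaf_cg_orthonormal[OF len irr1 irr2 dup_labelsD(1)[OF q'] dup_labelsD(1)[OF q]]
    by (simp only: dup_labelsD(2)[OF q] dup_labelsD(2)[OF q'] cong: sum.cong)
  also have "\<dots> = (if ?ps' = ?ps then \<Sum>zs\<in>?W. cnj (t' zs) * y zs else 0)"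
  proof (cases "?ps' = ?ps")
    case True
    then have "?W' = ?W" using psiff by simp
    moreover have "(\<Sum>us\<in>?W. (if zs = us then 1 else 0) * y us) = y zs" if "zs \<in> ?W" for zs
      using that finW by (simp add: sum_delta_mult)
    ultimately show ?thesis using True by simp
  qed simp
  finally show ?thesis by (simp only: psiff t'_def y_def)
qed

lemma pair_rep_inv:
  assumes "a \<in> carrier (grp S)" "u \<in> wts S \<Lambda>s1 \<times> wts S \<Lambda>s2" "v \<in> wts S \<Lambda>s1 \<times> wts S \<Lambda>s2"
  shows "pair_rep \<Lambda>s1 \<Lambda>s2 (replicate (num_leaves T) (inv\<^bsub>grp S\<^esub> a)) u v =
    cnj (pair_rep \<Lambda>s1 \<Lambda>s2 (replicate (num_leaves T) a) v u)"
  using assms reps_inv[OF irr1, of a "fst u" "fst v"] reps_inv[OF irr2, of a "snd u" "snd v"]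
  by (auto simp: pair_rep_def len1 len2)

end

text \<open>On the index lists of a pair \<open>u\<close>, the permutation operators merely exchange
  interleaving and concatenation. Both coefficients are therefore overlaps of the same two vectors,
  in opposite order and thus conjugate. The hypothesis on \<open>c\<close> supplies the value
  independent of \<open>\<mu>\<close> that the definite description asks for.\<close>

lemma recoupling_dup_join:
  assumes \<alpha>1: "\<alpha>1 \<in> labellings S T" and \<alpha>2: "\<alpha>2 \<in> labellings S T"
    and q: "(\<alpha>, ks) \<in> dup_labels T (leaves \<alpha>1) (leaves \<alpha>2)"
    and k: "(root_weight \<alpha>, k) \<in> coupled S (root_weight \<alpha>1) (root_weight \<alpha>2)"
    and c: "\<And>\<mu>. \<mu> \<in> wt S (root_weight \<alpha>) \<Longrightarrow>
      (\<Sum>u\<in>wts S (leaves \<alpha>1) \<times> wts S (leaves \<alpha>2).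
        cnj (dup_amp (leaves \<alpha>1) (leaves \<alpha>2) (\<alpha>, ks) u \<mu>) *
        tree_inj S (Node (root_weight \<alpha>, k) \<alpha>1 \<alpha>2) (fst u @ snd u) \<mu>) = c"
  shows "R_dup_join S T \<alpha>1 \<alpha>2 k \<alpha> ks = c" "R_join_dup S T \<alpha>1 \<alpha>2 k \<alpha> ks = cnj c"
proof -
  let ?U = "wts S (leaves \<alpha>1) \<times> wts S (leaves \<alpha>2)"
  let ?dup = "dup_lab \<alpha>1 \<alpha>2 \<alpha> ks" and ?join = "join_lab \<alpha>1 \<alpha>2 (root_weight \<alpha>, k)"
  let ?N = "num_leaves T"
  note t = labellingsD(1)[OF \<alpha>1] labellingsD(1)[OF \<alpha>2] labellingsD(2)[OF \<alpha>1] labellingsD(2)[OF \<alpha>2]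
  note n = labellingsD(3)[OF \<alpha>1] labellingsD(3)[OF \<alpha>2]
  have q': "tree_of \<alpha> = T" "tree_of ks = T" "admissible S \<alpha>"
    using q by (auto simp: dup_labels_def labellings_def)
  have cl: "(\<alpha>, ks, k) \<in> coupled_labs S T \<alpha>1 \<alpha>2"
    using q k by (auto simp: coupled_labs_def dup_labels_def)
  have irr: "root_weight \<alpha> \<in> irr S" using admissible_irr[OF q'(3)] by blast
  note irrs = labellingsD(4)[OF \<alpha>1] labellingsD(4)[OF \<alpha>2]
  have fin: "finite ?U" using finite_wts irrs by blast
  note shape = dup_lab_shape[OF t(1,2) q'(1,2)]
  have wlen: "length (fst u) = ?N" "length (snd u) = ?N" if "u \<in> ?U" for u
    using that n by (auto simp: in_wts_iff)
  have adm_join: "admissible S ?join" using t k by (simp add: join_lab_def)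
  have kj: "ket S ?join \<mu> (fst u @ snd u) = tree_inj S ?join (fst u @ snd u) \<mu>"
    if "\<mu> \<in> wt S (root_weight \<alpha>)" "u \<in> ?U" for \<mu> u
  proof (rule ket_eq[OF adm_join])
    show "\<mu> \<in> wt S (root_weight ?join)" using that by (simp add: join_lab_def)
    show "fst u @ snd u \<in> wts S (leaves ?join)"
      using that by (auto simp: join_lab_def in_wts_iff nth_append)
  qed
  have kd: "ket S ?dup \<mu> (splice (fst u) (snd u)) = dup_amp (leaves \<alpha>1) (leaves \<alpha>2) (\<alpha>, ks) u \<mu>"
    if \<mu>: "\<mu> \<in> wt S (root_weight \<alpha>)" and u: "u \<in> ?U" for \<mu> u
  proof -
    have "splice (fst u) (snd u) \<in> wts S (leaves ?dup)"
      using u n splice_in_wts by (auto simp: shape)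
    then have "ket S ?dup \<mu> (splice (fst u) (snd u)) = tree_inj S ?dup (splice (fst u) (snd u)) \<mu>"
      using \<mu> finite_wt[OF irr]
      by (simp add: ket_def mapply_def basis_vec_def shape if_distrib[where f = "\<lambda>x. _ * x"] cong: if_cong)
    also have "\<dots> = dup_amp (leaves \<alpha>1) (leaves \<alpha>2) (\<alpha>, ks) u \<mu>"
      using tree_inj_dup_lab[OF t(1,2) q'(1,2) t(3,4) q'(3), of "fst u" "snd u" \<mu>] \<mu> u
      by (auto simp: dup_amp_def)
    finally show ?thesis .
  qed
  have eqs: "splice (fst u) (snd u) = splice (fst v) (snd v) \<longleftrightarrow> u = v"
    "fst u @ snd u = fst v @ snd v \<longleftrightarrow> u = v" if "u \<in> ?U" "v \<in> ?U" for u v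
  proof -
    have "splice (fst u) (snd u) = splice (fst v) (snd v) \<Longrightarrow> u = v"
      using permute_list_join_to_dup[of "fst u" ?N "snd u"] permute_list_join_to_dup[of "fst v" ?N "snd v"]
        wlen[OF that(1)] wlen[OF that(2)] by (metis append_eq_append_conv prod_eq_iff)
    then show "splice (fst u) (snd u) = splice (fst v) (snd v) \<longleftrightarrow> u = v" by blast
    show "fst u @ snd u = fst v @ snd v \<longleftrightarrow> u = v"
      using wlen[OF that(1)] wlen[OF that(2)] by (auto simp: prod_eq_iff)
  qed
  have wj: "(\<Sum>zs\<in>wts S (leaves ?join). f zs) = (\<Sum>u\<in>?U. f (fst u @ snd u))" for f :: "'m list \<Rightarrow> complex"
    unfolding join_lab_def leaves.simps by (rule sum_wts_append)
  have wd: "(\<Sum>zs\<in>wts S (leaves ?dup). f zs) = (\<Sum>u\<in>?U. f (splice (fst u) (snd u)))" for f :: "'m list \<Rightarrow> complex"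
    unfolding shape using n by (intro sum_wts_splice) simp
  \<comment> \<open>A weight label is needed for uniqueness in \<open>THE\<close>; over an empty set
    every value would qualify.\<close>
  obtain \<mu>0 where \<mu>0: "\<mu>0 \<in> wt S (root_weight \<alpha>)" using wt_nonempty[OF irr] by blast
  have ipj: "ip (wts S (leaves ?dup)) (ket S ?dup \<mu>) (mapply (wts S (leaves ?dup)) (wts S (leaves ?join))
      (perm_op (inv_into UNIV (join_to_dup ?N))) (ket S ?join \<mu>)) = c"
    if \<mu>: "\<mu> \<in> wt S (root_weight \<alpha>)" for \<mu>
  proof -
    have "ip (wts S (leaves ?dup)) (ket S ?dup \<mu>) (mapply (wts S (leaves ?dup)) (wts S (leaves ?join))
        (perm_op (inv_into UNIV (join_to_dup ?N))) (ket S ?join \<mu>)) =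
        (\<Sum>u\<in>?U. cnj (ket S ?dup \<mu> (splice (fst u) (snd u))) *
          (\<Sum>v\<in>?U. (if splice (fst u) (snd u) = splice (fst v) (snd v) then 1 else 0) *
            ket S ?join \<mu> (fst v @ snd v)))"
      unfolding ip_mapply wd wj perm_op_def
      using permute_list_inv_join_to_dup[OF wlen] by (simp cong: sum.cong)
    also have "\<dots> = (\<Sum>u\<in>?U. cnj (ket S ?dup \<mu> (splice (fst u) (snd u))) *
          (\<Sum>v\<in>?U. (if u = v then 1 else 0) * ket S ?join \<mu> (fst v @ snd v)))"
      by (intro sum.cong refl arg_cong2[where f = "(*)"]) (simp add: eqs)
    also have "\<dots> = (\<Sum>u\<in>?U. cnj (ket S ?dup \<mu> (splice (fst u) (snd u))) * ket S ?join \<mu> (fst u @ snd u))"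
      using fin by (simp add: sum_delta_mult cong: sum.cong)
    also have "\<dots> = c"
      unfolding c[OF \<mu>, symmetric]
      by (intro sum.cong refl) (simp only: kd[OF \<mu>] kj[OF \<mu>], simp only: join_lab_def)
    finally show ?thesis .
  qed
  have rj: "root_weight ?join = root_weight \<alpha>" by (simp add: join_lab_def)
  show "R_dup_join S T \<alpha>1 \<alpha>2 k \<alpha> ks = c"
    unfolding R_dup_join_def recoupling_def Let_def rj using cl ipj \<mu>0 by (auto intro!: the_equality)
  have ipd: "ip (wts S (leaves ?join)) (ket S ?join \<mu>) (mapply (wts S (leaves ?join)) (wts S (leaves ?dup))
      (perm_op (join_to_dup ?N)) (ket S ?dup \<mu>)) = cnj c"
    if \<mu>: "\<mu> \<in> wt S (root_weight \<alpha>)" for \<mu>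
  proof -
    have "ip (wts S (leaves ?join)) (ket S ?join \<mu>) (mapply (wts S (leaves ?join)) (wts S (leaves ?dup))
        (perm_op (join_to_dup ?N)) (ket S ?dup \<mu>)) =
        (\<Sum>u\<in>?U. cnj (ket S ?join \<mu> (fst u @ snd u)) *
          (\<Sum>v\<in>?U. (if fst u @ snd u = fst v @ snd v then 1 else 0) *
            ket S ?dup \<mu> (splice (fst v) (snd v))))"
      unfolding ip_mapply wd wj perm_op_def
      using permute_list_join_to_dup[OF wlen] by (simp cong: sum.cong)
    also have "\<dots> = (\<Sum>u\<in>?U. cnj (ket S ?join \<mu> (fst u @ snd u)) *
          (\<Sum>v\<in>?U. (if u = v then 1 else 0) * ket S ?dup \<mu> (splice (fst v) (snd v))))"
      by (intro sum.cong refl arg_cong2[where f = "(*)"]) (simp add: eqs)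
    also have "\<dots> = (\<Sum>u\<in>?U. cnj (ket S ?join \<mu> (fst u @ snd u)) * ket S ?dup \<mu> (splice (fst u) (snd u)))"
      using fin by (simp add: sum_delta_mult cong: sum.cong)
    also have "\<dots> = cnj c"
      unfolding c[OF \<mu>, symmetric] cnj_sum
      by (intro sum.cong refl) (simp only: kd[OF \<mu>] kj[OF \<mu>], simp add: join_lab_def mult.commute)
    finally show ?thesis .
  qed
  show "R_join_dup S T \<alpha>1 \<alpha>2 k \<alpha> ks = cnj c"
    unfolding R_join_dup_def recoupling_def Let_def shape(2) using cl ipd \<mu>0
    by (auto intro!: the_equality)
qed

section \<open>Selection rule and expansion of kets of the join\<close>

lemma join_intertwines:
  assumes \<alpha>1: "\<alpha>1 \<in> labellings S T" and \<alpha>2: "\<alpha>2 \<in> labellings S T"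
    and x: "x \<in> coupled S (root_weight \<alpha>1) (root_weight \<alpha>2)"
    and a: "a \<in> carrier (grp S)" and u: "u \<in> wts S (leaves \<alpha>1) \<times> wts S (leaves \<alpha>2)"
    and \<mu>: "\<mu> \<in> wt S (fst x)"
  shows "(\<Sum>v\<in>wts S (leaves \<alpha>1) \<times> wts S (leaves \<alpha>2).
      pair_rep (leaves \<alpha>1) (leaves \<alpha>2) (replicate (num_leaves T) a) u v *
        tree_inj S (Node x \<alpha>1 \<alpha>2) (fst v @ snd v) \<mu>) =
    (\<Sum>\<nu>\<in>wt S (fst x). tree_inj S (Node x \<alpha>1 \<alpha>2) (fst u @ snd u) \<nu> * rep S (fst x) a \<nu> \<mu>)"
proof -
  have n: "num_leaves \<alpha>1 = num_leaves T" "num_leaves \<alpha>2 = num_leaves T"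
    using labellingsD[OF \<alpha>1] labellingsD[OF \<alpha>2] by auto
  have adm: "admissible S (Node x \<alpha>1 \<alpha>2)" using \<alpha>1 \<alpha>2 x by (simp add: labellings_def)
  have "fst u @ snd u \<in> wts S (leaves (Node x \<alpha>1 \<alpha>2))"
    using u by (auto simp: in_wts_iff nth_append)
  moreover have "\<mu> \<in> wt S (root_weight (Node x \<alpha>1 \<alpha>2))" using \<mu> by simp
  ultimately have "(\<Sum>us\<in>wts S (leaves (Node x \<alpha>1 \<alpha>2)).
      reps S (leaves (Node x \<alpha>1 \<alpha>2)) (replicate (num_leaves (Node x \<alpha>1 \<alpha>2)) a) (fst u @ snd u) us *
        tree_inj S (Node x \<alpha>1 \<alpha>2) us \<mu>) =
      (\<Sum>\<nu>\<in>wt S (fst x). tree_inj S (Node x \<alpha>1 \<alpha>2) (fst u @ snd u) \<nu> * rep S (fst x) a \<nu> \<mu>)"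
    using tree_inj_intertwines[OF adm a] by (simp del: tree_inj.simps)
  moreover have "reps S (leaves (Node x \<alpha>1 \<alpha>2)) (replicate (num_leaves (Node x \<alpha>1 \<alpha>2)) a)
      (fst u @ snd u) (fst v @ snd v) = pair_rep (leaves \<alpha>1) (leaves \<alpha>2) (replicate (num_leaves T) a) u v"
    if "v \<in> wts S (leaves \<alpha>1) \<times> wts S (leaves \<alpha>2)" for v
    using u that n by (auto simp: pair_rep_def replicate_add reps_append in_wts_iff)
  ultimately show ?thesis
    by (simp add: sum_wts_append del: tree_inj.simps cong: sum.cong)
qed

text \<open>Both injections are equivariant under the diagonal action, so Schur's lemma forces equal
  root weights and equal weight labels and leaves one constant, which is the recoupling
  coefficient.\<close>

lemma dup_join_overlap:
  assumes \<alpha>1: "\<alpha>1 \<in> labellings S T" and \<alpha>2: "\<alpha>2 \<in> labellings S T"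
    and q: "q \<in> dup_labels T (leaves \<alpha>1) (leaves \<alpha>2)"
    and x: "x \<in> coupled S (root_weight \<alpha>1) (root_weight \<alpha>2)"
  shows "\<And>\<nu> \<mu>. \<nu> \<in> wt S (root_weight (fst q)) \<Longrightarrow> \<mu> \<in> wt S (fst x) \<Longrightarrow>
      (\<Sum>u\<in>wts S (leaves \<alpha>1) \<times> wts S (leaves \<alpha>2).
        cnj (dup_amp (leaves \<alpha>1) (leaves \<alpha>2) q u \<nu>) * tree_inj S (Node x \<alpha>1 \<alpha>2) (fst u @ snd u) \<mu>) =
      (if root_weight (fst q) = fst x \<and> \<nu> = \<mu> then R_dup_join S T \<alpha>1 \<alpha>2 (snd x) (fst q) (snd q) else 0)"
    and "root_weight (fst q) = fst x \<Longrightarrow> R_join_dup S T \<alpha>1 \<alpha>2 (snd x) (fst q) (snd q) =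
      cnj (R_dup_join S T \<alpha>1 \<alpha>2 (snd x) (fst q) (snd q))"
proof -
  note n = labellingsD(3)[OF \<alpha>1] labellingsD(3)[OF \<alpha>2]
  note irrs = labellingsD(4)[OF \<alpha>1] labellingsD(4)[OF \<alpha>2]
  have irr: "fst x \<in> irr S" "root_weight (fst q) \<in> irr S"
    using coupled_irr[OF x] admissible_irr[OF dup_labelsD(3)[OF n irrs q]] by auto
  obtain c where c: "\<And>\<nu> \<mu>. \<nu> \<in> wt S (root_weight (fst q)) \<Longrightarrow> \<mu> \<in> wt S (fst x) \<Longrightarrow>
      (\<Sum>u\<in>wts S (leaves \<alpha>1) \<times> wts S (leaves \<alpha>2).
        cnj (dup_amp (leaves \<alpha>1) (leaves \<alpha>2) q u \<nu>) * tree_inj S (Node x \<alpha>1 \<alpha>2) (fst u @ snd u) \<mu>) =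
      (if fst x = root_weight (fst q) \<and> \<nu> = \<mu> then c else 0)"
    using overlap_schur[OF irr, of "wts S (leaves \<alpha>1) \<times> wts S (leaves \<alpha>2)"
        "\<lambda>a. pair_rep (leaves \<alpha>1) (leaves \<alpha>2) (replicate (num_leaves T) a)"
        "dup_amp (leaves \<alpha>1) (leaves \<alpha>2) q" "\<lambda>u. tree_inj S (Node x \<alpha>1 \<alpha>2) (fst u @ snd u)",
        OF pair_rep_inv[OF n irrs] dup_amp_intertwines[OF n irrs _ q] join_intertwines[OF \<alpha>1 \<alpha>2 x]]
    by blast
  have R: "R_dup_join S T \<alpha>1 \<alpha>2 (snd x) (fst q) (snd q) = c \<and>
      R_join_dup S T \<alpha>1 \<alpha>2 (snd x) (fst q) (snd q) = cnj c" if eq: "root_weight (fst q) = fst x"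
  proof -
    \<comment> \<open>The coefficients are defined with the root weight of \<open>fst q\<close> in
      the root label of the join, so they refer to \<open>x\<close> only when the weights
      agree.\<close>
    have x': "x = (root_weight (fst q), snd x)" using eq by simp
    show ?thesis
      using recoupling_dup_join[OF \<alpha>1 \<alpha>2, of "fst q" "snd q" "snd x" c] q x c eq x' by simp
  qed
  show "(\<Sum>u\<in>wts S (leaves \<alpha>1) \<times> wts S (leaves \<alpha>2).
        cnj (dup_amp (leaves \<alpha>1) (leaves \<alpha>2) q u \<nu>) * tree_inj S (Node x \<alpha>1 \<alpha>2) (fst u @ snd u) \<mu>) =
      (if root_weight (fst q) = fst x \<and> \<nu> = \<mu> then R_dup_join S T \<alpha>1 \<alpha>2 (snd x) (fst q) (snd q) else 0)"
    if "\<nu> \<in> wt S (root_weight (fst q))" "\<mu> \<in> wt S (fst x)" for \<nu> \<mu>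
    using c[OF that] R by auto
  show "root_weight (fst q) = fst x \<Longrightarrow> R_join_dup S T \<alpha>1 \<alpha>2 (snd x) (fst q) (snd q) =
      cnj (R_dup_join S T \<alpha>1 \<alpha>2 (snd x) (fst q) (snd q))"
    using R by simp
qed

text \<open>Inserting the completeness relation of the leaf duplication writes the ket through its
  overlaps; the selection rule leaves only labels of root weight \<open>fst x\<close>, with the same
  \<open>\<mu>\<close>.\<close>

lemma join_expansion:
  assumes \<alpha>1: "\<alpha>1 \<in> labellings S T" and \<alpha>2: "\<alpha>2 \<in> labellings S T"
    and x: "x \<in> coupled S (root_weight \<alpha>1) (root_weight \<alpha>2)" and \<mu>: "\<mu> \<in> wt S (fst x)"
    and v: "v \<in> wts S (leaves \<alpha>1) \<times> wts S (leaves \<alpha>2)"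
  shows "tree_inj S (Node x \<alpha>1 \<alpha>2) (fst v @ snd v) \<mu> =
    (\<Sum>q\<in>{q \<in> dup_labels T (leaves \<alpha>1) (leaves \<alpha>2). root_weight (fst q) = fst x}.
      R_dup_join S T \<alpha>1 \<alpha>2 (snd x) (fst q) (snd q) * dup_amp (leaves \<alpha>1) (leaves \<alpha>2) q v \<mu>)"
proof -
  note n = labellingsD(3)[OF \<alpha>1] labellingsD(3)[OF \<alpha>2]
  note irrs = labellingsD(4)[OF \<alpha>1] labellingsD(4)[OF \<alpha>2]
  let ?U = "wts S (leaves \<alpha>1) \<times> wts S (leaves \<alpha>2)" and ?Q = "dup_labels T (leaves \<alpha>1) (leaves \<alpha>2)"
  let ?F = "dup_amp (leaves \<alpha>1) (leaves \<alpha>2)"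
  define J where "J u = tree_inj S (Node x \<alpha>1 \<alpha>2) (fst u @ snd u) \<mu>" for u
  define R where "R q = R_dup_join S T \<alpha>1 \<alpha>2 (snd x) (fst q) (snd q)" for q
  have finU: "finite ?U" by (rule finite_pairs[OF n irrs])
  have "J v = (\<Sum>u\<in>?U. (if v = u then 1 else 0) * J u)"
    using v finU by (simp only: sum_delta_mult if_True)
  also have "\<dots> = (\<Sum>u\<in>?U. (\<Sum>q\<in>?Q. \<Sum>\<nu>\<in>wt S (root_weight (fst q)). ?F q v \<nu> * cnj (?F q u \<nu>)) * J u)"
    using dup_amp_complete[OF n irrs v] by (intro sum.cong refl) simp
  also have "\<dots> = (\<Sum>q\<in>?Q. \<Sum>u\<in>?U. (\<Sum>\<nu>\<in>wt S (root_weight (fst q)). ?F q v \<nu> * cnj (?F q u \<nu>)) * J u)"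
    unfolding sum_distrib_right by (rule sum.swap)
  also have "\<dots> = (\<Sum>q\<in>?Q. \<Sum>\<nu>\<in>wt S (root_weight (fst q)). ?F q v \<nu> * (\<Sum>u\<in>?U. cnj (?F q u \<nu>) * J u))"
    by (simp only: sum_mult_assoc)
  also have "\<dots> = (\<Sum>q\<in>?Q. if root_weight (fst q) = fst x then R q * ?F q v \<mu> else 0)"
  proof (rule sum.cong[OF refl])
    fix q assume q: "q \<in> ?Q"
    have fin: "finite (wt S (fst x))" using finite_wt coupled_irr[OF x] by blast
    have "(\<Sum>\<nu>\<in>wt S (root_weight (fst q)). ?F q v \<nu> * (\<Sum>u\<in>?U. cnj (?F q u \<nu>) * J u)) =
        (\<Sum>\<nu>\<in>wt S (root_weight (fst q)). ?F q v \<nu> *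
          (if root_weight (fst q) = fst x \<and> \<nu> = \<mu> then R q else 0))"
      using dup_join_overlap(1)[OF \<alpha>1 \<alpha>2 q x _ \<mu>]
      by (intro sum.cong refl arg_cong2[where f = "(*)"]) (simp only: J_def R_def)
    also have "\<dots> = (if root_weight (fst q) = fst x then R q * ?F q v \<mu> else 0)"
      using \<mu> fin by (simp add: if_distrib[where f = "\<lambda>x. _ * x"] mult.commute cong: if_cong)
    finally show "(\<Sum>\<nu>\<in>wt S (root_weight (fst q)). ?F q v \<nu> * (\<Sum>u\<in>?U. cnj (?F q u \<nu>) * J u)) =
        (if root_weight (fst q) = fst x then R q * ?F q v \<mu> else 0)" .
  qed
  also have "\<dots> = (\<Sum>q\<in>{q \<in> ?Q. root_weight (fst q) = fst x}. R q * ?F q v \<mu>)"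
    using finite_dup_labels[OF n irrs] by (rule sum.inter_filter[symmetric])
  finally show ?thesis by (simp only: J_def R_def)
qed

section \<open>Products of quasicharacters\<close>

lemma quasichar_mult:
  assumes c1: "combinable S T \<alpha>1 \<alpha>1'" and c2: "combinable S T \<alpha>2 \<alpha>2'"
    and gs: "length gs = num_leaves T" "set gs \<subseteq> carrier (grp S)"
  shows "quasichar S \<alpha>1 \<alpha>1' gs * quasichar S \<alpha>2 \<alpha>2' gs =
    (\<Sum>x\<in>coupled S (root_weight \<alpha>1) (root_weight \<alpha>2). \<Sum>\<mu>\<in>wt S (fst x).
      \<Sum>u\<in>wts S (leaves \<alpha>1) \<times> wts S (leaves \<alpha>2).
        cnj (tree_inj S (Node x \<alpha>1' \<alpha>2') (fst u @ snd u) \<mu>) *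
        (\<Sum>v\<in>wts S (leaves \<alpha>1) \<times> wts S (leaves \<alpha>2).
          pair_rep (leaves \<alpha>1) (leaves \<alpha>2) gs u v * tree_inj S (Node x \<alpha>1 \<alpha>2) (fst v @ snd v) \<mu>))"
proof -
  have same: "leaves \<alpha>1' = leaves \<alpha>1" "leaves \<alpha>2' = leaves \<alpha>2"
    "root_weight \<alpha>1' = root_weight \<alpha>1" "root_weight \<alpha>2' = root_weight \<alpha>2"
    using c1 c2 by (auto simp: combinable_def labellings_with_def)
  have irr: "root_weight \<alpha>1 \<in> irr S" "root_weight \<alpha>2 \<in> irr S"
    using c1 c2 admissible_irr by (auto simp: combinable_def labellings_with_def labellings_def)
  let ?U1 = "wts S (leaves \<alpha>1)" and ?U2 = "wts S (leaves \<alpha>2)"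
  let ?U = "?U1 \<times> ?U2" and ?P = "wt S (root_weight \<alpha>1) \<times> wt S (root_weight \<alpha>2)"
  let ?K = "coupled S (root_weight \<alpha>1) (root_weight \<alpha>2)"
  define t where "t u p = tree_inj S \<alpha>1 (fst u) (fst p) * tree_inj S \<alpha>2 (snd u) (snd p)" for u p
  define t' where "t' u p = tree_inj S \<alpha>1' (fst u) (fst p) * tree_inj S \<alpha>2' (snd u) (snd p)" for u p
  define Q where "Q = pair_rep (leaves \<alpha>1) (leaves \<alpha>2) gs"
  let ?c = "cg (root_weight \<alpha>1) (root_weight \<alpha>2)"
  \<comment> \<open>Combinable labellings share their root weights, so bra and ket are coupled by
    the same coefficients. Parseval's identity is used to introduce the root label \<open>x\<close>,
    not to remove it.\<close>
  have pars: "(\<Sum>x\<in>?K. \<Sum>\<mu>\<in>wt S (fst x).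
      tree_inj S (Node x \<alpha>1 \<alpha>2) (fst v @ snd v) \<mu> * cnj (tree_inj S (Node x \<alpha>1' \<alpha>2') (fst u @ snd u) \<mu>)) =
      (\<Sum>p\<in>?P. t v p * cnj (t' u p))" if "u \<in> ?U" "v \<in> ?U" for u v
  proof -
    have l: "length (fst u) = num_leaves \<alpha>1'" "length (fst v) = num_leaves \<alpha>1"
      using that same by (auto simp: in_wts_iff)
    show ?thesis
      unfolding tree_inj_Node[OF l(1)] tree_inj_Node[OF l(2)] same t_def t'_def
      by (rule cg_parseval[OF irr])
  qed
  have "quasichar S \<alpha>1 \<alpha>1' gs * quasichar S \<alpha>2 \<alpha>2' gs =
      (\<Sum>p\<in>?P. (\<Sum>z\<in>?U1. cnj (tree_inj S \<alpha>1' z (fst p)) *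
          (\<Sum>y\<in>?U1. reps S (leaves \<alpha>1) gs z y * tree_inj S \<alpha>1 y (fst p))) *
        (\<Sum>z\<in>?U2. cnj (tree_inj S \<alpha>2' z (snd p)) *
          (\<Sum>y\<in>?U2. reps S (leaves \<alpha>2) gs z y * tree_inj S \<alpha>2 y (snd p))))"
    unfolding quasichar_eq[OF c1] quasichar_eq[OF c2] sum_product[of _ "wt S (root_weight \<alpha>1)"]
    by (simp add: sum.cartesian_product case_prod_beta')
  also have "\<dots> = (\<Sum>p\<in>?P. \<Sum>u\<in>?U. cnj (t' u p) * (\<Sum>v\<in>?U. Q u v * t v p))"
    unfolding sum_Times_mult[symmetric] t_def t'_def Q_def pair_rep_def complex_cnj_mult ..
  also have "\<dots> = (\<Sum>p\<in>?P. \<Sum>u\<in>?U. \<Sum>v\<in>?U. Q u v * (t v p * cnj (t' u p)))"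
    by (simp add: sum_distrib_left ac_simps)
  also have "\<dots> = (\<Sum>u\<in>?U. \<Sum>v\<in>?U. \<Sum>p\<in>?P. Q u v * (t v p * cnj (t' u p)))"
    by (rule sum_rotate)
  also have "\<dots> = (\<Sum>u\<in>?U. \<Sum>v\<in>?U. \<Sum>x\<in>?K. \<Sum>\<mu>\<in>wt S (fst x). Q u v *
      (tree_inj S (Node x \<alpha>1 \<alpha>2) (fst v @ snd v) \<mu> * cnj (tree_inj S (Node x \<alpha>1' \<alpha>2') (fst u @ snd u) \<mu>)))"
    by (intro sum.cong refl) (simp only: sum_distrib_left[symmetric] pars)
  also have "\<dots> = (\<Sum>x\<in>?K. \<Sum>\<mu>\<in>wt S (fst x). \<Sum>u\<in>?U. \<Sum>v\<in>?U. Q u v *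
      (tree_inj S (Node x \<alpha>1 \<alpha>2) (fst v @ snd v) \<mu> * cnj (tree_inj S (Node x \<alpha>1' \<alpha>2') (fst u @ snd u) \<mu>)))"
    by (rule sum_swap_pairs[symmetric])
  finally show ?thesis
    by (simp add: sum_distrib_left ac_simps Q_def del: tree_inj.simps)
qed

text \<open>Bra and ket of the join are expanded separately, which gives a double sum over
  \<open>q'\<close> and \<open>q\<close>; orthogonality of the leaf couplings then ties their leaves
  and multiplicities together. \<open>Q\<close> is a variable with a defining equation, so that a
  locally defined family can be substituted.\<close>

lemma quasichar_mult_expansion:
  assumes c1: "combinable S T \<alpha>1 \<alpha>1'" and c2: "combinable S T \<alpha>2 \<alpha>2'"
    and gs: "length gs = num_leaves T" "set gs \<subseteq> carrier (grp S)"
    and Q: "\<And>x. Q x = {q \<in> dup_labels T (leaves \<alpha>1) (leaves \<alpha>2). root_weight (fst q) = fst x}"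
  shows "quasichar S \<alpha>1 \<alpha>1' gs * quasichar S \<alpha>2 \<alpha>2' gs =
    (\<Sum>x\<in>coupled S (root_weight \<alpha>1) (root_weight \<alpha>2). \<Sum>q'\<in>Q x. \<Sum>q\<in>Q x.
      if leaves (fst q') = leaves (fst q) \<and> snd q' = snd q then
        R_join_dup S T \<alpha>1' \<alpha>2' (snd x) (fst q') (snd q') * quasichar S (fst q) (fst q') gs *
        R_dup_join S T \<alpha>1 \<alpha>2 (snd x) (fst q) (snd q)
      else 0)"
proof -
  have same: "leaves \<alpha>1' = leaves \<alpha>1" "leaves \<alpha>2' = leaves \<alpha>2"
    "root_weight \<alpha>1' = root_weight \<alpha>1" "root_weight \<alpha>2' = root_weight \<alpha>2"
    using c1 c2 by (auto simp: combinable_def labellings_with_def)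
  have lab: "\<alpha>1 \<in> labellings S T" "\<alpha>2 \<in> labellings S T" "\<alpha>1' \<in> labellings S T" "\<alpha>2' \<in> labellings S T"
    using c1 c2 by (auto simp: combinable_def labellings_with_def)
  then have n: "num_leaves \<alpha>1 = num_leaves T" "num_leaves \<alpha>2 = num_leaves T"
    and irrs: "set (leaves \<alpha>1) \<subseteq> irr S" "set (leaves \<alpha>2) \<subseteq> irr S"
    using labellingsD by blast+
  let ?U = "wts S (leaves \<alpha>1) \<times> wts S (leaves \<alpha>2)"
  let ?K = "coupled S (root_weight \<alpha>1) (root_weight \<alpha>2)"
  let ?F = "dup_amp (leaves \<alpha>1) (leaves \<alpha>2)" and ?P = "pair_rep (leaves \<alpha>1) (leaves \<alpha>2) gs"
  let ?R' = "\<lambda>x q. R_dup_join S T \<alpha>1' \<alpha>2' (snd x) (fst q) (snd q)"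
  let ?R = "\<lambda>x q. R_dup_join S T \<alpha>1 \<alpha>2 (snd x) (fst q) (snd q)"
  let ?eq = "\<lambda>q' q. leaves (fst q') = leaves (fst q) \<and> snd q' = snd q"
  let ?G = "\<lambda>q' q \<mu>. \<Sum>u\<in>?U. cnj (?F q' u \<mu>) * (\<Sum>v\<in>?U. ?P u v * ?F q v \<mu>)"
  \<comment> \<open>Summing the matrix elements over the common weight label produces the trace that
    defines the quasicharacter; \<open>q'\<close> from the bra becomes its upper index.\<close>
  have G: "(\<Sum>\<mu>\<in>wt S (fst x). ?G q' q \<mu>) = (if ?eq q' q then quasichar S (fst q) (fst q') gs else 0)"
    if q': "q' \<in> Q x" and q: "q \<in> Q x" for x q' q
  proof -
    have mem: "q' \<in> dup_labels T (leaves \<alpha>1) (leaves \<alpha>2)" "q \<in> dup_labels T (leaves \<alpha>1) (leaves \<alpha>2)"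
      "root_weight (fst q') = fst x" "root_weight (fst q) = fst x" using q q' Q by auto
    have "combinable S T (fst q) (fst q')" if "?eq q' q"
      unfolding combinable_def labellings_with_def labellings_def
      by (rule exI[of _ "leaves (fst q)"], rule exI[of _ "fst x"])
         (use that mem(3,4) dup_labelsD(3,4)[OF n irrs mem(1)] dup_labelsD(3,4)[OF n irrs mem(2)] in simp)
    note qc = quasichar_eq[OF this]
    show ?thesis
      unfolding dup_amp_gram[OF n irrs gs mem(1,2)]
    proof (cases "?eq q' q")
      case True
      show "(\<Sum>\<mu>\<in>wt S (fst x). if ?eq q' q then
          \<Sum>zs\<in>wts S (leaves (fst q)). cnj (tree_inj S (fst q') zs \<mu>) *
            (\<Sum>us\<in>wts S (leaves (fst q)). reps S (leaves (fst q)) gs zs us * tree_inj S (fst q) us \<mu>)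
          else 0) = (if ?eq q' q then quasichar S (fst q) (fst q') gs else 0)"
        unfolding if_P[OF True] qc[OF True] mem(4) ..
    next
      case False
      show "(\<Sum>\<mu>\<in>wt S (fst x). if ?eq q' q then
          \<Sum>zs\<in>wts S (leaves (fst q)). cnj (tree_inj S (fst q') zs \<mu>) *
            (\<Sum>us\<in>wts S (leaves (fst q)). reps S (leaves (fst q)) gs zs us * tree_inj S (fst q) us \<mu>)
          else 0) = (if ?eq q' q then quasichar S (fst q) (fst q') gs else 0)"
        unfolding if_not_P[OF False] by simp
    qed
  qed
  have "quasichar S \<alpha>1 \<alpha>1' gs * quasichar S \<alpha>2 \<alpha>2' gs =
      (\<Sum>x\<in>?K. \<Sum>\<mu>\<in>wt S (fst x). \<Sum>u\<in>?U. cnj (\<Sum>q'\<in>Q x. ?R' x q' * ?F q' u \<mu>) *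
        (\<Sum>v\<in>?U. ?P u v * (\<Sum>q\<in>Q x. ?R x q * ?F q v \<mu>)))"
    unfolding quasichar_mult[OF c1 c2 gs] Q
    using join_expansion[OF lab(1,2)] join_expansion[OF lab(3,4), unfolded same]
    by (intro sum.cong refl arg_cong2[where f = "(*)"] arg_cong[where f = cnj]) auto
  also have "\<dots> = (\<Sum>x\<in>?K. \<Sum>\<mu>\<in>wt S (fst x). \<Sum>q'\<in>Q x. \<Sum>q\<in>Q x. cnj (?R' x q') * ?R x q * ?G q' q \<mu>)"
  proof (intro sum.cong refl)
    fix x \<mu>
    have "(\<Sum>u\<in>?U. cnj (\<Sum>q'\<in>Q x. ?R' x q' * ?F q' u \<mu>) *
        (\<Sum>v\<in>?U. ?P u v * (\<Sum>q\<in>Q x. ?R x q * ?F q v \<mu>))) =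
        (\<Sum>u\<in>?U. (\<Sum>q'\<in>Q x. cnj (?R' x q') * cnj (?F q' u \<mu>)) *
          (\<Sum>q\<in>Q x. ?R x q * (\<Sum>v\<in>?U. ?P u v * ?F q v \<mu>)))"
    proof (intro sum.cong refl arg_cong2[where f = "(*)"])
      fix u
      show "(\<Sum>v\<in>?U. ?P u v * (\<Sum>q\<in>Q x. ?R x q * ?F q v \<mu>)) =
          (\<Sum>q\<in>Q x. ?R x q * (\<Sum>v\<in>?U. ?P u v * ?F q v \<mu>))"
        unfolding sum_distrib_left mult.left_commute[of "?R x _"] by (rule sum.swap)
    qed simp
    also have "\<dots> = (\<Sum>u\<in>?U. \<Sum>q'\<in>Q x. \<Sum>q\<in>Q x. cnj (?R' x q') * ?R x q *
        (cnj (?F q' u \<mu>) * (\<Sum>v\<in>?U. ?P u v * ?F q v \<mu>)))"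
      unfolding sum_product by (intro sum.cong refl) (simp only: ac_simps)
    also have "\<dots> = (\<Sum>q'\<in>Q x. \<Sum>q\<in>Q x. \<Sum>u\<in>?U. cnj (?R' x q') * ?R x q *
        (cnj (?F q' u \<mu>) * (\<Sum>v\<in>?U. ?P u v * ?F q v \<mu>)))"
      by (rule sum_rotate)
    finally show "(\<Sum>u\<in>?U. cnj (\<Sum>q'\<in>Q x. ?R' x q' * ?F q' u \<mu>) *
        (\<Sum>v\<in>?U. ?P u v * (\<Sum>q\<in>Q x. ?R x q * ?F q v \<mu>))) =
        (\<Sum>q'\<in>Q x. \<Sum>q\<in>Q x. cnj (?R' x q') * ?R x q * ?G q' q \<mu>)"
      by (simp only: sum_distrib_left[of "cnj _ * _"])
  qed
  also have "\<dots> = (\<Sum>x\<in>?K. \<Sum>q'\<in>Q x. \<Sum>q\<in>Q x. cnj (?R' x q') * ?R x q * (\<Sum>\<mu>\<in>wt S (fst x). ?G q' q \<mu>))"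
    unfolding sum_distrib_left[of "cnj _ * _" _ "wt S _"] by (intro sum.cong refl sum_rotate)
  also have "\<dots> = (\<Sum>x\<in>?K. \<Sum>q'\<in>Q x. \<Sum>q\<in>Q x.
      if ?eq q' q then R_join_dup S T \<alpha>1' \<alpha>2' (snd x) (fst q') (snd q') *
        quasichar S (fst q) (fst q') gs * ?R x q else 0)"
  proof (intro sum.cong refl)
    fix x q' q assume x: "x \<in> ?K" and q': "q' \<in> Q x" and q: "q \<in> Q x"
    \<comment> \<open>Conjugation of the bra coefficient turns it into the coefficient with upper
      index in the join, as the product formula requires.\<close>
    have R': "R_join_dup S T \<alpha>1' \<alpha>2' (snd x) (fst q') (snd q') = cnj (?R' x q')"
      using dup_join_overlap(2)[OF lab(3,4), unfolded same] x q' Q by auto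
    show "cnj (?R' x q') * ?R x q * (\<Sum>\<mu>\<in>wt S (fst x). ?G q' q \<mu>) =
        (if ?eq q' q then R_join_dup S T \<alpha>1' \<alpha>2' (snd x) (fst q') (snd q') *
          quasichar S (fst q) (fst q') gs * ?R x q else 0)"
    proof (cases "?eq q' q")
      case True
      show ?thesis unfolding G[OF q' q] R' if_P[OF True] by (simp only: ac_simps)
    next
      case False
      show ?thesis unfolding G[OF q' q] if_not_P[OF False] by simp
    qed
  qed
  finally show ?thesis .
qed

text \<open>Only reindexing is left. Surviving triples \<open>(x, q', q)\<close> have equal second
  components \<open>ks\<close>, and the weight in \<open>x\<close> is the common root weight, so
  they carry the same data as \<open>(\<alpha>, \<alpha>', ks, k)\<close>.\<close>

lemma quasichar_mult_recoupling:
  assumes c1: "combinable S T \<alpha>1 \<alpha>1'" and c2: "combinable S T \<alpha>2 \<alpha>2'"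
    and gs: "length gs = num_leaves T" "set gs \<subseteq> carrier (grp S)"
  shows "quasichar S \<alpha>1 \<alpha>1' gs * quasichar S \<alpha>2 \<alpha>2' gs =
    (\<Sum>(\<alpha>, \<alpha>', ks, k) \<in> {(\<alpha>, \<alpha>', ks, k). combinable S T \<alpha> \<alpha>' \<and>
                                (\<alpha>, ks, k) \<in> coupled_labs S T \<alpha>1 \<alpha>2}.
       R_join_dup S T \<alpha>1' \<alpha>2' k \<alpha>' ks * quasichar S \<alpha> \<alpha>' gs * R_dup_join S T \<alpha>1 \<alpha>2 k \<alpha> ks)"
proof -
  have lab: "\<alpha>1 \<in> labellings S T" "\<alpha>2 \<in> labellings S T"
    using c1 c2 by (auto simp: combinable_def labellings_with_def)
  then have n: "num_leaves \<alpha>1 = num_leaves T" "num_leaves \<alpha>2 = num_leaves T"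
    and irrs: "set (leaves \<alpha>1) \<subseteq> irr S" "set (leaves \<alpha>2) \<subseteq> irr S"
    and irr: "root_weight \<alpha>1 \<in> irr S" "root_weight \<alpha>2 \<in> irr S"
    using labellingsD by blast+
  let ?K = "coupled S (root_weight \<alpha>1) (root_weight \<alpha>2)"
  define Q where "Q x = {q \<in> dup_labels T (leaves \<alpha>1) (leaves \<alpha>2). root_weight (fst q) = fst x}"
    for x :: "'l \<times> nat"
  define eq where "eq q' q \<longleftrightarrow> leaves (fst q') = leaves (fst q) \<and> snd q' = snd q"
    for q' q :: "'l labelling \<times> (nat, unit) btree"
  define h where "h x q' q = R_join_dup S T \<alpha>1' \<alpha>2' (snd x) (fst q') (snd q') *
      quasichar S (fst q) (fst q') gs * R_dup_join S T \<alpha>1 \<alpha>2 (snd x) (fst q) (snd q)" for x :: "'l \<times> nat" and q' q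
  let ?I = "{z \<in> Sigma ?K (\<lambda>x. Q x \<times> Q x). eq (fst (snd z)) (snd (snd z))}"
  \<comment> \<open>The coupling conditions are imposed on \<open>\<alpha>\<close> only; they pass
    to \<open>\<alpha>'\<close> because combinable labellings agree in leaves and root
    weight.\<close>
  have key: "combinable S T \<alpha> \<alpha>' \<and> (\<alpha>, ks, k) \<in> coupled_labs S T \<alpha>1 \<alpha>2 \<longleftrightarrow>
      (root_weight \<alpha>, k) \<in> ?K \<and> (\<alpha>', ks) \<in> Q (root_weight \<alpha>, k) \<and> (\<alpha>, ks) \<in> Q (root_weight \<alpha>, k) \<and>
      eq (\<alpha>', ks) (\<alpha>, ks)" (is "?l \<longleftrightarrow> ?r") for \<alpha> \<alpha>' ks k
  proof -
    have comb: "combinable S T \<alpha> \<alpha>' \<longleftrightarrow> \<alpha> \<in> labellings S T \<and> \<alpha>' \<in> labellings S T \<and>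
        leaves \<alpha>' = leaves \<alpha> \<and> root_weight \<alpha>' = root_weight \<alpha>"
      by (auto simp only: combinable_def labellings_with_def mem_Collect_eq)
    have mem: "(\<beta>, ks) \<in> dup_labels T (leaves \<alpha>1) (leaves \<alpha>2) \<longleftrightarrow> \<beta> \<in> labellings S T \<and> tree_of ks = T \<and>
        (\<forall>i<num_leaves T. (leaves \<beta> ! i, leaves ks ! i) \<in> coupled S (leaves \<alpha>1 ! i) (leaves \<alpha>2 ! i))" for \<beta>
      by (simp add: dup_labels_def)
    have "(\<alpha>, ks, k) \<in> coupled_labs S T \<alpha>1 \<alpha>2 \<longleftrightarrow>
        (\<alpha>, ks) \<in> dup_labels T (leaves \<alpha>1) (leaves \<alpha>2) \<and> (root_weight \<alpha>, k) \<in> ?K"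
      unfolding mem by (simp add: coupled_labs_def)
    then show ?thesis
      unfolding comb Q_def eq_def mem_Collect_eq fst_conv snd_conv mem by metis
  qed
  have finQ: "finite (Q x)" for x
    unfolding Q_def using finite_dup_labels[OF n irrs] by simp
  have finK: "finite ?K" by (rule finite_coupled[OF irr])
  have "quasichar S \<alpha>1 \<alpha>1' gs * quasichar S \<alpha>2 \<alpha>2' gs =
      (\<Sum>x\<in>?K. \<Sum>p\<in>Q x \<times> Q x. if eq (fst p) (snd p) then h x (fst p) (snd p) else 0)"
    unfolding quasichar_mult_expansion[OF c1 c2 gs Q_def] eq_def h_def
    by (simp add: sum.cartesian_product case_prod_beta')
  also have "\<dots> = (\<Sum>z\<in>Sigma ?K (\<lambda>x. Q x \<times> Q x).
      if eq (fst (snd z)) (snd (snd z)) then h (fst z) (fst (snd z)) (snd (snd z)) else 0)"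
    using finK finQ by (subst sum.Sigma) (auto simp: case_prod_beta')
  also have "\<dots> = (\<Sum>z\<in>?I. h (fst z) (fst (snd z)) (snd (snd z)))"
    by (rule sum.inter_filter[symmetric]) (use finK finQ in auto)
  also have "\<dots> = (\<Sum>(\<alpha>, \<alpha>', ks, k) \<in> {(\<alpha>, \<alpha>', ks, k). combinable S T \<alpha> \<alpha>' \<and>
        (\<alpha>, ks, k) \<in> coupled_labs S T \<alpha>1 \<alpha>2}.
      R_join_dup S T \<alpha>1' \<alpha>2' k \<alpha>' ks * quasichar S \<alpha> \<alpha>' gs * R_dup_join S T \<alpha>1 \<alpha>2 k \<alpha> ks)"
  proof (rule sum.reindex_bij_witness[where
        i = "\<lambda>(\<alpha>, \<alpha>', ks, k). ((root_weight \<alpha>, k), (\<alpha>', ks), (\<alpha>, ks))" and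
        j = "\<lambda>(x, q', q). (fst q, fst q', snd q, snd x)"])
    fix z assume "z \<in> ?I"
    then obtain \<Lambda> k q' \<alpha> ks where z: "z = ((\<Lambda>, k), q', (\<alpha>, ks))"
      and in_K: "(\<Lambda>, k) \<in> ?K" and in_Q: "q' \<in> Q (\<Lambda>, k)" "(\<alpha>, ks) \<in> Q (\<Lambda>, k)"
      and eq': "eq q' (\<alpha>, ks)" by auto
    obtain \<alpha>' where q': "q' = (\<alpha>', ks)" using eq' by (cases q') (simp add: eq_def)
    have \<Lambda>: "\<Lambda> = root_weight \<alpha>" using in_Q by (simp add: Q_def)
    show "(\<lambda>(\<alpha>, \<alpha>', ks, k). ((root_weight \<alpha>, k), (\<alpha>', ks), (\<alpha>, ks)))
        ((\<lambda>(x, q', q). (fst q, fst q', snd q, snd x)) z) = z"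
      by (simp add: z q' \<Lambda>)
    show "(\<lambda>(x, q', q). (fst q, fst q', snd q, snd x)) z \<in> {(\<alpha>, \<alpha>', ks, k). combinable S T \<alpha> \<alpha>' \<and>
        (\<alpha>, ks, k) \<in> coupled_labs S T \<alpha>1 \<alpha>2}"
      using key[of \<alpha> \<alpha>' ks k] in_K in_Q eq' by (simp add: z q' \<Lambda>)
    show "(case (\<lambda>(x, q', q). (fst q, fst q', snd q, snd x)) z of (\<alpha>, \<alpha>', ks, k) \<Rightarrow>
        R_join_dup S T \<alpha>1' \<alpha>2' k \<alpha>' ks * quasichar S \<alpha> \<alpha>' gs * R_dup_join S T \<alpha>1 \<alpha>2 k \<alpha> ks) =
        h (fst z) (fst (snd z)) (snd (snd z))"
      by (simp add: z q' h_def)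
  next
    fix y assume y: "y \<in> {(\<alpha>, \<alpha>', ks, k). combinable S T \<alpha> \<alpha>' \<and>
        (\<alpha>, ks, k) \<in> coupled_labs S T \<alpha>1 \<alpha>2}"
    obtain \<alpha> \<alpha>' ks k where y': "y = (\<alpha>, \<alpha>', ks, k)" by (cases y)
    show "(\<lambda>(x, q', q). (fst q, fst q', snd q, snd x))
        ((\<lambda>(\<alpha>, \<alpha>', ks, k). ((root_weight \<alpha>, k), (\<alpha>', ks), (\<alpha>, ks))) y) = y"
      by (simp add: y')
    show "(\<lambda>(\<alpha>, \<alpha>', ks, k). ((root_weight \<alpha>, k), (\<alpha>', ks), (\<alpha>, ks))) y \<in> ?I"
      using y key[of \<alpha> \<alpha>' ks k] by (simp add: y')
  qed
  finally show ?thesis .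
qed

end

theorem corollary3p10:
  fixes S :: "('g, 'l, 'm) coupling_data"
    and X :: "'g topology" and n :: nat and A :: "'g chart set"
    and N :: nat and T :: coupling_tree
    and \<alpha>1 \<alpha>1' \<alpha>2 \<alpha>2' :: "'l labelling"
    and gs :: "'g list"
  assumes "compact_lie_group (grp S) X n A"
    and "coupling_system S X"
    and "N \<ge> 2" and "num_leaves T = N"
    and "combinable S T \<alpha>1 \<alpha>1'" and "combinable S T \<alpha>2 \<alpha>2'"
    and "length gs = N" and "set gs \<subseteq> carrier (grp S)"
  shows "quasichar S \<alpha>1 \<alpha>1' gs * quasichar S \<alpha>2 \<alpha>2' gs =
    (\<Sum>(\<alpha>, \<alpha>', ks, k) \<in> {(\<alpha>, \<alpha>', ks, k). combinable S T \<alpha> \<alpha>' \<and>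
                                (\<alpha>, ks, k) \<in> coupled_labs S T \<alpha>1 \<alpha>2}.
       R_join_dup S T \<alpha>1' \<alpha>2' k \<alpha>' ks * quasichar S \<alpha> \<alpha>' gs * R_dup_join S T \<alpha>1 \<alpha>2 k \<alpha> ks)"
proof -
  interpret compact_lie_group "grp S" X n A by fact
  interpret coupling S X by unfold_locales fact
  show ?thesis using quasichar_mult_recoupling assms by blast
qed

end
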